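(* (I) There exist $Q(s,x)\in C^\infty([0,1]^2)$ with $Q(s,x)>0$ for all $(s,x)\in[0,1]^2$ and $Q(s,x)=1$ for all $s\ge 1/3$, and $b\in C^\infty_{\mathrm{cpt}}([0,1/3))$ with $b\not\equiv 0$, such that $$\int_0^1 e^{-s/x}\,Q(s,x)\,b(s)\,ds=0\quad\text{for all sufficiently small } x>0.$$ (II) Let $G(t,x)\in L^\infty([0,1]^2)$ and $b(t,s)\in C([0,1]^2)$ with $b(t,0)>0$ for all $t\in[0,1]$ and $\partial_s b(t,s)\in C([0,1]^2)$. For $t\in[0,1]$ and $x\in(0,1]$ set $$Q(t,x):=\frac1x\int_0^1 e^{-s/x}\,b(t,s)\,ds+e^{-1/x}G(t,x).$$ Suppose $a\in L^1([0,1])$ satisfies $$\int_0^1 e^{-t/x}\,Q(t,x)\,a(t)\,dt=O(e^{-1/x})\quad\text{for } 1/x\in\mathbb N,$$ that is, there is a constant $C$ such that the absolute value of the left-hand side is at most $Ce^{-1/x}$ for every $x=1/n$, $n\in\{1,2,3,\dots\}$. Then $a=0$ almost everywhere on $[0,1]$.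
   Context: Functions are real-valued. $C^\infty([0,1]^2)$ denotes functions smooth up to the boundary. $C^\infty_{\mathrm{cpt}}([0,1/3))$ denotes smooth functions (up to the endpoint $0$) whose support is a compact subset of $[0,1/3)$; such a function is extended by $0$ to $[0,1]$, and is not required to vanish near $0$. In part (II), $G$ is understood as an everywhere-defined bounded function on $[0,1]^2$ such that $t\mapsto G(t,x)$ is measurable for each $x$, so that $Q(t,x)$ can be evaluated at $x=1/n$. *)

theory Defs
  imports "HOL-Analysis.Analysis"
begin

text \<open>
  \<open>C\<^sup>k\<close> up to the boundary, by derivatives relative to \<open>S\<close> (one-sided at the boundary).  In the
  step, \<open>\<lambda>x. f' x v\<close> is the directional derivative of \<open>f\<close> along the fixed vector \<open>v\<close>.  This is
  meant for convex \<open>S\<close> with nonempty interior: there derivatives relative to \<open>S\<close> are unique, and the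
  condition says that all partial derivatives of order at most \<open>k\<close> exist in the interior and extend
  continuously to \<open>S\<close>.
\<close>

primrec Ck_on ::
  "nat \<Rightarrow> 'a::euclidean_space set \<Rightarrow> ('a \<Rightarrow> 'b::real_normed_vector) \<Rightarrow> bool" where
  "Ck_on 0 S f \<longleftrightarrow> continuous_on S f"
| "Ck_on (Suc k) S f \<longleftrightarrow>
     (\<exists>f'. (\<forall>x\<in>S. (f has_derivative f' x) (at x within S)) \<and> (\<forall>v. Ck_on k S (\<lambda>x. f' x v)))"

definition smooth_on ::
  "'a::euclidean_space set \<Rightarrow> ('a \<Rightarrow> 'b::real_normed_vector) \<Rightarrow> bool" where
  "smooth_on S f \<longleftrightarrow> (\<forall>k. Ck_on k S f)"

text \<open>
  The support is the closure taken in \<open>S\<close>, so \<open>f\<close> need not vanish at those boundary points of \<open>S\<close>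
  that belong to \<open>S\<close>.  The last conjunct is the extension by zero outside \<open>S\<close>.
\<close>

definition smooth_cpt_on ::
  "'a::euclidean_space set \<Rightarrow> ('a \<Rightarrow> 'b::real_normed_vector) \<Rightarrow> bool" where
  "smooth_cpt_on S f \<longleftrightarrow>
     smooth_on S f \<and> compact (S \<inter> closure {x \<in> S. f x \<noteq> 0}) \<and> (\<forall>x. x \<notin> S \<longrightarrow> f x = 0)"

end

theory Submission
  imports Defs
begin

text \<open>
  Part (I).  The function \<open>b\<close> (\<open>signal\<close>) is a sum of wave packets \<open>exp (- (2 ^ j / 2)) * B j s\<close> (\<open>packet\<close>)
  with disjoint supports near \<open>s = 1 / (8 * 2 ^ j)\<close>, accumulating at \<open>0\<close>.  Each \<open>B j\<close> is a normalised \<open>4 ^ j\<close>-fold difference of a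
  narrow bump.  Therefore its moments of order below \<open>4 ^ j\<close> vanish, and its Laplace transform is smaller
  than any exponential in \<open>2 ^ j\<close> for \<open>x\<close> comparable to \<open>1 / 4 ^ j\<close>; but the energy \<open>E j\<close>, the
  integral of \<open>(B j s)\<^sup>2\<close>, is only polynomially small in \<open>2 ^ j\<close> (\<open>energy_lower\<close>).

  Let \<open>I x\<close> be the integral of \<open>exp (- s / x) * b s\<close>.  For \<open>x\<close> comparable to \<open>1 / 4 ^ j\<close> and \<open>s\<close> in the support of
  \<open>B j\<close>, the quantity \<open>exp (s / x) * I x\<close> is \<open>O(exp (- (2 ^ j)))\<close> (\<open>laplace_bound\<close>): the packets \<open>i < j\<close> lie to
  the right of \<open>s\<close> and are damped, and the packets \<open>i \<ge> j\<close> cancel themselves by their moments.  So the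
  \<open>j\<close>-th packet alone can cancel the whole integral at the cost of a tiny change of the weight.  With
  a partition of unity \<open>\<rho> j x\<close>, where \<open>\<rho> j\<close> lives at \<open>x\<close> comparable to \<open>1 / 4 ^ j\<close>, put

    \<open>Q (s, x) = 1 - (\<Sum>j\<ge>J. \<rho> j x * B j s * exp (s / x) * I x / (exp (- (2 ^ j / 2)) * E j))\<close>.

  Multiplying by \<open>exp (- s / x) * b s\<close> and integrating gives \<open>I x * (1 - (\<Sum>j\<ge>J. \<rho> j x))\<close>, which is \<open>0\<close> for small \<open>x\<close>.
  The \<open>j\<close>-th summand is at most \<open>exp (- (2 ^ j / 2))\<close> times a power of \<open>2 ^ j\<close>, and every derivative in \<open>s\<close> or \<open>x\<close>
  costs only further powers of \<open>2 ^ j\<close> (\<open>wave_Ck_sum\<close>).  So \<open>Q\<close> is smooth up to the origin, and it is positive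
  when \<open>J\<close> is large.

  Part (II).  Here the weight is a Laplace transform, so with \<open>w = t + s\<close> the integral of
  \<open>exp (- t / x) * Q (t, x) * a t\<close> is, up to \<open>O(exp (- 1 / x))\<close>, the integral of \<open>exp (- w / x) * F w\<close> divided by \<open>x\<close>,
  where \<open>F w\<close> is the integral of \<open>a t * b (t, w - t)\<close> in \<open>t\<close>.  A theorem of Mikusinski on moments
  (\<open>exp_decay_moments_imp_zero\<close>) shows that the integral of \<open>F\<close> over \<open>[0, c]\<close> vanishes for all \<open>c < 1\<close>, so \<open>F = 0\<close> on
  \<open>[0, 1)\<close>.  This is a Volterra equation of the first
  kind for \<open>a\<close>.  As \<open>b (t, 0) > 0\<close> and \<open>b\<close> is differentiable in \<open>s\<close>, it can be differentiated into an equation of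
  the second kind, and Gronwall's inequality gives \<open>a = 0\<close> almost everywhere (\<open>volterra_unique\<close>).
\<close>

section \<open>Families with polynomially growing derivatives\<close>

text \<open>The scale \<open>2 ^ j\<close> is fixed throughout: the \<open>j\<close>-th building block lives at distance about \<open>1 / 2 ^ j\<close>
  from \<open>0\<close>, and every loss in the estimates has to be polynomial in \<open>2 ^ j\<close>, because only factors
  such as \<open>exp (- (2 ^ j / 2))\<close> are available to compensate it.\<close>

definition poly_bounded :: "(nat \<Rightarrow> real) \<Rightarrow> bool" where
  "poly_bounded g \<longleftrightarrow> (\<exists>C d. \<forall>j. \<bar>g j\<bar> \<le> C * (2 ^ j) ^ d)"

lemma poly_boundedI: "(\<And>j. \<bar>g j\<bar> \<le> C * (2 ^ j) ^ d) \<Longrightarrow> poly_bounded g"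
  unfolding poly_bounded_def by blast

lemma poly_boundedE:
  assumes "poly_bounded g"
  obtains C d where "C \<ge> 0" "\<And>j. \<bar>g j\<bar> \<le> C * (2 ^ j) ^ d"
proof -
  obtain C d where *: "\<And>j. \<bar>g j\<bar> \<le> C * (2 ^ j) ^ d"
    using assms unfolding poly_bounded_def by blast
  have "\<bar>g j\<bar> \<le> \<bar>C\<bar> * (2 ^ j) ^ d" for j
    by (rule order_trans[OF *]) (intro mult_right_mono, auto)
  then show ?thesis using that[of "\<bar>C\<bar>" d] by auto
qed

lemma poly_bounded_const: "poly_bounded (\<lambda>_. c)"
  by (rule poly_boundedI[of _ "\<bar>c\<bar>" 0]) simp

lemma poly_bounded_two_power: "poly_bounded (\<lambda>j. 2 ^ j)"
  by (rule poly_boundedI[of _ 1 1]) simp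

lemma poly_bounded_add:
  assumes "poly_bounded f" "poly_bounded g" shows "poly_bounded (\<lambda>j. f j + g j)"
proof -
  obtain C d where C: "C \<ge> 0" "\<And>j. \<bar>f j\<bar> \<le> C * (2 ^ j) ^ d" using assms(1) poly_boundedE by blast
  obtain D e where D: "D \<ge> 0" "\<And>j. \<bar>g j\<bar> \<le> D * (2 ^ j) ^ e" using assms(2) poly_boundedE by blast
  have "\<bar>f j + g j\<bar> \<le> (C + D) * (2 ^ j) ^ (d + e)" for j
  proof -
    have "C * (2 ^ j) ^ d \<le> C * (2 ^ j) ^ (d + e)" "D * (2 ^ j) ^ e \<le> D * (2 ^ j) ^ (d + e)"
      using C D by (auto intro!: mult_left_mono power_increasing)
    then show ?thesis using C(2)[of j] D(2)[of j] by (simp add: distrib_right)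
  qed
  then show ?thesis by (rule poly_boundedI)
qed

lemma poly_bounded_mult:
  assumes "poly_bounded f" "poly_bounded g" shows "poly_bounded (\<lambda>j. f j * g j)"
proof -
  obtain C d where C: "C \<ge> 0" "\<And>j. \<bar>f j\<bar> \<le> C * (2 ^ j) ^ d" using assms(1) poly_boundedE by blast
  obtain D e where D: "D \<ge> 0" "\<And>j. \<bar>g j\<bar> \<le> D * (2 ^ j) ^ e" using assms(2) poly_boundedE by blast
  have "\<bar>f j * g j\<bar> \<le> (C * D) * (2 ^ j) ^ (d + e)" for j
  proof -
    have "\<bar>f j\<bar> * \<bar>g j\<bar> \<le> (C * (2 ^ j) ^ d) * (D * (2 ^ j) ^ e)"
      using C D by (intro mult_mono) auto
    then show ?thesis by (simp add: abs_mult power_add mult_ac)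
  qed
  then show ?thesis by (rule poly_boundedI)
qed

lemma poly_bounded_mono:
  assumes "poly_bounded g" "\<And>j. \<bar>f j\<bar> \<le> \<bar>g j\<bar>" shows "poly_bounded f"
  using assms unfolding poly_bounded_def by (meson order_trans)

lemma poly_bounded_power:
  assumes "poly_bounded g" shows "poly_bounded (\<lambda>j. g j ^ n)"
  by (induction n) (auto intro: poly_bounded_const poly_bounded_mult assms)

definition controlled :: "(nat \<Rightarrow> real set) \<Rightarrow> (nat \<Rightarrow> real \<Rightarrow> real) \<Rightarrow> bool" where
  "controlled S u \<longleftrightarrow>
     (\<exists>g. poly_bounded g \<and> (\<forall>j s. \<bar>u j s\<bar> \<le> g j)) \<and> (\<forall>j s. s \<notin> S j \<longrightarrow> u j s = 0)"

lemma controlledI: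
  "poly_bounded g \<Longrightarrow> (\<And>j s. \<bar>u j s\<bar> \<le> g j) \<Longrightarrow> (\<And>j s. s \<notin> S j \<Longrightarrow> u j s = 0) \<Longrightarrow> controlled S u"
  unfolding controlled_def by blast

lemma controlledE:
  assumes "controlled S u"
  obtains g where "poly_bounded g" "\<And>j s. \<bar>u j s\<bar> \<le> g j" "\<And>j. g j \<ge> 0" "\<And>j s. s \<notin> S j \<Longrightarrow> u j s = 0"
  using assms unfolding controlled_def by (meson abs_ge_zero order_trans)

lemma controlled_mono: "controlled S u \<Longrightarrow> (\<And>j. S j \<subseteq> T j) \<Longrightarrow> controlled T u"
  unfolding controlled_def by blast

lemma controlled_add:
  assumes "controlled S u" "controlled S v" shows "controlled S (\<lambda>j s. u j s + v j s)"
proof -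
  obtain g where g: "poly_bounded g" "\<And>j s. \<bar>u j s\<bar> \<le> g j" "\<And>j s. s \<notin> S j \<Longrightarrow> u j s = 0"
    using controlledE[OF assms(1)] by metis
  obtain k where k: "poly_bounded k" "\<And>j s. \<bar>v j s\<bar> \<le> k j" "\<And>j s. s \<notin> S j \<Longrightarrow> v j s = 0"
    using controlledE[OF assms(2)] by metis
  have "\<bar>u j s + v j s\<bar> \<le> g j + k j" for j s
    using g(2)[of j s] k(2)[of j s] by linarith
  then show ?thesis
    by (rule controlledI[OF poly_bounded_add[OF g(1) k(1)]]) (simp_all add: g k)
qed

lemma controlled_mult:
  assumes "controlled S u" "controlled T v"
  shows "controlled (\<lambda>j. S j \<inter> T j) (\<lambda>j s. u j s * v j s)"
proof -
  obtain g where g: "poly_bounded g" "\<And>j s. \<bar>u j s\<bar> \<le> g j" "\<And>j. g j \<ge> 0" "\<And>j s. s \<notin> S j \<Longrightarrow> u j s = 0"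
    using controlledE[OF assms(1)] by metis
  obtain k where k: "poly_bounded k" "\<And>j s. \<bar>v j s\<bar> \<le> k j" "\<And>j. k j \<ge> 0" "\<And>j s. s \<notin> T j \<Longrightarrow> v j s = 0"
    using controlledE[OF assms(2)] by metis
  have "\<bar>u j s * v j s\<bar> \<le> g j * k j" for j s
    unfolding abs_mult by (intro mult_mono g k) auto
  then show ?thesis
    by (rule controlledI[OF poly_bounded_mult[OF g(1) k(1)]]) (use g(4) k(4) in force)
qed

text \<open>The bound on \<open>w\<close> is asked for on the supports only, since the factors of interest, such as
  \<open>1 / s\<close>, are unbounded near \<open>0\<close>.\<close>

lemma controlled_scale:
  assumes "controlled S u" "poly_bounded g" "\<And>j s. s \<in> S j \<Longrightarrow> \<bar>w j s\<bar> \<le> g j"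
  shows "controlled S (\<lambda>j s. w j s * u j s)"
proof -
  obtain k where k: "poly_bounded k" "\<And>j s. \<bar>u j s\<bar> \<le> k j" "\<And>j. k j \<ge> 0" "\<And>j s. s \<notin> S j \<Longrightarrow> u j s = 0"
    using controlledE[OF assms(1)] by metis
  have pb: "poly_bounded (\<lambda>j. \<bar>g j\<bar> * k j)"
    by (rule poly_bounded_mult[OF poly_bounded_mono[OF assms(2)] k(1)]) simp
  have "\<bar>w j s * u j s\<bar> \<le> \<bar>g j\<bar> * k j" for j s
  proof (cases "s \<in> S j")
    case True
    have "\<bar>w j s\<bar> \<le> \<bar>g j\<bar>" using assms(3)[OF True] by linarith
    then show ?thesis unfolding abs_mult by (intro mult_mono k) auto
  qed (simp add: k)
  then show ?thesis by (rule controlledI[OF pb]) (simp add: k)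
qed

text \<open>Families whose derivatives up to order \<open>n\<close> all vanish outside the prescribed sets and lose at most
  powers of \<open>2 ^ j\<close>.  The recursion on \<open>n\<close> lets closure properties be proved without a Leibniz
  formula: one derivative at a time is enough.\<close>

primrec tame :: "nat \<Rightarrow> (nat \<Rightarrow> real set) \<Rightarrow> (nat \<Rightarrow> real \<Rightarrow> real) \<Rightarrow> bool" where
  "tame 0 S u \<longleftrightarrow> controlled S u"
| "tame (Suc n) S u \<longleftrightarrow> controlled S u \<and>
     (\<exists>u'. (\<forall>j s. (u j has_real_derivative u' j s) (at s)) \<and> tame n S u')"

lemma tame_SucI:
  "controlled S u \<Longrightarrow> (\<And>j s. (u j has_real_derivative u' j s) (at s)) \<Longrightarrow> tame n S u' \<Longrightarrow> tame (Suc n) S u"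
  by (simp, blast)

lemma tame_SucE:
  assumes "tame (Suc n) S u"
  obtains u' where "\<And>j s. (u j has_real_derivative u' j s) (at s)" "tame n S u'"
  using assms by auto

lemma tame_imp_controlled: "tame n S u \<Longrightarrow> controlled S u"
  by (cases n) auto

lemma tame_SucD: "tame (Suc n) S u \<Longrightarrow> tame n S u"
  by (induction n arbitrary: u) auto

lemma tame_mono: "tame n S u \<Longrightarrow> (\<And>j. S j \<subseteq> T j) \<Longrightarrow> tame n T u"
  by (induction n arbitrary: u) (auto intro: controlled_mono)

lemma tame_add: "tame n S u \<Longrightarrow> tame n S v \<Longrightarrow> tame n S (\<lambda>j s. u j s + v j s)"
proof (induction n arbitrary: u v)
  case (Suc n)
  obtain u' where u': "\<And>j s. (u j has_real_derivative u' j s) (at s)" "tame n S u'"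
    using tame_SucE[OF Suc.prems(1)] by metis
  obtain v' where v': "\<And>j s. (v j has_real_derivative v' j s) (at s)" "tame n S v'"
    using tame_SucE[OF Suc.prems(2)] by metis
  have "controlled S (\<lambda>j s. u j s + v j s)"
    using Suc.prems by (intro controlled_add) auto
  moreover have "((\<lambda>s. u j s + v j s) has_real_derivative u' j s + v' j s) (at s)" for j s
    by (intro DERIV_add u' v')
  ultimately show ?case using Suc.IH[OF u'(2) v'(2)] by (rule tame_SucI)
qed (simp add: controlled_add)

lemma controlled_cmult:
  assumes "poly_bounded g" "controlled S u" shows "controlled S (\<lambda>j s. g j * u j s)"
  by (rule controlled_scale[where g = "\<lambda>j. \<bar>g j\<bar>"]) (use assms in \<open>auto intro: poly_bounded_mono\<close>)

lemma tame_scale: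
  assumes "poly_bounded g" shows "tame n S u \<Longrightarrow> tame n S (\<lambda>j s. g j * u j s)"
proof (induction n arbitrary: u)
  case (Suc n)
  obtain u' where u': "\<And>j s. (u j has_real_derivative u' j s) (at s)" "tame n S u'"
    using tame_SucE[OF Suc.prems(1)] by metis
  have "controlled S (\<lambda>j s. g j * u j s)"
    using Suc.prems by (intro controlled_cmult assms) auto
  moreover have "((\<lambda>s. g j * u j s) has_real_derivative g j * u' j s) (at s)" for j s
    by (intro DERIV_cmult u')
  ultimately show ?case using Suc.IH[OF u'(2)] by (rule tame_SucI)
qed (simp add: controlled_cmult assms)

lemma tame_mult:
  "tame n S u \<Longrightarrow> tame n T v \<Longrightarrow> tame n (\<lambda>j. S j \<inter> T j) (\<lambda>j s. u j s * v j s)"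
proof (induction n arbitrary: u v)
  case (Suc n)
  obtain u' where u': "\<And>j s. (u j has_real_derivative u' j s) (at s)" "tame n S u'"
    using tame_SucE[OF Suc.prems(1)] by metis
  obtain v' where v': "\<And>j s. (v j has_real_derivative v' j s) (at s)" "tame n T v'"
    using tame_SucE[OF Suc.prems(2)] by metis
  have "tame n (\<lambda>j. S j \<inter> T j) (\<lambda>j s. u' j s * v j s + u j s * v' j s)"
    by (intro tame_add Suc.IH u' v' tame_SucD[OF Suc.prems(1)] tame_SucD[OF Suc.prems(2)])
  moreover have "((\<lambda>s. u j s * v j s) has_real_derivative u' j s * v j s + u j s * v' j s) (at s)" for j s
    by (auto intro!: derivative_eq_intros u' v')
  moreover have "controlled (\<lambda>j. S j \<inter> T j) (\<lambda>j s. u j s * v j s)"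
    using Suc.prems by (intro controlled_mult) auto
  ultimately show ?case by (intro tame_SucI)
qed (simp add: controlled_mult)

text \<open>The supports stay in a bounded set, so the factor \<open>s\<close> costs a constant.\<close>

lemma tame_times_id:
  assumes S: "\<And>j s. s \<in> S j \<Longrightarrow> \<bar>s\<bar> \<le> 1" shows "tame n S u \<Longrightarrow> tame n S (\<lambda>j s. s * u j s)"
proof (induction n arbitrary: u)
  case 0
  show ?case unfolding tame.simps
    by (rule controlled_scale[OF _ poly_bounded_const[of 1]])
       (use 0 S in auto)
next
  case (Suc n)
  obtain u' where u': "\<And>j s. (u j has_real_derivative u' j s) (at s)" "tame n S u'"
    using tame_SucE[OF Suc.prems(1)] by metis
  have c: "controlled S (\<lambda>j s. s * u j s)"
    by (rule controlled_scale[OF _ poly_bounded_const[of 1]])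
       (use tame_imp_controlled[OF Suc.prems] S in auto)
  have "tame n S (\<lambda>j s. u j s + s * u' j s)"
    by (rule tame_add[OF tame_SucD[OF Suc.prems] Suc.IH[OF u'(2)]])
  moreover have "((\<lambda>s. s * u j s) has_real_derivative u j s + s * u' j s) (at s)" for j s
    by (auto intro!: derivative_eq_intros u')
  ultimately show ?case by (intro tame_SucI[OF c])
qed

text \<open>The supports approach \<open>0\<close> at a geometric rate only, so \<open>1 / s\<close> costs a power of \<open>2 ^ j\<close>.  The family
  vanishes near \<open>0\<close> and to the left of it, which makes the quotient differentiable there despite
  the division by zero at \<open>s = 0\<close>.\<close>

lemma tame_divide_id:
  assumes S: "\<And>j. S j \<subseteq> {l j..}" "\<And>j. l j > 0" "poly_bounded (\<lambda>j. 1 / l j)"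
  shows "tame n S u \<Longrightarrow> tame n S (\<lambda>j s. u j s / s)"
proof (induction n arbitrary: u)
  case 0
  have "controlled S (\<lambda>j s. 1 / s * u j s)"
  proof (rule controlled_scale)
    show "\<bar>1 / s\<bar> \<le> 1 / l j" if "s \<in> S j" for j s
      using S(1)[of j] S(2)[of j] that by (auto simp: field_simps)
  qed (use 0 S in auto)
  then show ?case by simp
next
  case (Suc n)
  have "controlled S (\<lambda>j s. 1 / s * u j s)"
  proof (rule controlled_scale)
    show "\<bar>1 / s\<bar> \<le> 1 / l j" if "s \<in> S j" for j s
      using S(1)[of j] S(2)[of j] that by (auto simp: field_simps)
  qed (use Suc.prems S in auto)
  then have c: "controlled S (\<lambda>j s. u j s / s)" by simp
  obtain u' where u': "\<And>j s. (u j has_real_derivative u' j s) (at s)" "tame n S u'"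
    using Suc.prems by auto
  have out: "s \<notin> S j" if "s < l j" for j s using that S(1)[of j] by auto
  have u0: "u j s = 0" if "s < l j" for j s
    using tame_imp_controlled[OF Suc.prems] out[OF that] by (auto simp: controlled_def)
  have u'0: "u' j s = 0" if "s < l j" for j s
    using tame_imp_controlled[OF u'(2)] out[OF that] by (auto simp: controlled_def)
  have d: "((\<lambda>s. u j s / s) has_real_derivative u' j s / s + (- 1) * (u j s / s / s)) (at s)" for j s
  proof (cases "s < l j")
    case True
    have "((\<lambda>_. 0) has_real_derivative 0) (at s)" by simp
    then have "((\<lambda>s. u j s / s) has_real_derivative 0) (at s)"
      by (rule has_field_derivative_transform_within_open[of _ _ _ "{..<l j}"]) (use True u0 in auto)
    then show ?thesis using True by (simp add: u0 u'0)
  next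
    case False
    then have "s > 0" using S(2)[of j] by linarith
    then show ?thesis
      by (auto intro!: derivative_eq_intros u' simp: field_simps)
  qed
  have "tame n S (\<lambda>j s. u' j s / s + (- 1) * (u j s / s / s))"
    by (intro tame_add Suc.IH tame_scale[OF poly_bounded_const] u' tame_SucD[OF Suc.prems])
  with c d show ?case by (intro tame_SucI)
qed

text \<open>Each derivative of a function squeezed to width \<open>h j\<close> costs a factor \<open>1 / h j\<close>.\<close>

lemma tame_affine:
  fixes h :: "nat \<Rightarrow> real"
  assumes "\<And>j. h j > 0" "poly_bounded (\<lambda>j. 1 / h j)"
  shows "tame n (\<lambda>_. {0..1}) (\<lambda>_. f) \<Longrightarrow> tame n (\<lambda>j. {a j..a j + h j}) (\<lambda>j s. f ((s - a j) / h j))"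
proof (induction n arbitrary: f)
  case 0
  obtain g where g: "poly_bounded g" "\<And>s. \<bar>f s\<bar> \<le> g j" "\<And>s. s \<notin> {0..1} \<Longrightarrow> f s = 0" for j
    using 0 by (auto elim!: controlledE)
  have "f ((s - a j) / h j) = 0" if "s \<notin> {a j..a j + h j}" for s j
    by (rule g(3)) (use that assms(1)[of j] in \<open>auto simp: field_simps\<close>)
  then show ?case using g by (auto intro!: controlledI[of g])
next
  case (Suc n)
  obtain g where g: "poly_bounded g" "\<And>s. \<bar>f s\<bar> \<le> g j" "\<And>s. s \<notin> {0..1} \<Longrightarrow> f s = 0" for j
    using Suc.prems by (auto elim!: controlledE)
  have "f ((s - a j) / h j) = 0" if "s \<notin> {a j..a j + h j}" for s j
    by (rule g(3)) (use that assms(1)[of j] in \<open>auto simp: field_simps\<close>)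
  then have c: "controlled (\<lambda>j. {a j..a j + h j}) (\<lambda>j s. f ((s - a j) / h j))"
    using g by (auto intro!: controlledI[of g])
  obtain f' where f': "\<And>s. (f has_real_derivative f' 0 s) (at s)" "\<And>j s. (f has_real_derivative f' j s) (at s)" "tame n (\<lambda>_. {0..1}) f'"
    using Suc.prems by auto
  have "f' j = f' 0" for j using f' DERIV_unique by blast
  then have f'eq: "f' = (\<lambda>_. f' 0)" by auto
  have "tame n (\<lambda>j. {a j..a j + h j}) (\<lambda>j s. 1 / h j * f' 0 ((s - a j) / h j))"
    using f'(3) f'eq by (intro tame_scale[OF assms(2)] Suc.IH) metis
  moreover have "((\<lambda>s. f ((s - a j) / h j)) has_real_derivative 1 / h j * f' 0 ((s - a j) / h j)) (at s)" for j s
  proof -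
    have "((\<lambda>s. (s - a j) / h j) has_real_derivative 1 / h j) (at s)"
      using assms(1)[of j] by (auto intro!: derivative_eq_intros)
    from DERIV_chain2[OF f'(1) this] show ?thesis by (simp add: mult.commute)
  qed
  ultimately show ?case by (intro tame_SucI[OF c])
qed

text \<open>The \<open>N\<close>-fold backward difference, divided by \<open>2 ^ N\<close> so that it does not increase the supremum
  norm, however large \<open>N\<close> is.\<close>

primrec diff_op :: "nat \<Rightarrow> real \<Rightarrow> (real \<Rightarrow> real) \<Rightarrow> real \<Rightarrow> real" where
  "diff_op 0 h f = f"
| "diff_op (Suc N) h f = (\<lambda>s. (diff_op N h f s - diff_op N h f (s - h)) / 2)"

lemma diff_op_bound: "(\<And>s. \<bar>f s\<bar> \<le> g) \<Longrightarrow> \<bar>diff_op N h f s\<bar> \<le> g"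
proof (induction N arbitrary: s)
  case (Suc N)
  from Suc(1)[OF Suc(2), of s] Suc(1)[OF Suc(2), of "s - h"] show ?case by simp
qed simp

lemma diff_op_support:
  assumes "\<And>s. s \<notin> {a..b} \<Longrightarrow> f s = 0" "h \<ge> 0"
  shows "s \<notin> {a..b + real N * h} \<Longrightarrow> diff_op N h f s = 0"
proof (induction N arbitrary: s)
  case (Suc N)
  have "s \<notin> {a..b + real N * h}" "s - h \<notin> {a..b + real N * h}"
    using Suc.prems assms(2) by (auto simp: algebra_simps)
  then show ?case using Suc.IH by simp
qed (use assms in auto)

lemma diff_op_deriv:
  assumes "\<And>s. (f has_real_derivative f' s) (at s)"
  shows "(diff_op N h f has_real_derivative diff_op N h f' s) (at s)"
proof (induction N arbitrary: s)
  case (Suc N)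
  have "((\<lambda>s. diff_op N h f (s - h)) has_real_derivative diff_op N h f' (s - h) * 1) (at s)"
    by (rule DERIV_chain2[OF Suc]) (auto intro!: derivative_eq_intros)
  then show ?case by (auto intro!: derivative_eq_intros Suc)
qed (simp add: assms)

text \<open>The order \<open>N j\<close> may grow with \<open>j\<close> at no cost: a difference commutes with differentiation and is
  an average of translates, up to signs.\<close>

lemma tame_diff_op:
  assumes h: "\<And>j. h j \<ge> 0"
  shows "tame n (\<lambda>j. {a j..b j}) u \<Longrightarrow>
    tame n (\<lambda>j. {a j..b j + real (N j) * h j}) (\<lambda>j. diff_op (N j) (h j) (u j))"
proof (induction n arbitrary: u)
  case 0
  then obtain g where g: "poly_bounded g" "\<And>j s. \<bar>u j s\<bar> \<le> g j" "\<And>j s. s \<notin> {a j..b j} \<Longrightarrow> u j s = 0"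
    by (auto elim!: controlledE)
  show ?case using g h by (auto intro!: controlledI[of g] diff_op_bound diff_op_support simp del: atLeastAtMost_iff)
next
  case (Suc n)
  then obtain g where g: "poly_bounded g" "\<And>j s. \<bar>u j s\<bar> \<le> g j" "\<And>j s. s \<notin> {a j..b j} \<Longrightarrow> u j s = 0"
    by (auto elim!: controlledE)
  have "controlled (\<lambda>j. {a j..b j + real (N j) * h j}) (\<lambda>j. diff_op (N j) (h j) (u j))"
    using g h by (auto intro!: controlledI[of g] diff_op_bound diff_op_support simp del: atLeastAtMost_iff)
  moreover obtain u' where "\<And>j s. (u j has_real_derivative u' j s) (at s)" "tame n (\<lambda>j. {a j..b j}) u'"
    using Suc.prems by auto
  ultimately show ?case by (intro tame_SucI[where u' = "\<lambda>j. diff_op (N j) (h j) (u' j)"] diff_op_deriv Suc.IH)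
qed

section \<open>Smooth sums of families\<close>

definition M_test :: "'a::topological_space set \<Rightarrow> (nat \<Rightarrow> 'a \<Rightarrow> real) \<Rightarrow> bool" where
  "M_test S F \<longleftrightarrow> (\<forall>j. continuous_on S (F j)) \<and>
     (\<exists>M. summable M \<and> (\<forall>j. \<forall>p\<in>S. \<bar>F j p\<bar> \<le> M j))"

lemma M_testI:
  "(\<And>j. continuous_on S (F j)) \<Longrightarrow> summable M \<Longrightarrow> (\<And>j p. p \<in> S \<Longrightarrow> \<bar>F j p\<bar> \<le> M j) \<Longrightarrow> M_test S F"
  unfolding M_test_def by blast

lemma M_testE:
  assumes "M_test S F"
  obtains M where "summable M" "\<And>j p. p \<in> S \<Longrightarrow> \<bar>F j p\<bar> \<le> M j" "\<And>j. continuous_on S (F j)"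
  using assms unfolding M_test_def by blast

lemma M_test_add:
  assumes "M_test S F" "M_test S G" shows "M_test S (\<lambda>j p. F j p + G j p)"
proof -
  obtain M where M: "summable M" "\<And>j p. p \<in> S \<Longrightarrow> \<bar>F j p\<bar> \<le> M j" "\<And>j. continuous_on S (F j)"
    using M_testE[OF assms(1)] by metis
  obtain K where K: "summable K" "\<And>j p. p \<in> S \<Longrightarrow> \<bar>G j p\<bar> \<le> K j" "\<And>j. continuous_on S (G j)"
    using M_testE[OF assms(2)] by metis
  show ?thesis
  proof (rule M_testI[OF _ summable_add[OF M(1) K(1)]])
    show "\<bar>F j p + G j p\<bar> \<le> M j + K j" if "p \<in> S" for j p
      using M(2)[OF that, of j] K(2)[OF that, of j] by linarith
  qed (intro continuous_intros M K)
qed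

lemma M_test_cmult:
  assumes "M_test S F" shows "M_test S (\<lambda>j p. c * F j p)"
proof -
  obtain M where M: "summable M" "\<And>j p. p \<in> S \<Longrightarrow> \<bar>F j p\<bar> \<le> M j" "\<And>j. continuous_on S (F j)"
    using M_testE[OF assms(1)] by metis
  show ?thesis
  proof (rule M_testI[OF _ summable_mult[OF M(1), of "\<bar>c\<bar>"]])
    show "\<bar>c * F j p\<bar> \<le> \<bar>c\<bar> * M j" if "p \<in> S" for j p
      using M(2)[OF that, of j] by (simp add: abs_mult mult_left_mono)
  qed (intro continuous_intros M)
qed

text \<open>The M-test for all derivatives up to order \<open>n\<close>, in the recursive shape of \<open>Ck_on\<close>.\<close>

primrec Ck_sum :: "nat \<Rightarrow> 'a::euclidean_space set \<Rightarrow> (nat \<Rightarrow> 'a \<Rightarrow> real) \<Rightarrow> bool" where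
  "Ck_sum 0 S F \<longleftrightarrow> M_test S F"
| "Ck_sum (Suc n) S F \<longleftrightarrow> M_test S F \<and>
     (\<exists>F'. (\<forall>j. \<forall>p\<in>S. (F j has_derivative F' j p) (at p within S)) \<and>
           (\<forall>v. Ck_sum n S (\<lambda>j p. F' j p v)))"

lemma Ck_sum_imp_M_test: "Ck_sum n S F \<Longrightarrow> M_test S F"
  by (cases n) auto

lemma Ck_sum_SucI:
  "M_test S F \<Longrightarrow> (\<And>j p. p \<in> S \<Longrightarrow> (F j has_derivative F' j p) (at p within S)) \<Longrightarrow>
   (\<And>v. Ck_sum n S (\<lambda>j p. F' j p v)) \<Longrightarrow> Ck_sum (Suc n) S F"
  unfolding Ck_sum.simps by blast

lemma Ck_sum_SucE:
  assumes "Ck_sum (Suc n) S F"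
  obtains F' where "\<And>j p. p \<in> S \<Longrightarrow> (F j has_derivative F' j p) (at p within S)"
    "\<And>v. Ck_sum n S (\<lambda>j p. F' j p v)"
  using assms unfolding Ck_sum.simps by blast

lemma Ck_sum_add: "Ck_sum n S F \<Longrightarrow> Ck_sum n S G \<Longrightarrow> Ck_sum n S (\<lambda>j p. F j p + G j p)"
proof (induction n arbitrary: F G)
  case (Suc n)
  obtain F' where F': "\<And>j p. p \<in> S \<Longrightarrow> (F j has_derivative F' j p) (at p within S)"
      "\<And>v. Ck_sum n S (\<lambda>j p. F' j p v)" using Ck_sum_SucE[OF Suc.prems(1)] by metis
  obtain G' where G': "\<And>j p. p \<in> S \<Longrightarrow> (G j has_derivative G' j p) (at p within S)"
      "\<And>v. Ck_sum n S (\<lambda>j p. G' j p v)" using Ck_sum_SucE[OF Suc.prems(2)] by metis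
  show ?case
  proof (rule Ck_sum_SucI[where F' = "\<lambda>j p v. F' j p v + G' j p v"])
    show "M_test S (\<lambda>j p. F j p + G j p)" using Suc.prems by (intro M_test_add Ck_sum_imp_M_test)
  qed (auto intro: has_derivative_add F' G' Suc.IH)
qed (simp add: M_test_add)

lemma Ck_sum_cmult: "Ck_sum n S F \<Longrightarrow> Ck_sum n S (\<lambda>j p. c * F j p)"
proof (induction n arbitrary: F)
  case (Suc n)
  obtain F' where F': "\<And>j p. p \<in> S \<Longrightarrow> (F j has_derivative F' j p) (at p within S)"
      "\<And>v. Ck_sum n S (\<lambda>j p. F' j p v)" using Ck_sum_SucE[OF Suc.prems] by metis
  show ?case
  proof (rule Ck_sum_SucI[where F' = "\<lambda>j p v. c * F' j p v"])
    show "M_test S (\<lambda>j p. c * F j p)" using Suc.prems by (intro M_test_cmult Ck_sum_imp_M_test)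
  qed (auto intro: has_derivative_mult_right F' Suc.IH)
qed (simp add: M_test_cmult)

lemma M_test_summable:
  assumes "M_test S F" "p \<in> S" shows "summable (\<lambda>j. F j p)"
  using assms by (auto elim!: M_testE intro: summable_comparison_test')

text \<open>Term-by-term differentiation.  The derivative series converges uniformly as a series of linear maps:
  its values on the finitely many basis vectors are dominated by summable sequences, and these bound
  the operator norms.\<close>

lemma Ck_sum_suminf:
  assumes "convex S"
  shows "Ck_sum n S F \<Longrightarrow> Ck_on n S (\<lambda>p. \<Sum>j. F j p)"
proof (induction n arbitrary: F)
  case 0
  obtain M where M: "summable M" "\<And>j p. p \<in> S \<Longrightarrow> \<bar>F j p\<bar> \<le> M j" "\<And>j. continuous_on S (F j)"
    using 0 by (auto elim: M_testE)
  have "uniform_limit S (\<lambda>n p. \<Sum>j<n. F j p) (\<lambda>p. \<Sum>j. F j p) sequentially"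
    by (rule Weierstrass_m_test) (use M in auto)
  then show ?case
  proof (simp, rule uniform_limit_theorem[rotated])
    show "\<forall>\<^sub>F n in sequentially. continuous_on S (\<lambda>p. \<Sum>j<n. F j p)"
      by (intro always_eventually allI continuous_on_sum M)
  qed simp
next
  case (Suc n)
  obtain F' where F': "\<And>j p. p \<in> S \<Longrightarrow> (F j has_derivative F' j p) (at p within S)"
      "\<And>v. Ck_sum n S (\<lambda>j p. F' j p v)" using Ck_sum_SucE[OF Suc.prems] by metis
  have F0: "M_test S F" using Suc.prems by simp
  have lin: "linear (F' j p)" if "p \<in> S" for j p
    using F'(1)[OF that, of j] by (rule has_derivative_linear)
  have "\<forall>v. \<exists>M. summable M \<and> (\<forall>j. \<forall>p\<in>S. \<bar>F' j p v\<bar> \<le> M j)"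
    using F'(2) Ck_sum_imp_M_test unfolding M_test_def by blast
  then obtain M where M: "\<And>v. summable (M v)" "\<And>v j p. p \<in> S \<Longrightarrow> \<bar>F' j p v\<bar> \<le> M v j"
    by metis
  define K where "K = (\<lambda>j. \<Sum>e\<in>Basis. M e j)"
  have K: "summable K" unfolding K_def by (intro summable_sum M)
  have Kb: "\<bar>F' j p v\<bar> \<le> K j * norm v" if "p \<in> S" for j p v
  proof -
    have "F' j p v = F' j p (\<Sum>e\<in>Basis. (v \<bullet> e) *\<^sub>R e)" by (simp add: euclidean_representation)
    also have "\<dots> = (\<Sum>e\<in>Basis. (v \<bullet> e) * F' j p e)"
      using lin[OF that, of j] by (simp add: linear_sum linear_cmul)
    also have "\<bar>\<dots>\<bar> \<le> (\<Sum>e\<in>Basis. norm v * M e j)"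
    proof (rule order_trans[OF sum_abs], rule sum_mono)
      fix e :: 'a assume "e \<in> Basis"
      then show "\<bar>(v \<bullet> e) * F' j p e\<bar> \<le> norm v * M e j"
        unfolding abs_mult by (intro mult_mono Basis_le_norm M that) auto
    qed
    finally show ?thesis by (simp add: K_def sum_distrib_left mult.commute)
  qed
  have sm: "summable (\<lambda>j. F' j p v)" if "p \<in> S" for p v
    using M that by (auto intro: summable_comparison_test'[of "M v"])
  have deriv: "((\<lambda>p. \<Sum>j. F j p) has_derivative (\<lambda>v. \<Sum>j. F' j p v)) (at p within S)" if p: "p \<in> S" for p
  proof -
    have "\<exists>g. \<forall>x\<in>S. (\<lambda>j. F j x) sums g x \<and> (g has_derivative (\<lambda>v. \<Sum>j. F' j x v)) (at x within S)"
    proof (rule has_derivative_series[OF assms F'(1) _ p])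
      show "(\<lambda>j. F j p) sums (\<Sum>j. F j p)"
        using M_test_summable[OF F0 p] by (rule summable_sums)
      fix e :: real assume "e > 0"
      \<comment> \<open>The tail of the dominating series bounds the tails of the derivative series in operator norm.\<close>
      have "\<forall>\<^sub>F n in sequentially. \<bar>(\<Sum>j. K (j + n))\<bar> < e"
        using suminf_exist_split2[OF K] \<open>e > 0\<close> by (auto simp: tendsto_iff dist_real_def)
      then show "\<forall>\<^sub>F n in sequentially. \<forall>x\<in>S. \<forall>h. norm ((\<Sum>i<n. F' i x h) - (\<Sum>j. F' j x h)) \<le> e * norm h"
      proof eventually_elim
        case (elim n)
        show ?case
        proof safe
          fix x h assume x: "x \<in> S"
          have "(\<Sum>i<n. F' i x h) - (\<Sum>j. F' j x h) = - (\<Sum>j. F' (j + n) x h)"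
            using suminf_split_initial_segment[OF sm[OF x, of h], of n] by simp
          also have "norm \<dots> \<le> (\<Sum>j. K (j + n) * norm h)"
            unfolding norm_minus_cancel
            by (rule norm_suminf_le)
               (use Kb[OF x] K in \<open>auto intro!: summable_mult2 summable_ignore_initial_segment\<close>)
          also have "\<dots> = (\<Sum>j. K (j + n)) * norm h"
            using K by (simp add: suminf_mult2 summable_ignore_initial_segment)
          also have "\<dots> \<le> e * norm h" using elim by (intro mult_right_mono) auto
          finally show "norm ((\<Sum>i<n. F' i x h) - (\<Sum>j. F' j x h)) \<le> e * norm h" .
        qed
      qed
    qed
    then obtain g where g: "\<And>x. x \<in> S \<Longrightarrow> (\<lambda>j. F j x) sums g x"
      "\<And>x. x \<in> S \<Longrightarrow> (g has_derivative (\<lambda>v. \<Sum>j. F' j x v)) (at x within S)" by blast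
    then show ?thesis
      using p by (intro has_derivative_transform[OF p _ g(2)[OF p]]) (simp add: sums_iff)
  qed
  show ?case unfolding Ck_on.simps
    by (intro exI[of _ "\<lambda>p v. \<Sum>j. F' j p v"] conjI ballI allI deriv Suc.IH F'(2))
qed

lemma Ck_on_subset: "Ck_on n S f \<Longrightarrow> T \<subseteq> S \<Longrightarrow> Ck_on n T f"
proof (induction n arbitrary: f)
  case 0
  then show ?case by (auto intro: continuous_on_subset)
next
  case (Suc n)
  obtain f' where "\<forall>p\<in>S. (f has_derivative f' p) (at p within S)" "\<forall>v. Ck_on n S (\<lambda>p. f' p v)"
    using Suc.prems(1) unfolding Ck_on.simps by blast
  with Suc.IH Suc.prems(2) show ?case unfolding Ck_on.simps
    by (intro exI[of _ f']) (blast intro: has_derivative_subset)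
qed

lemma Ck_on_const: "Ck_on n S (\<lambda>_. c)"
  by (induction n arbitrary: c) (auto intro!: exI[of _ "\<lambda>_ _. 0"])

lemma Ck_on_diff: "Ck_on n S f \<Longrightarrow> Ck_on n S g \<Longrightarrow> Ck_on n S (\<lambda>x. f x - g x)"
proof (induction n arbitrary: f g)
  case 0
  then show ?case by (auto intro: continuous_intros)
next
  case (Suc n)
  obtain f' where f': "\<And>p. p \<in> S \<Longrightarrow> (f has_derivative f' p) (at p within S)"
      "\<And>v. Ck_on n S (\<lambda>p. f' p v)" using Suc.prems(1) by auto
  obtain g' where g': "\<And>p. p \<in> S \<Longrightarrow> (g has_derivative g' p) (at p within S)"
      "\<And>v. Ck_on n S (\<lambda>p. g' p v)" using Suc.prems(2) by auto
  show ?case unfolding Ck_on.simps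
    by (intro exI[of _ "\<lambda>p v. f' p v - g' p v"] conjI ballI allI has_derivative_diff f' g' Suc.IH)
qed

lemma power_over_fact_le_exp:
  fixes y :: real assumes "y \<ge> 0" shows "y ^ n / fact n \<le> exp y"
proof -
  have "(\<Sum>k\<in>{n}. inverse (fact k) *\<^sub>R y ^ k) \<le> (\<Sum>k. inverse (fact k) *\<^sub>R y ^ k)"
    using assms by (intro sum_le_suminf summable_exp_generic) auto
  then show ?thesis by (simp add: exp_def divide_inverse mult.commute)
qed

text \<open>\<open>exp (2 ^ j / 2)\<close> exceeds every power of \<open>2 ^ j\<close>; one power more than needed leaves a geometric series.\<close>

lemma summable_poly_exp:
  assumes "poly_bounded g" shows "summable (\<lambda>j. g j * exp (- (2 ^ j / 2)))"
proof -
  obtain C d where C: "C \<ge> 0" "\<And>j. \<bar>g j\<bar> \<le> C * (2 ^ j) ^ d" using assms poly_boundedE by blast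
  have le: "(2 ^ j :: real) ^ d * exp (- (2 ^ j / 2)) \<le> fact (Suc d) * 2 ^ Suc d * (1/2) ^ j" for j
  proof -
    have "(2 ^ j / 2) ^ Suc d / fact (Suc d) \<le> exp (2 ^ j / 2 :: real)"
      by (rule power_over_fact_le_exp) simp
    then have "(2 ^ j) ^ Suc d \<le> fact (Suc d) * 2 ^ Suc d * exp (2 ^ j / 2 :: real)"
      by (simp add: pos_divide_le_eq power_divide mult_ac del: power_Suc fact_Suc)
    then show ?thesis by (simp add: exp_minus field_simps power_divide del: fact_Suc)
  qed
  have "norm (g j * exp (- (2 ^ j / 2))) \<le> C * (fact (Suc d) * 2 ^ Suc d * (1/2) ^ j)" for j
  proof -
    have "norm (g j * exp (- (2 ^ j / 2))) \<le> C * (2 ^ j) ^ d * exp (- (2 ^ j / 2))"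
      using C(2)[of j] by (simp add: abs_mult)
    also have "\<dots> \<le> C * (fact (Suc d) * 2 ^ Suc d * (1/2) ^ j)"
      using mult_left_mono[OF le C(1), of j] by (simp add: mult.assoc)
    finally show ?thesis .
  qed
  then show ?thesis
    by (rule summable_comparison_test'[rotated]) (intro summable_mult summable_geometric, simp)
qed

lemma tame_M_test:
  assumes "tame (Suc n) S u" shows "M_test UNIV (\<lambda>j s. exp (- (2 ^ j / 2)) * u j s)"
proof -
  obtain g where g: "poly_bounded g" "\<And>j s. \<bar>u j s\<bar> \<le> g j"
    using tame_imp_controlled[OF assms] by (auto simp: controlled_def)
  obtain u' where u': "\<And>j s. (u j has_real_derivative u' j s) (at s)"
    using tame_SucE[OF assms] by metis
  have "continuous_on UNIV (u j)" for j
    using u' by (meson DERIV_continuous_on has_field_derivative_at_within)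
  then show ?thesis
    by (intro M_testI[OF _ summable_poly_exp[OF g(1)]]) (auto simp: abs_mult g intro!: continuous_intros)
qed

lemma tame_Ck_sum:
  "tame (Suc n) S u \<Longrightarrow> Ck_sum n UNIV (\<lambda>j s. exp (- (2 ^ j / 2)) * u j s)"
proof (induction n arbitrary: u)
  case 0
  show ?case unfolding Ck_sum.simps by (rule tame_M_test[OF 0])
next
  case (Suc n)
  obtain u' where u': "\<And>j s. (u j has_real_derivative u' j s) (at s)" "tame (Suc n) S u'"
    using tame_SucE[OF Suc.prems] by metis
  have d: "((\<lambda>s. exp (- (2 ^ j / 2)) * u j s) has_derivative
      (\<lambda>v. v * (exp (- (2 ^ j / 2)) * u' j s))) (at s)" for j s
    using DERIV_cmult[OF u'(1)[of j s], of "exp (- (2 ^ j / 2))"]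
    by (simp add: has_field_derivative_def mult.commute[of _ "_ * _"] mult_commute_abs)
  show ?case
    by (rule Ck_sum_SucI[OF tame_M_test[OF Suc.prems] d]) (rule Ck_sum_cmult[OF Suc.IH[OF u'(2)]])
qed

section \<open>Bump, step and partition of unity\<close>

text \<open>The functions \<open>exp (- 1 / x) / x ^ k\<close>, extended by \<open>0\<close> to \<open>x \<le> 0\<close>.  Differentiation maps their linear span to
  itself, so that they are all smooth as soon as they are differentiable.\<close>

definition flat :: "nat \<Rightarrow> real \<Rightarrow> real" where
  "flat k x = (if x > 0 then (1 / x) ^ k * exp (- (1 / x)) else 0)"

lemma flat_nonneg: "flat k x \<ge> 0" by (simp add: flat_def)

lemma flat_eq_0: "x \<le> 0 \<Longrightarrow> flat k x = 0" by (simp add: flat_def)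

lemma flat_le_fact: "flat k x \<le> fact k"
proof (cases "x > 0")
  case True
  have "(1 / x) ^ k / fact k \<le> exp (1 / x)"
    using True by (intro power_over_fact_le_exp) simp
  then have "(1 / x) ^ k \<le> fact k * exp (1 / x)"
    by (simp add: pos_divide_le_eq mult.commute)
  then show ?thesis using True by (simp add: flat_def exp_minus field_simps)
qed (simp add: flat_def)

lemma flat_shift: "flat k x = x\<^sup>2 * flat (k + 2) x"
  by (auto simp: flat_def field_simps power2_eq_square)

text \<open>Only \<open>x = 0\<close> is delicate: there \<open>flat k x = x\<^sup>2 * flat (k + 2) x = O(x\<^sup>2)\<close>.\<close>

lemma flat_deriv:
  "(flat k has_real_derivative (- real k * flat (k + 1) x + flat (k + 2) x)) (at x)"
proof -
  consider "x > 0" | "x < 0" | "x = 0" by linarith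
  then show ?thesis
  proof cases
    case 1
    have "((\<lambda>x. (1 / x) ^ k * exp (- (1 / x))) has_real_derivative
        (- real k * flat (k + 1) x + flat (k + 2) x)) (at x)"
    proof -
      have y: "((\<lambda>x. 1 / x) has_real_derivative - ((1 / x)\<^sup>2)) (at x)"
        using 1 by (auto intro!: derivative_eq_intros simp: power2_eq_square)
      have e: "((\<lambda>x. exp (- (1 / x))) has_real_derivative exp (- (1 / x)) * (1 / x)\<^sup>2) (at x)"
        using DERIV_fun_exp[OF DERIV_minus[OF y]] by simp
      have "real k * (- ((1 / x)\<^sup>2) * (1 / x) ^ (k - Suc 0)) = - real k * (1 / x) ^ (k + 1)"
        using 1 by (cases k) (auto simp: power2_eq_square field_simps)
      note eq = this
      show ?thesis
        by (rule DERIV_cong[OF DERIV_mult[OF DERIV_power[OF y, of k] e]], unfold eq)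
           (use 1 in \<open>simp add: flat_def algebra_simps power2_eq_square\<close>)
    qed
    then show ?thesis
      by (rule has_field_derivative_transform_within_open[of _ _ _ "{0<..}"]) (use 1 in \<open>auto simp: flat_def\<close>)
  next
    case 2
    have "((\<lambda>_. 0) has_real_derivative 0) (at x)" by simp
    then have "(flat k has_real_derivative 0) (at x)"
      by (rule has_field_derivative_transform_within_open[of _ _ _ "{..<0}"]) (use 2 in \<open>auto simp: flat_def\<close>)
    then show ?thesis using 2 by (simp add: flat_eq_0)
  next
    case 3
    have "(flat k has_real_derivative 0) (at 0)" unfolding DERIV_def
    proof (rule Lim_null_comparison)
      show "\<forall>\<^sub>F h in at 0. norm ((flat k (0 + h) - flat k 0) / h) \<le> fact (k + 2) * \<bar>h\<bar>"
      proof (intro always_eventually allI)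
        fix h :: real
        have "norm ((flat k (0 + h) - flat k 0) / h) = \<bar>h\<bar> * flat (k + 2) h"
          using flat_nonneg[of "k + 2" h]
          by (simp add: flat_eq_0 flat_shift[of k h] power2_eq_square abs_mult)
        also have "\<dots> \<le> fact (k + 2) * \<bar>h\<bar>"
          using mult_left_mono[OF flat_le_fact[of "k + 2" h], of "\<bar>h\<bar>"] by (simp add: mult.commute)
        finally show "norm ((flat k (0 + h) - flat k 0) / h) \<le> fact (k + 2) * \<bar>h\<bar>" .
      qed
      show "((\<lambda>h::real. fact (k + 2) * \<bar>h\<bar>) \<longlongrightarrow> 0) (at 0)"
        by (auto intro!: tendsto_eq_intros)
    qed
    then show ?thesis using 3 by (simp add: flat_eq_0)
  qed
qed

lemma controlled_flat: "controlled (\<lambda>_. {0..}) (\<lambda>_. flat k)"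
  by (rule controlledI[OF poly_bounded_const[of "fact k"]])
     (auto simp: flat_nonneg flat_le_fact flat_eq_0)

lemma tame_flat: "tame n (\<lambda>_. {0..}) (\<lambda>_. flat k)"
proof (induction n arbitrary: k)
  case 0
  show ?case by (simp add: controlled_flat)
next
  case (Suc n)
  show ?case
    by (rule tame_SucI[OF controlled_flat flat_deriv])
       (intro tame_add tame_scale[OF poly_bounded_const] Suc.IH)
qed

lemma tame_flat_reflected: "tame n (\<lambda>_. {..1}) (\<lambda>_ s. flat k (1 - s))"
proof (induction n arbitrary: k)
  case 0
  show ?case unfolding tame.simps by (rule controlledI[OF poly_bounded_const[of "fact k"]])
     (auto simp: flat_nonneg flat_le_fact flat_eq_0)
next
  case (Suc n)
  have c: "controlled (\<lambda>_. {..1}) (\<lambda>_ s. flat k (1 - s))"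
    by (rule controlledI[OF poly_bounded_const[of "fact k"]])
       (auto simp: flat_nonneg flat_le_fact flat_eq_0)
  have "((\<lambda>s. flat k (1 - s)) has_real_derivative
      (- real k * flat (k + 1) (1 - s) + flat (k + 2) (1 - s)) * (- 1)) (at s)" for s
    by (rule DERIV_chain2[OF flat_deriv]) (auto intro!: derivative_eq_intros)
  then have "((\<lambda>s. flat k (1 - s)) has_real_derivative
      real k * flat (k + 1) (1 - s) + (- 1) * flat (k + 2) (1 - s)) (at s)" for s
    by (simp add: algebra_simps)
  then show ?case
    by (rule tame_SucI[OF c])
       (intro tame_add tame_scale[OF poly_bounded_const] Suc.IH)
qed

definition bump :: "real \<Rightarrow> real" where
  "bump s = flat 0 s * flat 0 (1 - s)"

lemma tame_bump: "tame n (\<lambda>_. {0..1}) (\<lambda>_. bump)"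
  unfolding bump_def
  by (rule tame_mono[OF tame_mult[OF tame_flat tame_flat_reflected]]) auto

lemma bump_nonneg: "bump s \<ge> 0"
  by (simp add: bump_def flat_nonneg)

lemma bump_pos: "0 < s \<Longrightarrow> s < 1 \<Longrightarrow> bump s > 0"
  by (simp add: bump_def flat_def)

lemma bump_eq_0: "s \<notin> {0..1} \<Longrightarrow> bump s = 0"
  by (auto simp: bump_def flat_def)

lemma tame_continuous: "tame (Suc n) S u \<Longrightarrow> continuous_on A (u j)"
  by (metis DERIV_continuous_on has_field_derivative_at_within tame_SucE)

lemma continuous_on_bump: "continuous_on A bump"
  using tame_continuous[OF tame_bump] .

lemma integral_pos_continuous:
  fixes f :: "real \<Rightarrow> real"
  assumes "continuous_on {a..b} f" "\<And>s. s \<in> {a..b} \<Longrightarrow> f s \<ge> 0" "c \<in> {a..b}" "f c > 0" "a < b"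
  shows "integral {a..b} f > 0"
proof -
  have "integral {a..b} f \<ge> 0" using assms by (intro integral_nonneg integrable_continuous_real) auto
  moreover have "integral {a..b} f \<noteq> 0"
    using integral_eq_0_iff[of a b f] assms by force
  ultimately show ?thesis by linarith
qed

definition bump_mass :: real where "bump_mass = integral {0..1} bump"

lemma bump_mass_pos: "bump_mass > 0"
  unfolding bump_mass_def
  by (rule integral_pos_continuous[of _ _ _ "1/2"]) (auto simp: continuous_on_bump bump_nonneg bump_pos)

definition step :: "real \<Rightarrow> real" where
  "step x = integral {0..x} bump / bump_mass"

lemma step_eq_0: "x \<le> 0 \<Longrightarrow> step x = 0"
  by (cases "x = 0") (auto simp: step_def)

lemma step_eq_1: assumes "x \<ge> 1" shows "step x = 1"
proof -
  have "integral {0..x} bump = integral {0..1} bump + integral {1..x} bump"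
    using assms by (intro Henstock_Kurzweil_Integration.integral_combine[symmetric] integrable_continuous_real continuous_on_bump) auto
  moreover have "integral {1..x} bump = integral {1..x} (\<lambda>_. 0)"
    by (rule integral_cong) (auto simp: bump_def flat_def)
  ultimately show ?thesis using bump_mass_pos by (simp add: step_def bump_mass_def)
qed

lemma step_bounds: "0 \<le> step x" "step x \<le> 1"
proof -
  have "integral {0..x} bump \<le> bump_mass"
  proof (cases "x \<le> 1")
    case True
    then show ?thesis unfolding bump_mass_def
      by (intro integral_subset_le integrable_continuous_real continuous_on_bump) (auto simp: bump_nonneg)
  next
    case False
    then show ?thesis using step_eq_1[of x] bump_mass_pos by (simp add: step_def)
  qed
  then show "step x \<le> 1" using bump_mass_pos by (simp add: step_def)
  show "0 \<le> step x" using bump_mass_pos unfolding step_def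
    by (intro divide_nonneg_pos integral_nonneg integrable_continuous_real continuous_on_bump bump_nonneg) auto
qed

lemma step_deriv: "(step has_real_derivative bump x / bump_mass) (at x)"
proof (cases "x < 0")
  case True
  have "((\<lambda>_. 0) has_real_derivative 0) (at x)" by simp
  then have "(step has_real_derivative 0) (at x)"
    by (rule has_field_derivative_transform_within_open[of _ _ _ "{..<0}"]) (use True in \<open>auto simp: step_eq_0\<close>)
  then show ?thesis using True by (simp add: bump_def flat_def)
next
  case False
  have "((\<lambda>y. integral {-1..y} bump) has_real_derivative bump x) (at x within {-1..x + 1})"
    by (rule integral_has_real_derivative[OF continuous_on_bump]) (use False in auto)
  then have "((\<lambda>y. integral {-1..y} bump) has_real_derivative bump x) (at x)"
    using False by (subst (asm) at_within_interior) auto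
  then have "((\<lambda>y. integral {-1..y} bump / bump_mass) has_real_derivative bump x / bump_mass) (at x)"
    by (rule DERIV_cdivide)
  then show ?thesis
  proof (rule has_field_derivative_transform_within_open[of _ _ _ "{-1<..}"])
    fix y :: real assume y: "y \<in> {-1<..}"
    have z: "integral {-1..c} bump = 0" if "c \<le> 0" for c
    proof -
      have "integral {-1..c} bump = integral {-1..c} (\<lambda>_. 0)"
        by (rule integral_cong) (use that in \<open>auto simp: bump_def flat_def\<close>)
      then show ?thesis by simp
    qed
    show "integral {-1..y} bump / bump_mass = step y"
    proof (cases "y \<le> 0")
      case True
      then show ?thesis using z by (simp add: step_eq_0)
    next
      case False
      then have "integral {-1..y} bump = integral {-1..0} bump + integral {0..y} bump"
        by (intro Henstock_Kurzweil_Integration.integral_combine[symmetric] integrable_continuous_real continuous_on_bump) auto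
      then show ?thesis using z by (simp add: step_def)
    qed
  qed (use False in auto)
qed

text \<open>A telescoping partition of unity in the small parameter \<open>x\<close>, with the \<open>j\<close>-th member living where \<open>x\<close> is
  comparable to \<open>1 / 4 ^ j\<close>.  This is the range of \<open>x\<close> in which the window \<open>s \<approx> 1 / 2 ^ j\<close> is to be
  used for the correction.\<close>

definition cutoff :: "nat \<Rightarrow> real \<Rightarrow> real" where
  "cutoff j x = step (256 * 4 ^ j * x - 1) - step (64 * 4 ^ j * x - 1)"

lemma poly_bounded_four_power: "poly_bounded (\<lambda>j. c * 4 ^ j)"
proof -
  have "poly_bounded (\<lambda>j. c * (2 ^ j) ^ 2)"
    by (intro poly_bounded_mult poly_bounded_const poly_bounded_power poly_bounded_two_power)
  then show ?thesis by (simp add: power2_eq_square flip: power_mult_distrib)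
qed

lemma cutoff_eq_0:
  assumes "x \<notin> {1 / (256 * 4 ^ j)..1 / (32 * 4 ^ j)}" shows "cutoff j x = 0"
proof (cases "x < 1 / (256 * 4 ^ j)")
  case True
  then have "256 * 4 ^ j * x < 1" by (simp add: field_simps)
  moreover have "64 * 4 ^ j * x \<le> 1" using calculation
    by (cases "x \<ge> 0") (auto simp: mult_nonneg_nonpos)
  ultimately show ?thesis by (simp add: cutoff_def step_eq_0)
next
  case False
  then have "x > 1 / (32 * 4 ^ j)" using assms by auto
  then have "32 * 4 ^ j * x > 1" by (simp add: field_simps)
  then have "64 * 4 ^ j * x > 2" "256 * 4 ^ j * x > 8" by linarith+
  then show ?thesis by (simp add: cutoff_def step_eq_1)
qed

lemma tame_cutoff: "tame n (\<lambda>j. {1 / (256 * 4 ^ j)..1 / (32 * 4 ^ j)}) cutoff"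
proof -
  have b: "\<bar>cutoff j s\<bar> \<le> 1" for j s
    unfolding cutoff_def using step_bounds by (smt (verit))
  have c: "controlled (\<lambda>j. {1 / (256 * 4 ^ j)..1 / (32 * 4 ^ j)}) cutoff"
    by (rule controlledI[OF poly_bounded_const[of 1]]) (auto simp: b intro: cutoff_eq_0)
  show ?thesis
  proof (cases n)
    case (Suc m)
    define u' where "u' = (\<lambda>j s. 256 * 4 ^ j / bump_mass * bump ((s - 1 / (256 * 4 ^ j)) / (1 / (256 * 4 ^ j)))
        + (- 64) * 4 ^ j / bump_mass * bump ((s - 1 / (64 * 4 ^ j)) / (1 / (64 * 4 ^ j))))"
    have pb: "poly_bounded (\<lambda>j. c * 4 ^ j / bump_mass)" for c
      using poly_bounded_four_power[of "c / bump_mass"] by simp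
    have t: "tame m (\<lambda>j. {1 / (256 * 4 ^ j)..1 / (32 * 4 ^ j)})
        (\<lambda>j s. bump ((s - 1 / (c * 4 ^ j)) / (1 / (c * 4 ^ j))))" if "64 \<le> c" "c \<le> 256" for c
    proof (rule tame_mono)
      show "tame m (\<lambda>j. {1 / (c * 4 ^ j)..1 / (c * 4 ^ j) + 1 / (c * 4 ^ j)})
        (\<lambda>j s. bump ((s - 1 / (c * 4 ^ j)) / (1 / (c * 4 ^ j))))"
        by (rule tame_affine[OF _ _ tame_bump]) (use that poly_bounded_four_power in auto)
      show "{1 / (c * 4 ^ j)..1 / (c * 4 ^ j) + 1 / (c * 4 ^ j)} \<subseteq> {1 / (256 * 4 ^ j)..1 / (32 * 4 ^ j)}" for j
        using that by (auto simp: field_simps)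
    qed
    have "tame m (\<lambda>j. {1 / (256 * 4 ^ j)..1 / (32 * 4 ^ j)}) u'"
      unfolding u'_def by (intro tame_add tame_scale pb t) auto
    moreover have "(cutoff j has_real_derivative u' j s) (at s)" for j s
    proof -
      have "((\<lambda>x. step (c * 4 ^ j * x - 1)) has_real_derivative
          bump (c * 4 ^ j * s - 1) / bump_mass * (c * 4 ^ j)) (at s)" for c
        by (rule DERIV_chain2[OF step_deriv]) (auto intro!: derivative_eq_intros)
      note d = DERIV_diff[OF this[of 256] this[of 64]]
      have eq: "(s - 1 / (c * 4 ^ j)) / (1 / (c * 4 ^ j)) = c * 4 ^ j * s - 1" if "c > 0" for c :: real
        using that by (simp add: field_simps)
      have "u' j s = bump (256 * 4 ^ j * s - 1) / bump_mass * (256 * 4 ^ j)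
          - bump (64 * 4 ^ j * s - 1) / bump_mass * (64 * 4 ^ j)"
        unfolding u'_def eq[OF zero_less_numeral] by (simp add: mult_ac)
      with d show ?thesis unfolding cutoff_def[abs_def] by simp
    qed
    ultimately show ?thesis unfolding Suc by (intro tame_SucI[OF c])
  qed (use c in simp)
qed

section \<open>Wave packets with vanishing moments\<close>

definition left_end :: "nat \<Rightarrow> real" where "left_end j = 1 / (8 * 2 ^ j)"
definition mesh :: "nat \<Rightarrow> real" where "mesh j = 1 / (16 * 2 ^ j * (4 ^ j + 1))"

text \<open>The wave packet at scale \<open>j\<close>: \<open>4 ^ j\<close> differences of a narrow bump.  The mesh is chosen such that the
  translates of the bump fill exactly the interval from \<open>1 / (8 * 2 ^ j)\<close> to \<open>3 / (16 * 2 ^ j)\<close>; these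
  intervals are disjoint, separated by gaps comparable to their length, and contained in \<open>[0, 3/16]\<close>.\<close>

definition packet :: "nat \<Rightarrow> real \<Rightarrow> real" where
  "packet j = diff_op (4 ^ j) (mesh j) (\<lambda>s. bump ((s - left_end j) / mesh j))"

lemma mesh_pos: "mesh j > 0" unfolding mesh_def by (simp add: add_pos_pos)

lemma poly_bounded_inverse_mesh: "poly_bounded (\<lambda>j. 1 / mesh j)"
proof -
  have "poly_bounded (\<lambda>j. 16 * 2 ^ j * (1 * 4 ^ j + 1))"
    by (intro poly_bounded_mult poly_bounded_add poly_bounded_const poly_bounded_two_power poly_bounded_four_power)
  then show ?thesis by (simp add: mesh_def)
qed

lemma packet_right_end: "left_end j + mesh j + real (4 ^ j) * mesh j = 3 / (16 * 2 ^ j)"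
proof -
  have "mesh j + real (4 ^ j) * mesh j = (4 ^ j + 1) * mesh j" by (simp add: algebra_simps)
  also have "\<dots> = 1 / (16 * 2 ^ j)"
  proof -
    have "(4 ^ j + 1 :: real) \<noteq> 0" using zero_less_power[of "4::real" j] by linarith
    then show ?thesis by (simp add: mesh_def)
  qed
  finally have "mesh j + real (4 ^ j) * mesh j = 1 / (16 * 2 ^ j)" .
  moreover have "1 / (8 * 2 ^ j) + 1 / (16 * 2 ^ j) = 3 / (16 * 2 ^ j :: real)"
    by (simp add: field_simps)
  ultimately show ?thesis by (simp add: left_end_def add.assoc)
qed

lemma tame_packet: "tame n (\<lambda>j. {left_end j..3 / (16 * 2 ^ j)}) packet"
proof -
  have "tame n (\<lambda>j. {left_end j..left_end j + mesh j}) (\<lambda>j s. bump ((s - left_end j) / mesh j))"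
    by (rule tame_affine[OF mesh_pos poly_bounded_inverse_mesh tame_bump])
  then have "tame n (\<lambda>j. {left_end j..left_end j + mesh j + real (4 ^ j) * mesh j}) packet"
    unfolding packet_def by (intro tame_diff_op less_imp_le[OF mesh_pos])
  then show ?thesis unfolding packet_right_end .
qed

lemma compact_support_integral:
  fixes f :: "real \<Rightarrow> real"
  assumes "continuous_on UNIV f" "\<And>s. s \<notin> {a..b} \<Longrightarrow> f s = 0"
  shows "integrable lborel f" "(LINT s|lborel. f s) = integral {a..b} f"
proof -
  have eq: "(\<lambda>s. indicator {a..b} s * f s) = f"
    using assms(2) by (auto simp: indicator_def fun_eq_iff)
  have si: "set_integrable lborel {a..b} f"
    by (rule borel_integrable_atLeastAtMost') (rule continuous_on_subset[OF assms(1)], simp)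
  then show "integrable lborel f" by (simp add: set_integrable_def eq)
  show "(LINT s|lborel. f s) = integral {a..b} f"
    using set_borel_integral_eq_integral(2)[OF si] by (simp add: set_lebesgue_integral_def eq)
qed

lemma diff_op_continuous:
  "continuous_on UNIV f \<Longrightarrow> continuous_on UNIV (diff_op N h f)"
proof (induction N)
  case (Suc N)
  have "continuous_on UNIV (\<lambda>s. diff_op N h f (s - h))"
    by (rule continuous_on_compose2[OF Suc.IH[OF Suc.prems]]) (auto intro!: continuous_intros)
  then show ?case using Suc by (auto intro!: continuous_intros)
qed simp

lemma diff_op_adjoint:
  fixes f g :: "real \<Rightarrow> real"
  assumes f: "continuous_on UNIV f" "\<And>s. s \<notin> {a..b} \<Longrightarrow> f s = 0" and g: "continuous_on UNIV g" and h: "h \<ge> 0"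
  shows "(LINT s|lborel. diff_op (Suc N) h f s * g s) =
    (LINT s|lborel. diff_op N h f s * ((g s - g (s + h)) / 2))"
proof -
  let ?F = "diff_op N h f"
  have cF: "continuous_on UNIV ?F" by (rule diff_op_continuous[OF f(1)])
  have zF: "?F s = 0" if "s \<notin> {a..b + real N * h}" for s
    by (rule diff_op_support[OF f(2) h that])
  have cFs: "continuous_on UNIV (\<lambda>s. ?F (s - h))"
    by (rule continuous_on_compose2[OF cF]) (auto intro!: continuous_intros)
  have cgs: "continuous_on UNIV (\<lambda>s. g (s + h))"
    by (rule continuous_on_compose2[OF g]) (auto intro!: continuous_intros)
  have i1: "integrable lborel (\<lambda>s. ?F s * g s)"
    by (rule compact_support_integral(1)[of _ a "b + real N * h"]) (auto intro!: continuous_intros cF g simp: zF)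
  have i2: "integrable lborel (\<lambda>s. ?F (s - h) * g s)"
    by (rule compact_support_integral(1)[of _ "a + h" "b + real N * h + h"])
       (auto intro!: continuous_intros cFs g simp: zF)
  have i3: "integrable lborel (\<lambda>s. ?F s * g (s + h))"
    by (rule compact_support_integral(1)[of _ a "b + real N * h"]) (auto intro!: continuous_intros cF cgs simp: zF)
  have "(LINT s|lborel. ?F (s - h) * g s) = (LINT s|lborel. ?F s * g (s + h))"
    using lborel_integral_real_affine[of 1 "\<lambda>s. ?F (s - h) * g s" h] by (simp add: add.commute)
  moreover have "(LINT s|lborel. diff_op (Suc N) h f s * g s) =
      (LINT s|lborel. (?F s * g s - ?F (s - h) * g s) / 2)"
    by (rule Bochner_Integration.integral_cong) (auto simp: field_simps)
  moreover have "(LINT s|lborel. diff_op N h f s * ((g s - g (s + h)) / 2)) =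
      (LINT s|lborel. (?F s * g s - ?F s * g (s + h)) / 2)"
    by (rule Bochner_Integration.integral_cong) (auto simp: field_simps)
  ultimately show ?thesis using i1 i2 i3 by simp
qed

text \<open>Moving a difference onto the monomial \<open>s ^ m\<close> lowers its degree, so each of the \<open>N\<close> differences kills one
  more moment.\<close>

lemma diff_op_moments:
  fixes f :: "real \<Rightarrow> real"
  assumes f: "continuous_on UNIV f" "\<And>s. s \<notin> {a..b} \<Longrightarrow> f s = 0" and h: "h \<ge> 0"
  shows "m < N \<Longrightarrow> (LINT s|lborel. diff_op N h f s * s ^ m) = 0"
proof (induction N arbitrary: m)
  case (Suc N)
  let ?F = "diff_op N h f"
  have cF: "continuous_on UNIV ?F" by (rule diff_op_continuous[OF f(1)])
  have zF: "?F s = 0" if "s \<notin> {a..b + real N * h}" for s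
    by (rule diff_op_support[OF f(2) h that])
  have int: "integrable lborel (\<lambda>s. ?F s * s ^ k)" for k
    by (rule compact_support_integral(1)[of _ a "b + real N * h"]) (auto intro!: continuous_intros cF simp: zF)
  have eq: "?F s * ((s ^ m - (s + h) ^ m) / 2) =
      (\<Sum>k<m. - (real (m choose k) * h ^ (m - k) / 2) * (?F s * s ^ k))" for s
  proof -
    have "(s + h) ^ m = (\<Sum>k\<le>m. real (m choose k) * s ^ k * h ^ (m - k))"
      by (rule binomial_ring)
    also have "\<dots> = (\<Sum>k<m. real (m choose k) * s ^ k * h ^ (m - k)) + s ^ m"
      by (simp add: lessThan_Suc_atMost[symmetric])
    finally show ?thesis
      by (simp add: sum_distrib_left sum_divide_distrib sum_negf mult_ac)
  qed
  have "(LINT s|lborel. diff_op (Suc N) h f s * s ^ m) =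
      (LINT s|lborel. ?F s * ((s ^ m - (s + h) ^ m) / 2))"
    by (rule diff_op_adjoint[OF f _ h]) (auto intro!: continuous_intros)
  also have "\<dots> = (LINT s|lborel. (\<Sum>k<m. - (real (m choose k) * h ^ (m - k) / 2) * (?F s * s ^ k)))"
    by (simp only: eq)
  also have "\<dots> = (\<Sum>k<m. - (real (m choose k) * h ^ (m - k) / 2) * (LINT s|lborel. ?F s * s ^ k))"
    by (subst Bochner_Integration.integral_sum) (auto simp: int)
  also have "\<dots> = 0"
    using Suc by (intro sum.neutral) auto
  finally show ?case .
qed simp

text \<open>The translation by \<open>h\<close> changes the sign of a sine wave of period \<open>2 * h\<close>, so the adjoint of the
  normalised difference fixes this wave.  Differences annihilate polynomials but keep the correlation
  with this wave, which bounds the packets from below independently of \<open>N\<close>.\<close>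

lemma diff_op_sin:
  fixes f :: "real \<Rightarrow> real"
  assumes f: "continuous_on UNIV f" "\<And>s. s \<notin> {a..b} \<Longrightarrow> f s = 0" and h: "h > 0"
  shows "(LINT s|lborel. diff_op N h f s * sin (pi * (s - c) / h)) =
    (LINT s|lborel. f s * sin (pi * (s - c) / h))"
proof (induction N)
  case (Suc N)
  have "sin (pi * (s + h - c) / h) = - sin (pi * (s - c) / h)" for s
  proof -
    have "pi * (s + h - c) / h = pi * (s - c) / h + pi" using h by (simp add: field_simps)
    then show ?thesis by simp
  qed
  then have "(LINT s|lborel. diff_op (Suc N) h f s * sin (pi * (s - c) / h)) =
      (LINT s|lborel. diff_op N h f s * sin (pi * (s - c) / h))"
    using h by (subst diff_op_adjoint[OF f, where g = "\<lambda>s. sin (pi * (s - c) / h)"]) (auto intro!: continuous_intros)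
  then show ?case using Suc by simp
qed simp

lemma bump_le_1: "bump s \<le> 1"
  using mult_mono[OF flat_le_fact[of 0 s] flat_le_fact[of 0 "1 - s"]] flat_nonneg by (simp add: bump_def)

lemma packet_le_1: "\<bar>packet j s\<bar> \<le> 1"
  unfolding packet_def by (rule diff_op_bound) (simp add: bump_nonneg bump_le_1)

lemma packet_eq_0: "s \<notin> {left_end j..3 / (16 * 2 ^ j)} \<Longrightarrow> packet j s = 0"
  using tame_packet[of 0] by (auto simp: controlled_def)

lemma packet_unit: "s \<notin> {0..1} \<Longrightarrow> packet j s = 0"
proof (rule packet_eq_0, rule notI)
  assume s: "s \<notin> {0..1}" "s \<in> {left_end j..3 / (16 * 2 ^ j)}"
  have "3 \<le> 16 * (2::real) ^ j"
    using one_le_power[of "2::real" j] by linarith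
  then have "3 / (16 * 2 ^ j) \<le> (1::real)" by simp
  with s have "s \<le> 1" by (auto intro: order_trans)
  moreover have "left_end j > 0" by (simp add: left_end_def)
  ultimately show False using s by auto
qed

lemma continuous_on_packet: "continuous_on A (packet j)"
  using tame_continuous[OF tame_packet] .

lemma scaled_bump:
  "continuous_on UNIV (\<lambda>s. bump ((s - left_end j) / mesh j))"
  "s \<notin> {left_end j..left_end j + mesh j} \<Longrightarrow> bump ((s - left_end j) / mesh j) = 0"
  using mesh_pos[of j]
  by (auto intro!: continuous_intros continuous_on_compose2[OF continuous_on_bump[of UNIV]] bump_eq_0 simp: field_simps)

lemma packet_moments:
  assumes "m < 4 ^ j" shows "integral {0..1} (\<lambda>s. packet j s * s ^ m) = 0"
proof -
  have "(LINT s|lborel. packet j s * s ^ m) = 0"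
    unfolding packet_def by (rule diff_op_moments[OF scaled_bump]) (use assms mesh_pos[of j] in auto)
  then show ?thesis
    by (subst (asm) compact_support_integral(2)[of _ 0 1])
       (auto intro!: continuous_intros continuous_on_packet simp: packet_unit)
qed

definition bump_sine :: real where "bump_sine = integral {0..1} (\<lambda>t. bump t * sin (pi * t))"

lemma bump_sine_pos: "bump_sine > 0"
  unfolding bump_sine_def
proof (rule integral_pos_continuous[of _ _ _ "1/2"])
  show "0 \<le> bump s * sin (pi * s)" if "s \<in> {0..1}" for s
    using that bump_nonneg[of s] sin_ge_zero[of "pi * s"] by (simp add: mult_left_le)
  show "0 < bump (1/2) * sin (pi * (1/2))"
    using bump_pos[of "1/2"] by simp
qed (auto intro!: continuous_intros continuous_on_bump)

definition energy :: "nat \<Rightarrow> real" where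
  "energy j = integral {0..1} (\<lambda>s. (packet j s)\<^sup>2)"

lemma packet_sine:
  "integral {0..1} (\<lambda>s. packet j s * sin (pi * (s - left_end j) / mesh j)) = mesh j * bump_sine"
proof -
  let ?h = "mesh j" and ?a = "left_end j"
  have h: "?h > 0" by (rule mesh_pos)
  have "integral {0..1} (\<lambda>s. packet j s * sin (pi * (s - ?a) / ?h)) =
      (LINT s|lborel. packet j s * sin (pi * (s - ?a) / ?h))"
    using h by (intro compact_support_integral(2)[of _ 0 1, symmetric])
       (auto intro!: continuous_intros continuous_on_packet simp: packet_unit)
  also have "\<dots> = (LINT s|lborel. bump ((s - ?a) / ?h) * sin (pi * (s - ?a) / ?h))"
    unfolding packet_def by (rule diff_op_sin[OF scaled_bump h])
  also have "\<dots> = ?h * (LINT t|lborel. bump t * sin (pi * t))"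
    using h by (subst lborel_integral_real_affine[of ?h _ ?a]) auto
  also have "(LINT t|lborel. bump t * sin (pi * t)) = bump_sine"
    unfolding bump_sine_def
    by (rule compact_support_integral(2)) (auto intro!: continuous_intros continuous_on_bump simp: bump_eq_0)
  finally show ?thesis .
qed

text \<open>Cauchy-Schwarz against the sine wave.  The energy loses only powers of \<open>2 ^ j\<close>, although the packet
  is a difference of order \<open>4 ^ j\<close>.\<close>

lemma energy_lower: "energy j \<ge> (mesh j * bump_sine)\<^sup>2"
proof -
  let ?k = "mesh j * bump_sine" and ?w = "\<lambda>s. sin (pi * (s - left_end j) / mesh j)"
  have h: "mesh j \<noteq> 0" using mesh_pos[of j] by simp
  have i: "(\<lambda>s. packet j s * ?w s) integrable_on {0..1}" "(\<lambda>s. (packet j s)\<^sup>2) integrable_on {0..1}"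
    using h by (intro integrable_continuous_real continuous_intros continuous_on_packet; simp)+
  \<comment> \<open>Expand \<open>(packet j s - ?k * ?w s)\<^sup>2 \<ge> 0\<close>; the multiple \<open>?k\<close> is the correlation itself, which is optimal up to a constant.\<close>
  have "integral {0..1} (\<lambda>s. 2 * ?k * (packet j s * ?w s) - ?k\<^sup>2) \<le> integral {0..1} (\<lambda>s. (packet j s)\<^sup>2)"
  proof (rule integral_le)
    fix s :: real
    have "(?w s)\<^sup>2 \<le> 1" by (simp add: abs_square_le_1)
    then have "?k\<^sup>2 * (?w s)\<^sup>2 \<le> ?k\<^sup>2 * 1" by (intro mult_left_mono) auto
    moreover have "(packet j s - ?k * ?w s)\<^sup>2 \<ge> 0" by simp
    ultimately show "2 * ?k * (packet j s * ?w s) - ?k\<^sup>2 \<le> (packet j s)\<^sup>2"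
      by (simp add: power2_diff power_mult_distrib mult_ac)
  qed (intro integrable_diff integrable_on_mult_right i integrable_const_ivl)+
  also have "integral {0..1} (\<lambda>s. 2 * ?k * (packet j s * ?w s) - ?k\<^sup>2) = 2 * ?k * ?k - ?k\<^sup>2"
    using has_integral_diff[OF has_integral_mult_right[OF integrable_integral[OF i(1)], of "2 * ?k"]
        has_integral_const_real[of "?k\<^sup>2" 0 1]]
    by (intro integral_unique) (simp add: packet_sine)
  finally show ?thesis by (simp add: energy_def power2_eq_square mult_ac)
qed

lemma energy_pos: "energy j > 0"
  using energy_lower[of j] mesh_pos[of j] bump_sine_pos by (smt (verit) mult_pos_pos zero_less_power)

lemma poly_bounded_inverse_energy: "poly_bounded (\<lambda>j. 1 / energy j)"
proof -
  have "poly_bounded (\<lambda>j. (1 / mesh j) ^ 2 * (1 / bump_sine) ^ 2)"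
    by (intro poly_bounded_mult poly_bounded_power poly_bounded_inverse_mesh poly_bounded_const)
  then show ?thesis
  proof (rule poly_bounded_mono)
    fix j
    have "0 < (mesh j * bump_sine)\<^sup>2" using mesh_pos[of j] bump_sine_pos by simp
    then have "1 / energy j \<le> 1 / (mesh j * bump_sine)\<^sup>2"
      using energy_lower[of j] by (intro divide_left_mono) (auto simp: energy_pos)
    then show "\<bar>1 / energy j\<bar> \<le> \<bar>(1 / mesh j) ^ 2 * (1 / bump_sine) ^ 2\<bar>"
      using energy_pos[of j] by (simp add: power_mult_distrib power_divide)
  qed
qed

section \<open>The Laplace transform of the sum of packets\<close>

text \<open>The function \<open>b\<close> of the counterexample.  The coefficients must be small enough for smoothness at \<open>0\<close>, and yet
  large compared with \<open>exp (- (2 ^ j))\<close>, the relative size of the quantity to be corrected.\<close>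

definition signal :: "real \<Rightarrow> real" where
  "signal s = (\<Sum>j. exp (- (2 ^ j / 2)) * packet j s)"

text \<open>The power \<open>k\<close> appears because every derivative in \<open>x\<close> of the Laplace transform produces a factor
  \<open>\<sigma> / x\<^sup>2\<close> in the integrand.\<close>

definition laplace :: "nat \<Rightarrow> real \<Rightarrow> real" where
  "laplace k x = integral {0..1} (\<lambda>\<sigma>. \<sigma> ^ k * exp (- \<sigma> / x) * signal \<sigma>)"

lemma Ck_on_signal: "Ck_on n UNIV signal"
proof -
  have "Ck_sum n UNIV (\<lambda>j s. exp (- (2 ^ j / 2)) * packet j s)"
    by (rule tame_Ck_sum[OF tame_packet])
  from Ck_sum_suminf[OF convex_UNIV this] show ?thesis by (simp only: signal_def[abs_def])
qed

lemma continuous_on_signal: "continuous_on A signal"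
proof -
  have "continuous_on UNIV signal" using Ck_on_signal[of 0] by simp
  then show ?thesis by (rule continuous_on_subset) simp
qed

lemma two_power_le_exp: "(2::real) ^ j \<le> exp (2 ^ j)"
  by (rule order_trans[OF _ exp_ge_add_one_self]) simp

lemma laplace_sums:
  "(\<lambda>i. exp (- (2 ^ i / 2)) * integral {0..1} (\<lambda>\<sigma>. \<sigma> ^ k * exp (- \<sigma> / x) * packet i \<sigma>)) sums laplace k x"
  if "x > 0"
proof -
  have c: "continuous_on {0..1} (\<lambda>\<sigma>. \<sigma> ^ k * exp (- \<sigma> / x))"
    using that by (auto intro!: continuous_intros)
  let ?f = "\<lambda>i \<sigma>. \<sigma> ^ k * exp (- \<sigma> / x) * (exp (- (2 ^ i / 2)) * packet i \<sigma>)"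
  have "uniform_limit {0..1} (\<lambda>n \<sigma>. \<Sum>i<n. ?f i \<sigma>) (\<lambda>\<sigma>. \<Sum>i. ?f i \<sigma>) sequentially"
  proof (rule Weierstrass_m_test)
    fix i \<sigma> assume \<sigma>: "\<sigma> \<in> {0..1::real}"
    have "\<bar>\<sigma> ^ k\<bar> * \<bar>exp (- \<sigma> / x)\<bar> * (exp (- (2 ^ i / 2)) * \<bar>packet i \<sigma>\<bar>) \<le> 1 * 1 * (exp (- (2 ^ i / 2)) * 1)"
      using \<sigma> that packet_le_1 by (intro mult_mono) (auto simp: power_le_one)
    then show "norm (?f i \<sigma>) \<le> 1 * exp (- (2 ^ i / 2))" by (simp add: abs_mult)
  next
    show "summable (\<lambda>i. 1 * exp (- ((2::real) ^ i / 2)))"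
      by (rule summable_poly_exp[OF poly_bounded_const])
  qed
  moreover have "(\<Sum>i. ?f i \<sigma>) = \<sigma> ^ k * exp (- \<sigma> / x) * signal \<sigma>" for \<sigma>
  proof -
    have "summable (\<lambda>i. exp (- (2 ^ i / 2)) * packet i \<sigma>)"
      using M_test_summable[OF Ck_sum_imp_M_test[OF tame_Ck_sum[OF tame_packet]]] by blast
    then show ?thesis by (simp add: signal_def suminf_mult)
  qed
  ultimately have u: "uniform_limit {0..1} (\<lambda>n \<sigma>. \<Sum>i<n. ?f i \<sigma>) (\<lambda>\<sigma>. \<sigma> ^ k * exp (- \<sigma> / x) * signal \<sigma>) sequentially"
    by simp
  have fi: "?f i integrable_on {0..1}" for i
    by (intro integrable_continuous_real continuous_intros c continuous_on_packet)
  obtain I J where IJ: "\<And>n. ((\<lambda>\<sigma>. \<Sum>i<n. ?f i \<sigma>) has_integral I n) {0..1}"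
      "((\<lambda>\<sigma>. \<sigma> ^ k * exp (- \<sigma> / x) * signal \<sigma>) has_integral J) {0..1}" "(I \<longlongrightarrow> J) sequentially"
    by (rule uniform_limit_integral[OF u _ sequentially_bot])
       (intro continuous_intros c continuous_on_packet, blast)
  have I: "I = (\<lambda>n. \<Sum>i<n. integral {0..1} (?f i))"
  proof
    fix n
    show "I n = (\<Sum>i<n. integral {0..1} (?f i))"
      unfolding integral_unique[OF IJ(1)[of n], symmetric] by (intro integral_sum fi) simp
  qed
  have "(\<lambda>i. integral {0..1} (?f i)) sums J"
    using IJ(3) unfolding sums_def by (rule back_subst[where P = "\<lambda>f. (f \<longlongrightarrow> J) sequentially"]) (simp only: I)
  moreover have "integral {0..1} (?f i) = exp (- (2 ^ i / 2)) * integral {0..1} (\<lambda>\<sigma>. \<sigma> ^ k * exp (- \<sigma> / x) * packet i \<sigma>)" for i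
    by (subst integral_mult_right[symmetric]) (simp add: mult_ac)
  ultimately show ?thesis using IJ(2) by (simp add: laplace_def integral_unique)
qed

text \<open>Each term of the remainder contains at least \<open>M\<close> factors \<open>u\<close>; replacing \<open>u\<close> by \<open>3 * u\<close> gains
  \<open>(1 / 3) ^ M\<close>.\<close>

lemma exp_taylor_remainder:
  fixes u :: real assumes "u \<ge> 0"
  shows "\<bar>exp (- u) - (\<Sum>n<M. (- u) ^ n / fact n)\<bar> \<le> (1 / 3) ^ M * exp (3 * u)"
proof -
  have s: "(\<lambda>n. (- u) ^ n / fact n) sums exp (- u)" and s3: "(\<lambda>n. (3 * u) ^ n / fact n) sums exp (3 * u)"
    using exp_converges[of "- u"] exp_converges[of "3 * u"] by (simp_all add: divide_inverse mult.commute)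
  have s3M: "summable (\<lambda>n. (3 * u) ^ (n + M) / fact (n + M))"
    using s3 by (subst summable_iff_shift) (simp add: sums_iff)
  have "exp (- u) - (\<Sum>n<M. (- u) ^ n / fact n) = (\<Sum>n. (- u) ^ (n + M) / fact (n + M))"
    using s suminf_split_initial_segment[of "\<lambda>n. (- u) ^ n / fact n" M] by (simp add: sums_iff)
  also have "\<bar>\<dots>\<bar> \<le> (\<Sum>n. (1 / 3) ^ M * ((3 * u) ^ (n + M) / fact (n + M)))"
    unfolding real_norm_def[symmetric]
  proof (rule norm_suminf_le)
    fix n
    have "u ^ (n + M) \<le> 3 ^ n * u ^ (n + M)"
      using assms mult_right_mono[of 1 "3 ^ n :: real" "u ^ (n + M)"] by simp
    also have "\<dots> = (1 / 3) ^ M * (3 * u) ^ (n + M)"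
      by (simp add: power_mult_distrib power_add power_divide)
    finally show "norm ((- u) ^ (n + M) / fact (n + M)) \<le> (1 / 3) ^ M * ((3 * u) ^ (n + M) / fact (n + M))"
      using assms by (simp add: power_abs divide_right_mono)
  qed (intro summable_mult s3M)
  also have "\<dots> = (1 / 3) ^ M * (\<Sum>n. (3 * u) ^ (n + M) / fact (n + M))"
    by (rule suminf_mult[OF s3M])
  also have "(\<Sum>n. (3 * u) ^ (n + M) / fact (n + M)) \<le> exp (3 * u)"
  proof -
    have "exp (3 * u) = (\<Sum>n. (3 * u) ^ (n + M) / fact (n + M)) + (\<Sum>n<M. (3 * u) ^ n / fact n)"
      using s3 suminf_split_initial_segment[of "\<lambda>n. (3 * u) ^ n / fact n" M] by (simp add: sums_iff)
    moreover have "(\<Sum>n<M. (3 * u) ^ n / fact n) \<ge> 0" using assms by (intro sum_nonneg) auto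
    ultimately show ?thesis by linarith
  qed
  finally show ?thesis by (simp add: mult_left_mono)
qed

text \<open>Since the moments of order below \<open>4 ^ i\<close> vanish, the Taylor polynomial of \<open>exp (- \<sigma> / x)\<close> may be subtracted.  The
  remainder is of size \<open>(1 / 3) ^ (4 ^ i)\<close>, which beats \<open>exp (3 * y)\<close> when \<open>y\<close> is proportional to \<open>2 ^ i\<close>.\<close>

lemma packet_laplace_small:
  assumes "x > 0" "3 / (16 * 2 ^ i) / x \<le> y" "y \<ge> 0"
  shows "\<bar>integral {0..1} (\<lambda>\<sigma>. \<sigma> ^ k * exp (- \<sigma> / x) * packet i \<sigma>)\<bar> \<le> 3 ^ k * (1 / 3) ^ (4 ^ i) * exp (3 * y)"
proof -
  \<comment> \<open>Of the \<open>4 ^ i\<close> vanishing moments, \<open>k\<close> are used up by the factor \<open>\<sigma> ^ k\<close>.  If \<open>k > 4 ^ i\<close>, then \<open>M = 0\<close> and nothing is subtracted.\<close>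
  define M where "M = 4 ^ i - k"
  define P where "P = (\<lambda>\<sigma>. \<Sum>n<M. (- (\<sigma> / x)) ^ n / fact n)"
  have cP: "continuous_on {0..1} P" unfolding P_def using assms(1) by (auto intro!: continuous_intros)
  have cE: "continuous_on {0..1} (\<lambda>\<sigma>. exp (- \<sigma> / x))" using assms(1) by (auto intro!: continuous_intros)
  have P0: "integral {0..1} (\<lambda>\<sigma>. \<sigma> ^ k * P \<sigma> * packet i \<sigma>) = 0"
  proof -
    have "integral {0..1} (\<lambda>\<sigma>. \<sigma> ^ k * P \<sigma> * packet i \<sigma>) =
        integral {0..1} (\<lambda>\<sigma>. \<Sum>n<M. ((- (1 / x)) ^ n / fact n) * (packet i \<sigma> * \<sigma> ^ (n + k)))"
    proof (rule integral_cong)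
      fix \<sigma>
      have "- (\<sigma> / x) = - (1 / x) * \<sigma>" by simp
      then have "(- (\<sigma> / x)) ^ n = (- (1 / x)) ^ n * \<sigma> ^ n" for n
        by (simp only: power_mult_distrib)
      then show "\<sigma> ^ k * P \<sigma> * packet i \<sigma> = (\<Sum>n<M. ((- (1 / x)) ^ n / fact n) * (packet i \<sigma> * \<sigma> ^ (n + k)))"
        unfolding P_def sum_distrib_left sum_distrib_right by (intro sum.cong) (simp_all add: power_add mult_ac)
    qed
    also have "\<dots> = (\<Sum>n<M. integral {0..1} (\<lambda>\<sigma>. ((- (1 / x)) ^ n / fact n) * (packet i \<sigma> * \<sigma> ^ (n + k))))"
      by (intro integral_sum integrable_continuous_real continuous_intros continuous_on_packet) auto
    also have "\<dots> = 0"
      by (intro sum.neutral) (auto simp: M_def packet_moments simp del: power_Suc)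
    finally show ?thesis .
  qed
  have "integral {0..1} (\<lambda>\<sigma>. \<sigma> ^ k * exp (- \<sigma> / x) * packet i \<sigma>) =
      integral {0..1} (\<lambda>\<sigma>. \<sigma> ^ k * exp (- \<sigma> / x) * packet i \<sigma>) - integral {0..1} (\<lambda>\<sigma>. \<sigma> ^ k * P \<sigma> * packet i \<sigma>)"
    by (simp add: P0)
  also have "\<dots> = integral {0..1} (\<lambda>\<sigma>. \<sigma> ^ k * (exp (- \<sigma> / x) - P \<sigma>) * packet i \<sigma>)"
    by (subst Henstock_Kurzweil_Integration.integral_diff[symmetric])
       (use assms(1) in \<open>auto intro!: integrable_continuous_real continuous_intros cP cE continuous_on_packet simp: algebra_simps\<close>)
  finally have eq: "integral {0..1} (\<lambda>\<sigma>. \<sigma> ^ k * exp (- \<sigma> / x) * packet i \<sigma>) =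
      integral {0..1} (\<lambda>\<sigma>. \<sigma> ^ k * (exp (- \<sigma> / x) - P \<sigma>) * packet i \<sigma>)" .
  have "norm (integral {0..1} (\<lambda>\<sigma>. \<sigma> ^ k * (exp (- \<sigma> / x) - P \<sigma>) * packet i \<sigma>)) \<le> ((1 / 3) ^ M * exp (3 * y)) * (1 - 0)"
  proof (rule integral_bound)
    fix \<sigma> :: real assume \<sigma>: "\<sigma> \<in> {0..1}"
    show "norm (\<sigma> ^ k * (exp (- \<sigma> / x) - P \<sigma>) * packet i \<sigma>) \<le> (1 / 3) ^ M * exp (3 * y)"
    proof (cases "\<sigma> \<in> {left_end i..3 / (16 * 2 ^ i)}")
      case True
      then have "\<sigma> / x \<le> y" using assms(1) by (intro order_trans[OF divide_right_mono assms(2)]) auto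
      have "\<bar>exp (- (\<sigma> / x)) - P \<sigma>\<bar> \<le> (1 / 3) ^ M * exp (3 * (\<sigma> / x))"
        unfolding P_def using \<sigma> assms(1) by (intro exp_taylor_remainder) auto
      also have "\<dots> \<le> (1 / 3) ^ M * exp (3 * y)"
        using \<open>\<sigma> / x \<le> y\<close> by simp
      finally have R: "\<bar>exp (- (\<sigma> / x)) - P \<sigma>\<bar> \<le> (1 / 3) ^ M * exp (3 * y)" .
      have "\<bar>\<sigma> ^ k\<bar> * \<bar>exp (- (\<sigma> / x)) - P \<sigma>\<bar> * \<bar>packet i \<sigma>\<bar> \<le> 1 * ((1 / 3) ^ M * exp (3 * y)) * 1"
        using \<sigma> packet_le_1 by (intro mult_mono R) (auto simp: power_le_one)
      then show ?thesis by (simp add: abs_mult)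
    qed (simp add: packet_eq_0)
  qed (use assms(1) in \<open>auto intro!: continuous_intros cP cE continuous_on_packet\<close>)
  also have "(1 / 3) ^ M * exp (3 * y) * (1 - 0) \<le> 3 ^ k * (1 / 3) ^ (4 ^ i) * exp (3 * y)"
  proof -
    have "(1 / 3 :: real) ^ M \<le> 3 ^ k * (1 / 3) ^ (4 ^ i)"
    proof (cases "k \<le> 4 ^ i")
      case True
      then have "4 ^ i = M + k" by (simp add: M_def)
      then show ?thesis by (simp add: power_add power_divide)
    next
      case False
      then have "(3::real) ^ 4 ^ i \<le> 3 ^ k" by (intro power_increasing) auto
      then show ?thesis using False by (simp add: M_def power_divide)
    qed
    then show ?thesis by simp
  qed
  finally show ?thesis unfolding eq real_norm_def .
qed

text \<open>Let \<open>x\<close> be comparable to \<open>1 / 4 ^ j\<close> and \<open>s\<close> in the support of the \<open>j\<close>-th packet.  A packet with \<open>i < j\<close> lies to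
  the right of \<open>s\<close> by at least \<open>1 / (16 * 2 ^ j)\<close>, and \<open>exp ((s - \<sigma>) / x)\<close> is small on it.  For \<open>i \<ge> j\<close> this
  exponential may be as large as \<open>exp (48 * 2 ^ j)\<close>, and the vanishing moments decide.\<close>

lemma laplace_term_bound:
  fixes s x :: real
  assumes s: "s \<in> {left_end j..3 / (16 * 2 ^ j)}" and x: "x \<in> {1 / (256 * 4 ^ j)..1 / (32 * 4 ^ j)}"
  shows "\<bar>exp (s / x) * (exp (- (2 ^ i / 2)) * integral {0..1} (\<lambda>\<sigma>. \<sigma> ^ k * exp (- \<sigma> / x) * packet i \<sigma>))\<bar>
    \<le> 3 ^ k * exp 9409 * exp (- (2 ^ j)) * (1 / 2) ^ i"
proof -
  define z :: real where "z = 2 ^ j"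
  have z1: "z \<ge> 1" by (simp add: z_def)
  have z2: "4 ^ j = z\<^sup>2" by (simp add: z_def power2_eq_square flip: power_mult_distrib)
  have "1 / (256 * z\<^sup>2) > 0" using z1 by simp
  then have x0: "x > 0" using x unfolding z2 by (meson atLeastAtMost_iff less_le_trans)
  have xl: "1 / x \<le> 256 * z\<^sup>2" and xu: "1 / x \<ge> 32 * z\<^sup>2"
    using x x0 z1 by (auto simp: z2 field_simps)
  have C1: "(1::real) \<le> 3 ^ k * exp 9409"
    using mult_mono[of 1 "3 ^ k :: real" 1 "exp 9409"] by simp
  show ?thesis
  proof (cases "i < j")
    case True
    have "(2::real) ^ Suc i \<le> 2 ^ j" using True by (intro power_increasing) auto
    then have li: "left_end i \<ge> 1 / (4 * z)" using z1 by (simp add: left_end_def z_def field_simps)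
    have "norm (integral {0..1} (\<lambda>\<sigma>. exp (s / x) * (\<sigma> ^ k * exp (- \<sigma> / x) * packet i \<sigma>))) \<le> exp (- 2 * z) * (1 - 0)"
    proof (rule integral_bound)
      fix \<sigma> :: real assume \<sigma>: "\<sigma> \<in> {0..1}"
      show "norm (exp (s / x) * (\<sigma> ^ k * exp (- \<sigma> / x) * packet i \<sigma>)) \<le> exp (- 2 * z)"
      proof (cases "\<sigma> \<in> {left_end i..3 / (16 * 2 ^ i)}")
        case True
        have "s - \<sigma> \<le> 3 / (16 * z) - 1 / (4 * z)" using s True li by (auto simp: z_def)
        also have "\<dots> = - (1 / (16 * z))" using z1 by (simp add: field_simps)
        finally have "(s - \<sigma>) * (1 / x) \<le> - (1 / (16 * z)) * (1 / x)"
          using x0 by (intro mult_right_mono) auto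
        also have "\<dots> \<le> - (1 / (16 * z)) * (32 * z\<^sup>2)"
          using xu z1 by (intro mult_left_mono_neg) auto
        also have "\<dots> = - 2 * z" using z1 by (simp add: power2_eq_square)
        finally have "exp (s / x) * exp (- \<sigma> / x) \<le> exp (- 2 * z)"
          by (simp add: exp_add[symmetric] diff_divide_distrib)
        then have "\<bar>\<sigma> ^ k\<bar> * (exp (s / x) * exp (- \<sigma> / x)) * \<bar>packet i \<sigma>\<bar> \<le> 1 * exp (- 2 * z) * 1"
          using \<sigma> packet_le_1 by (intro mult_mono) (auto simp: power_le_one)
        then show ?thesis by (simp add: abs_mult mult_ac)
      qed (simp add: packet_eq_0)
    qed (use x0 in \<open>auto intro!: continuous_intros continuous_on_packet\<close>)
    then have "\<bar>exp (s / x) * integral {0..1} (\<lambda>\<sigma>. \<sigma> ^ k * exp (- \<sigma> / x) * packet i \<sigma>)\<bar> \<le> exp (- 2 * z)"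
      by simp
    then have "exp (- (2 ^ i / 2)) * \<bar>exp (s / x) * integral {0..1} (\<lambda>\<sigma>. \<sigma> ^ k * exp (- \<sigma> / x) * packet i \<sigma>)\<bar>
        \<le> 1 * exp (- 2 * z)"
      by (intro mult_mono) auto
    also have "\<dots> = exp (- z) * exp (- z)" by (simp add: exp_add[symmetric])
    also have "\<dots> \<le> exp (- z) * (1 / 2) ^ i"
    proof (intro mult_left_mono)
      have "(2::real) ^ i \<le> 2 ^ j" using True by (intro power_increasing) auto
      also have "\<dots> \<le> exp z" unfolding z_def by (rule two_power_le_exp)
      finally show "exp (- z) \<le> (1 / 2) ^ i" by (simp add: exp_minus power_divide field_simps)
    qed simp
    also have "\<dots> \<le> 3 ^ k * exp 9409 * (exp (- z) * (1 / 2) ^ i)"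
      using mult_right_mono[OF C1, of "exp (- z) * (1 / 2) ^ i"] by simp
    finally show ?thesis by (simp add: z_def abs_mult mult_ac)
  next
    case False
    define t :: real where "t = 2 ^ i"
    have tz: "t \<ge> z" using False by (simp add: t_def z_def)
    have t2: "real (4 ^ i) = t\<^sup>2" by (simp add: t_def power2_eq_square flip: power_mult_distrib)
    have sx: "3 / (16 * z) * (1 / x) \<le> 48 * z"
    proof -
      have "3 / (16 * z) * (1 / x) \<le> 3 / (16 * z) * (256 * z\<^sup>2)" using xl z1 by (intro mult_left_mono) auto
      also have "\<dots> = 48 * z" using z1 by (simp add: power2_eq_square)
      finally show ?thesis .
    qed
    have "s * (1 / x) \<le> 3 / (16 * z) * (1 / x)" using s x0 by (intro mult_right_mono) (auto simp: z_def)
    then have e1: "exp (s / x) \<le> exp (48 * z)" using sx by simp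
    have "3 / (16 * 2 ^ i) * (1 / x) \<le> 3 / (16 * z) * (1 / x)"
      using tz z1 x0 by (intro mult_right_mono divide_left_mono) (auto simp: t_def)
    then have y: "3 / (16 * 2 ^ i) / x \<le> 48 * z" using sx by simp
    have "\<bar>integral {0..1} (\<lambda>\<sigma>. \<sigma> ^ k * exp (- \<sigma> / x) * packet i \<sigma>)\<bar> \<le> 3 ^ k * (1 / 3) ^ (4 ^ i) * exp (3 * (48 * z))"
      by (rule packet_laplace_small[OF x0 y]) (use z1 in simp)
    then have "exp (s / x) * (exp (- (2 ^ i / 2)) * \<bar>integral {0..1} (\<lambda>\<sigma>. \<sigma> ^ k * exp (- \<sigma> / x) * packet i \<sigma>)\<bar>)
        \<le> exp (48 * z) * (1 * (3 ^ k * (1 / 3) ^ (4 ^ i) * exp (3 * (48 * z))))"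
      using e1 by (intro mult_mono) auto
    also have "\<dots> = 3 ^ k * (1 / 3) ^ (4 ^ i) * exp (192 * z)"
      by (simp add: mult_ac flip: exp_add)
    also have "\<dots> \<le> 3 ^ k * exp (- (t\<^sup>2)) * exp (192 * z)"
    proof -
      have "(1 / 3 :: real) ^ (4 ^ i) \<le> exp (- 1) ^ (4 ^ i)"
        using exp_le by (intro power_mono) (auto simp: exp_minus field_simps)
      also have "\<dots> = exp (- (t\<^sup>2))" by (simp add: exp_of_nat_mult[symmetric] t2[symmetric])
      finally show ?thesis by simp
    qed
    also have "\<dots> \<le> 3 ^ k * (exp 9409 * exp (- z) * exp (- t))"
    proof -
      \<comment> \<open>Since \<open>z \<le> t\<close>, it suffices that \<open>194 * t - t\<^sup>2 \<le> 97\<^sup>2 = 9409\<close>.\<close>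
      have "0 \<le> (t - 97)\<^sup>2" by simp
      then have "- (t\<^sup>2) + 192 * z \<le> 9409 - z - t" using tz by (simp add: power2_diff)
      then have "exp (- (t\<^sup>2) + 192 * z) \<le> exp (9409 - z - t)" by simp
      also have "exp (9409 - z - t) = exp 9409 * exp (- z) * exp (- t)"
        by (simp flip: exp_add)
      finally have "exp (- (t\<^sup>2)) * exp (192 * z) \<le> exp 9409 * exp (- z) * exp (- t)"
        by (simp only: exp_add)
      then have "3 ^ k * (exp (- (t\<^sup>2)) * exp (192 * z)) \<le> 3 ^ k * (exp 9409 * exp (- z) * exp (- t))"
        by (rule mult_left_mono) simp
      then show ?thesis by (simp only: mult.assoc)
    qed
    also have "\<dots> \<le> 3 ^ k * (exp 9409 * exp (- z) * (1 / 2) ^ i)"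
    proof -
      have "exp (- t) \<le> (1 / 2) ^ i"
        using two_power_le_exp[of i] by (simp add: t_def exp_minus power_divide field_simps)
      then show ?thesis by (intro mult_left_mono) auto
    qed
    finally show ?thesis unfolding z_def abs_mult abs_exp_cancel by (simp only: mult.assoc)
  qed
qed

text \<open>The estimate on which the construction rests: the whole integral to be cancelled is exponentially
  small, in \<open>2 ^ j\<close>, compared with what the \<open>j\<close>-th packet can contribute.\<close>

lemma laplace_bound:
  fixes s x :: real
  assumes s: "s \<in> {left_end j..3 / (16 * 2 ^ j)}" and x: "x \<in> {1 / (256 * 4 ^ j)..1 / (32 * 4 ^ j)}"
  shows "\<bar>exp (s / x) * laplace k x\<bar> \<le> 2 * (3 ^ k * exp 9409) * exp (- (2 ^ j))"
proof -
  have "0 < 1 / (256 * 4 ^ j :: real)" by simp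
  then have x0: "x > 0" using x by (meson atLeastAtMost_iff less_le_trans)
  define c :: real where "c = 3 ^ k * exp 9409 * exp (- (2 ^ j))"
  have "(\<lambda>i. (1 / 2 :: real) ^ i) sums (1 / (1 - 1 / 2))" by (rule geometric_sums) simp
  from sums_mult[OF this, of c] have g: "(\<lambda>i. c * (1 / 2) ^ i) sums (2 * c)" by (simp add: mult.commute[of 2])
  let ?f = "\<lambda>i. exp (s / x) * (exp (- (2 ^ i / 2)) * integral {0..1} (\<lambda>\<sigma>. \<sigma> ^ k * exp (- \<sigma> / x) * packet i \<sigma>))"
  have "?f sums (exp (s / x) * laplace k x)" by (rule sums_mult[OF laplace_sums[OF x0]])
  then have "exp (s / x) * laplace k x = suminf ?f" by (rule sums_unique)
  moreover have "norm (suminf ?f) \<le> (\<Sum>i. c * (1 / 2) ^ i)"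
  proof (rule norm_suminf_le)
    show "norm (?f i) \<le> c * (1 / 2) ^ i" for i
      unfolding c_def real_norm_def by (rule laplace_term_bound[OF s x])
    show "summable (\<lambda>i. c * (1 / 2) ^ i)" using g by (rule sums_summable)
  qed
  ultimately have "norm (exp (s / x) * laplace k x) \<le> 2 * c"
    using sums_unique[OF g] by metis
  then show ?thesis unfolding c_def real_norm_def by (simp only: mult.assoc)
qed

lemma laplace_deriv:
  assumes "x > 0"
  shows "(laplace k has_real_derivative laplace (Suc k) x / x\<^sup>2) (at x)"
proof -
  have "((\<lambda>x. integral (cbox 0 1) (\<lambda>\<sigma>. \<sigma> ^ k * exp (- \<sigma> / x) * signal \<sigma>)) has_field_derivative
      integral (cbox 0 1) (\<lambda>\<sigma>. \<sigma> ^ k * (exp (- \<sigma> / x) * (\<sigma> / x\<^sup>2)) * signal \<sigma>)) (at x within {0<..})"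
  proof (rule leibniz_rule_field_derivative[where U = "{0<..}"])
    fix y \<sigma> :: real assume "y \<in> {0<..}" "\<sigma> \<in> cbox 0 1"
    then show "((\<lambda>y. \<sigma> ^ k * exp (- \<sigma> / y) * signal \<sigma>) has_field_derivative
        \<sigma> ^ k * (exp (- \<sigma> / y) * (\<sigma> / y\<^sup>2)) * signal \<sigma>) (at y within {0<..})"
      by (auto intro!: derivative_eq_intros simp: power2_eq_square)
  next
    fix y :: real assume "y \<in> {0<..}"
    then show "(\<lambda>\<sigma>. \<sigma> ^ k * exp (- \<sigma> / y) * signal \<sigma>) integrable_on cbox 0 1"
      by (intro integrable_continuous continuous_intros continuous_on_signal) auto
  next
    show "continuous_on ({0<..} \<times> cbox 0 1) (\<lambda>(y, \<sigma>). \<sigma> ^ k * (exp (- \<sigma> / y) * (\<sigma> / y\<^sup>2)) * signal \<sigma>)"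
      unfolding case_prod_unfold
      by (intro continuous_intros continuous_on_compose2[OF continuous_on_signal[of UNIV]]) auto
  qed (use assms in auto)
  then have "((\<lambda>x. integral (cbox 0 1) (\<lambda>\<sigma>. \<sigma> ^ k * exp (- \<sigma> / x) * signal \<sigma>)) has_field_derivative
      integral (cbox 0 1) (\<lambda>\<sigma>. \<sigma> ^ k * (exp (- \<sigma> / x) * (\<sigma> / x\<^sup>2)) * signal \<sigma>)) (at x)"
    using assms by (subst (asm) at_within_open) auto
  moreover have "integral (cbox 0 1) (\<lambda>\<sigma>. \<sigma> ^ k * (exp (- \<sigma> / x) * (\<sigma> / x\<^sup>2)) * signal \<sigma>) = laplace (Suc k) x / x\<^sup>2"
  proof -
    have "(\<lambda>\<sigma>. \<sigma> ^ k * (exp (- \<sigma> / x) * (\<sigma> / x\<^sup>2)) * signal \<sigma>) =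
        (\<lambda>\<sigma>. \<sigma> ^ Suc k * exp (- \<sigma> / x) * signal \<sigma> / x\<^sup>2)"
      by (auto simp: mult_ac)
    then show ?thesis by (simp only: laplace_def integral_divide cbox_interval)
  qed
  ultimately show ?thesis unfolding laplace_def[abs_def] by (simp only: cbox_interval)
qed

section \<open>The smooth weight\<close>

text \<open>The summands of the correction \<open>1 - Q\<close>, with general factors \<open>u\<close> and \<open>v\<close> in place of the packets and the
  partition of unity.  In this generality the class is closed under both partial derivatives
  up to linear combinations (\<open>wave_deriv\<close>).  The factor \<open>exp (2 ^ j / 2)\<close> undoes the weight of the packet in \<open>signal\<close>.\<close>

definition wave :: "nat \<Rightarrow> (nat \<Rightarrow> real \<Rightarrow> real) \<Rightarrow> (nat \<Rightarrow> real \<Rightarrow> real) \<Rightarrow> nat \<Rightarrow> real \<times> real \<Rightarrow> real" where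
  "wave k u v j p = exp (2 ^ j / 2) * (u j (fst p) * v j (snd p)) * (exp (fst p / snd p) * laplace k (snd p))"

text \<open>The growth \<open>exp (2 ^ j / 2)\<close> of the normalisation meets the decay \<open>exp (- (2 ^ j))\<close> of the Laplace transform.\<close>

lemma wave_bound:
  assumes "controlled (\<lambda>j. {left_end j..3 / (16 * 2 ^ j)}) u"
    and "controlled (\<lambda>j. {1 / (256 * 4 ^ j)..1 / (32 * 4 ^ j)}) v"
  shows "\<exists>g. poly_bounded g \<and> (\<forall>j p. \<bar>wave k u v j p\<bar> \<le> g j * exp (- (2 ^ j / 2)))"
proof -
  obtain g where g: "poly_bounded g" "\<And>j s. \<bar>u j s\<bar> \<le> g j" "\<And>j. g j \<ge> 0"
      "\<And>j s. s \<notin> {left_end j..3 / (16 * 2 ^ j)} \<Longrightarrow> u j s = 0" using controlledE[OF assms(1)] by metis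
  obtain h where h: "poly_bounded h" "\<And>j s. \<bar>v j s\<bar> \<le> h j" "\<And>j. h j \<ge> 0"
      "\<And>j s. s \<notin> {1 / (256 * 4 ^ j)..1 / (32 * 4 ^ j)} \<Longrightarrow> v j s = 0" using controlledE[OF assms(2)] by metis
  define c :: real where "c = 2 * (3 ^ k * exp 9409)"
  have c0: "c \<ge> 0" by (simp add: c_def)
  have "\<bar>wave k u v j p\<bar> \<le> g j * h j * c * exp (- (2 ^ j / 2))" for j p
  proof (cases "fst p \<in> {left_end j..3 / (16 * 2 ^ j)} \<and> snd p \<in> {1 / (256 * 4 ^ j)..1 / (32 * 4 ^ j)}")
    case True
    have L: "\<bar>exp (fst p / snd p) * laplace k (snd p)\<bar> \<le> c * exp (- (2 ^ j))"
      unfolding c_def by (rule laplace_bound) (use True in auto)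
    have "\<bar>u j (fst p)\<bar> * \<bar>v j (snd p)\<bar> \<le> g j * h j" by (intro mult_mono g h) auto
    then have "exp (2 ^ j / 2) * (\<bar>u j (fst p)\<bar> * \<bar>v j (snd p)\<bar>) * \<bar>exp (fst p / snd p) * laplace k (snd p)\<bar>
        \<le> exp (2 ^ j / 2) * (g j * h j) * (c * exp (- (2 ^ j)))"
      by (intro mult_mono L mult_nonneg_nonneg g h) auto
    also have "\<dots> = g j * h j * c * (exp (2 ^ j / 2) * exp (- (2 ^ j)))" by (simp only: mult_ac)
    also have "exp (2 ^ j / 2) * exp (- (2 ^ j)) = exp (- (2 ^ j / 2 :: real))" by (simp flip: exp_add)
    finally show ?thesis unfolding wave_def abs_mult abs_exp_cancel .
  next
    case False
    then have "wave k u v j p = 0" using g(4) h(4) by (auto simp: wave_def)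
    then show ?thesis using g(3)[of j] h(3)[of j] c0 by simp
  qed
  moreover have "poly_bounded (\<lambda>j. g j * h j * c)"
    by (intro poly_bounded_mult g h poly_bounded_const)
  ultimately show ?thesis by (intro exI[of _ "\<lambda>j. g j * h j * c"]) auto
qed

lemma wave_deriv:
  assumes u: "\<And>j s. (u j has_real_derivative u' j s) (at s)"
    and v: "\<And>j x. (v j has_real_derivative v' j x) (at x)"
    and v0: "\<And>j x. x < 1 / (256 * 4 ^ j) \<Longrightarrow> v j x = 0" "\<And>j x. x < 1 / (256 * 4 ^ j) \<Longrightarrow> v' j x = 0"
  shows "(wave k u v j has_derivative
    (\<lambda>d. fst d * (wave k u' v j p + wave k u (\<lambda>j x. v j x / x) j p) +
         snd d * (wave k u v' j p + (- 1) * wave k (\<lambda>j s. s * u j s) (\<lambda>j x. v j x / x / x) j p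
           + wave (Suc k) u (\<lambda>j x. v j x / x / x) j p))) (at p)"
proof (cases "snd p < 1 / (256 * 4 ^ j)")
  case True
  have z: "wave k' w (\<lambda>j x. v j x / x) j p = 0" "wave k' w (\<lambda>j x. v j x / x / x) j p = 0"
      "wave k' w v j p = 0" "wave k' w v' j p = 0" for k' w
    using True v0 by (simp_all add: wave_def)
  have "((\<lambda>_. 0) has_derivative (\<lambda>_. 0)) (at p)" by simp
  then have "(wave k u v j has_derivative (\<lambda>_. 0)) (at p)"
  proof (rule has_derivative_transform_within_open)
    show "open {q :: real \<times> real. snd q < 1 / (256 * 4 ^ j)}"
      by (intro open_Collect_less continuous_intros)
    show "p \<in> {q. snd q < 1 / (256 * 4 ^ j)}" using True by simp
    show "0 = wave k u v j q" if "q \<in> {q. snd q < 1 / (256 * 4 ^ j)}" for q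
      using that v0 by (simp add: wave_def)
  qed
  then show ?thesis unfolding z by simp
next
  case False
  have "0 < 1 / (256 * 4 ^ j :: real)" by simp
  then have x: "snd p > 0" using False by linarith
  have du: "((\<lambda>q. u j (fst q)) has_derivative (\<lambda>d. fst d * u' j (fst p))) (at p)"
    by (rule DERIV_compose_FDERIV[where f = "u j" and g = fst, OF u]) (auto intro!: derivative_eq_intros)
  have dv: "((\<lambda>q. v j (snd q)) has_derivative (\<lambda>d. snd d * v' j (snd p))) (at p)"
    by (rule DERIV_compose_FDERIV[where f = "v j" and g = snd, OF v]) (auto intro!: derivative_eq_intros)
  have dl: "((\<lambda>q. laplace k (snd q)) has_derivative (\<lambda>d. snd d * (laplace (Suc k) (snd p) / (snd p)\<^sup>2))) (at p)"
    by (rule DERIV_compose_FDERIV[where f = "laplace k" and g = snd, OF laplace_deriv[OF x]]) (auto intro!: derivative_eq_intros)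
  have dq: "((\<lambda>q. fst q / snd q) has_derivative (\<lambda>d. fst d / snd p - snd d * fst p / (snd p)\<^sup>2)) (at p)"
    using x by (auto intro!: derivative_eq_intros simp: power2_eq_square field_simps)
  have de: "((\<lambda>q. exp (fst q / snd q)) has_derivative
      (\<lambda>d. (fst d / snd p - snd d * fst p / (snd p)\<^sup>2) * exp (fst p / snd p))) (at p)"
    by (rule DERIV_compose_FDERIV[where f = exp and g = "\<lambda>q. fst q / snd q", OF DERIV_exp dq])
  note D = has_derivative_mult[OF has_derivative_mult_right[OF has_derivative_mult[OF du dv], of "exp (2 ^ j / 2)"]
      has_derivative_mult[OF de dl]]
  \<comment> \<open>The formula for the derivative, as a polynomial identity in the values of the factors and the reciprocal of the second variable.\<close>
  have ring: "E * (U * V) * (X * (c * (L' * (I * I))) + (a * I - c * s * (I * I)) * X * L) +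
      E * (U * (c * V') + a * U' * V) * (X * L) =
      a * (E * (U' * V) * (X * L) + E * (U * (V * I)) * (X * L)) +
      c * (E * (U * V') * (X * L) + (- 1) * (E * (s * U * (V * I * I)) * (X * L)) + E * (U * (V * I * I)) * (X * L'))"
    for E U V X c L' I a s L V' U' :: real
    by (simp add: algebra_simps)
  show ?thesis unfolding wave_def[abs_def]
  proof (rule has_derivative_eq_rhs[OF D], rule ext)
    fix d :: "real \<times> real"
    show "exp (2 ^ j / 2) * (u j (fst p) * v j (snd p)) *
        (exp (fst p / snd p) * (snd d * (laplace (Suc k) (snd p) / (snd p)\<^sup>2)) +
         (fst d / snd p - snd d * fst p / (snd p)\<^sup>2) * exp (fst p / snd p) * laplace k (snd p)) +
        exp (2 ^ j / 2) * (u j (fst p) * (snd d * v' j (snd p)) + fst d * u' j (fst p) * v j (snd p)) *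
        (exp (fst p / snd p) * laplace k (snd p)) =
        fst d * (exp (2 ^ j / 2) * (u' j (fst p) * v j (snd p)) * (exp (fst p / snd p) * laplace k (snd p)) +
          exp (2 ^ j / 2) * (u j (fst p) * (v j (snd p) / snd p)) * (exp (fst p / snd p) * laplace k (snd p))) +
        snd d * (exp (2 ^ j / 2) * (u j (fst p) * v' j (snd p)) * (exp (fst p / snd p) * laplace k (snd p)) +
          (- 1) * (exp (2 ^ j / 2) * (fst p * u j (fst p) * (v j (snd p) / snd p / snd p)) *
            (exp (fst p / snd p) * laplace k (snd p))) +
          exp (2 ^ j / 2) * (u j (fst p) * (v j (snd p) / snd p / snd p)) *
            (exp (fst p / snd p) * laplace (Suc k) (snd p)))"
      unfolding divide_inverse power2_eq_square inverse_mult_distrib by (rule ring)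
  qed
qed

lemma wave_Ck_sum:
  assumes "tame (Suc n) (\<lambda>j. {left_end j..3 / (16 * 2 ^ j)}) u"
    and "tame (Suc n) (\<lambda>j. {1 / (256 * 4 ^ j)..1 / (32 * 4 ^ j)}) v"
  shows "Ck_sum n UNIV (wave k u v)"
  using assms
proof (induction n arbitrary: k u v)
  case (0 k u v)
  obtain g where g: "poly_bounded g" "\<And>j p. \<bar>wave k u v j p\<bar> \<le> g j * exp (- (2 ^ j / 2))"
    using wave_bound[OF 0[THEN tame_imp_controlled]] by blast
  obtain u' where u': "\<And>j s. (u j has_real_derivative u' j s) (at s)" using tame_SucE[OF 0(1)] by metis
  obtain v' where v': "\<And>j s. (v j has_real_derivative v' j s) (at s)"
    "tame 0 (\<lambda>j. {1 / (256 * 4 ^ j)..1 / (32 * 4 ^ j)}) v'" using tame_SucE[OF 0(2)] by metis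
  have v0: "v j x = 0" "v' j x = 0" if "x < 1 / (256 * 4 ^ j)" for j x
    using tame_imp_controlled[OF 0(2)] tame_imp_controlled[OF v'(2)] that by (auto simp: controlled_def)
  have "continuous_on UNIV (wave k u v j)" for j
    by (intro continuous_at_imp_continuous_on ballI has_derivative_continuous[OF wave_deriv[where u' = u' and v' = v']] u' v'(1) v0)
  then show ?case unfolding Ck_sum.simps by (rule M_testI[OF _ summable_poly_exp[OF g(1)] g(2)])
next
  case (Suc n k u v)
  obtain g where g: "poly_bounded g" "\<And>j p. \<bar>wave k u v j p\<bar> \<le> g j * exp (- (2 ^ j / 2))"
    using wave_bound[OF Suc.prems[THEN tame_imp_controlled]] by blast
  let ?S = "\<lambda>j. {left_end j..3 / (16 * 2 ^ j)}"
  let ?T = "\<lambda>j. {1 / (256 * 4 ^ j)..1 / (32 * 4 ^ j) :: real}"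
  obtain u' where u': "\<And>j s. (u j has_real_derivative u' j s) (at s)" "tame (Suc n) ?S u'"
    using tame_SucE[OF Suc.prems(1)] by metis
  obtain v' where v': "\<And>j s. (v j has_real_derivative v' j s) (at s)" "tame (Suc n) ?T v'"
    using tame_SucE[OF Suc.prems(2)] by metis
  have v0: "v j x = 0" "v' j x = 0" if "x < 1 / (256 * 4 ^ j)" for j x
    using tame_imp_controlled[OF Suc.prems(2)] tame_imp_controlled[OF v'(2)] that by (auto simp: controlled_def)
  have d: "(wave k u v j has_derivative
    (\<lambda>d. fst d * (wave k u' v j p + wave k u (\<lambda>j x. v j x / x) j p) +
         snd d * (wave k u v' j p + (- 1) * wave k (\<lambda>j s. s * u j s) (\<lambda>j x. v j x / x / x) j p
           + wave (Suc k) u (\<lambda>j x. v j x / x / x) j p))) (at p)" for j p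
    by (rule wave_deriv) (rule u'(1) v'(1) v0; assumption)+
  have c: "continuous_on UNIV (wave k u v j)" for j
    by (intro continuous_at_imp_continuous_on ballI has_derivative_continuous[OF d])
  note tu = tame_SucD[OF Suc.prems(1)] and tv = tame_SucD[OF Suc.prems(2)]
  have t1: "tame (Suc n) ?T (\<lambda>j x. w j x / x)" if "tame (Suc n) ?T w" for w
    by (rule tame_divide_id[of _ "\<lambda>j. 1 / (256 * 4 ^ j)", OF _ _ _ that])
       (use poly_bounded_four_power[of 256] in auto)
  have t2: "tame (Suc n) ?S (\<lambda>j s. s * u j s)"
  proof (rule tame_times_id[OF _ tu])
    fix j s assume s: "s \<in> ?S j"
    have "3 \<le> 16 * (2::real) ^ j" using one_le_power[of "2::real" j] by linarith
    then have "3 / (16 * 2 ^ j) \<le> (1::real)" by simp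
    then have "s \<le> 1" using s by (auto intro: order_trans)
    moreover have "left_end j > 0" by (simp add: left_end_def)
    ultimately show "\<bar>s\<bar> \<le> 1" using s by auto
  qed
  show ?case
  proof (rule Ck_sum_SucI[OF M_testI[OF c summable_poly_exp[OF g(1)] g(2)] d])
    fix w :: "real \<times> real"
    show "Ck_sum n UNIV (\<lambda>j p. fst w * (wave k u' v j p + wave k u (\<lambda>j x. v j x / x) j p) +
         snd w * (wave k u v' j p + (- 1) * wave k (\<lambda>j s. s * u j s) (\<lambda>j x. v j x / x / x) j p
           + wave (Suc k) u (\<lambda>j x. v j x / x / x) j p))"
      by (intro Ck_sum_add Ck_sum_cmult Suc.IH u'(2) v'(2) tu tv t2 t1[OF tv] t1[OF t1[OF tv]])
  qed
qed

lemma packet_supports_disjoint: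
  assumes "s \<in> {left_end j..3 / (16 * 2 ^ j)}" "i \<noteq> j"
  shows "s \<notin> {left_end i..3 / (16 * 2 ^ i)}"
proof -
  have *: "3 / (16 * 2 ^ b) < left_end a" if "a < b" for a b :: nat
  proof -
    have "(2::real) ^ Suc a \<le> 2 ^ b" using that by (intro power_increasing) auto
    moreover have "(2::real) ^ a > 0" by simp
    ultimately have "3 * 2 ^ a < 2 * (2::real) ^ b" unfolding power_Suc by linarith
    then show ?thesis by (simp add: left_end_def field_simps)
  qed
  show ?thesis using *[of i j] *[of j i] assms by (cases i j rule: linorder_cases) auto
qed

lemma signal_on_packet:
  assumes "s \<in> {left_end j..3 / (16 * 2 ^ j)}"
  shows "signal s = exp (- (2 ^ j / 2)) * packet j s"
proof -
  have "signal s = (\<Sum>i\<in>{j}. exp (- (2 ^ i / 2)) * packet i s)"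
    unfolding signal_def
    by (rule suminf_finite) (use packet_supports_disjoint[OF assms] packet_eq_0 in auto)
  then show ?thesis by simp
qed

lemma signal_eq_0:
  assumes "s \<notin> {0..3 / 16}" shows "signal s = 0"
proof -
  have "packet j s = 0" for j
  proof (rule packet_eq_0, rule notI)
    assume s: "s \<in> {left_end j..3 / (16 * 2 ^ j)}"
    have "3 / (16 * 2 ^ j) \<le> (3 / 16 :: real)" by (simp add: field_simps)
    moreover have "left_end j > 0" by (simp add: left_end_def)
    ultimately show False using s assms by auto
  qed
  then show ?thesis by (simp add: signal_def)
qed

lemma packet_signal_integral:
  "integral {0..1} (\<lambda>s. packet j s * signal s) = exp (- (2 ^ j / 2)) * energy j"
proof -
  have "(\<lambda>s. packet j s * signal s) = (\<lambda>s. exp (- (2 ^ j / 2)) * (packet j s)\<^sup>2)"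
    using signal_on_packet packet_eq_0 by (fastforce simp: power2_eq_square)
  then show ?thesis by (simp add: energy_def)
qed

lemma smooth_cpt_signal: "smooth_cpt_on {0..<1/3} signal"
  unfolding smooth_cpt_on_def
proof (intro conjI allI impI)
  show "smooth_on {0..<1/3} signal"
    unfolding smooth_on_def by (auto intro: Ck_on_subset[OF Ck_on_signal])
  have "{s \<in> {0..<1/3}. signal s \<noteq> 0} \<subseteq> {0..3/16}" using signal_eq_0 by blast
  then have cl: "closure {s \<in> {0..<1/3}. signal s \<noteq> 0} \<subseteq> {0..3/16}"
    by (rule closure_minimal) simp
  then have "{0..<1/3} \<inter> closure {s \<in> {0..<1/3}. signal s \<noteq> 0} = closure {s \<in> {0..<1/3}. signal s \<noteq> 0}"
    by force
  moreover have "compact (closure {s \<in> {0..<1/3}. signal s \<noteq> 0})"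
    using cl by (meson closed_closure compact_Icc compact_eq_bounded_closed bounded_subset)
  ultimately show "compact ({0..<1/3} \<inter> closure {s \<in> {0..<1/3}. signal s \<noteq> 0})" by simp
  show "signal s = 0" if "s \<notin> {0..<1/3}" for s
    by (rule signal_eq_0) (use that in auto)
qed

lemma signal_nonzero: "\<exists>s\<in>{0..<1/3}. signal s \<noteq> 0"
proof (rule ccontr)
  assume "\<not> ?thesis"
  then have "signal s = 0" for s
    using smooth_cpt_signal unfolding smooth_cpt_on_def by blast
  then have "exp (- (2 ^ 0 / 2)) * energy 0 = 0" using packet_signal_integral[of 0] by simp
  then show False using energy_pos[of 0] by simp
qed

lemma sum_cutoff:
  "J \<le> n \<Longrightarrow> (\<Sum>j=J..<n. cutoff j x) = step (64 * 4 ^ n * x - 1) - step (64 * 4 ^ J * x - 1)"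
proof (induction n rule: dec_induct)
  case (step n)
  then show ?case by (simp add: cutoff_def mult.assoc)
qed simp

text \<open>The factor \<open>exp (s / x)\<close> in the correction cancels \<open>exp (- s / x)\<close>, and integrating the \<open>j\<close>-th packet against
  \<open>signal\<close> gives exactly its weighted energy.  So the \<open>j\<close>-th term removes the portion \<open>cutoff j x\<close> of the
  integral, and for small \<open>x\<close> these portions add up to one.\<close>

lemma corrected_integral_zero:
  assumes x: "0 < x" "x \<le> 1 / (64 * 4 ^ J)"
  defines "u \<equiv> \<lambda>j s. (if j < J then 0 else 1 / energy j) * packet j s"
  shows "(LINT s|lebesgue_on {0..1}. exp (- s / x) * (1 - (\<Sum>j. wave 0 u cutoff j (s, x))) * signal s) = 0"
proof -
  \<comment> \<open>Beyond \<open>n\<close> the cutoffs vanish at this \<open>x\<close>, so the series is a finite sum.\<close>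
  obtain n0 where n0: "1 / (32 * x) < 4 ^ n0" using real_arch_pow[of 4 "1 / (32 * x)"] by auto
  define n where "n = max n0 J"
  have "(4::real) ^ n0 \<le> 4 ^ n" by (intro power_increasing) (auto simp: n_def)
  then have n: "1 / (32 * x) < 4 ^ n" "J \<le> n" using n0 by (linarith, simp add: n_def)
  have fin: "(\<Sum>j. wave 0 u cutoff j (s, x)) = (\<Sum>j=J..<n. wave 0 u cutoff j (s, x))" for s
  proof (rule suminf_finite)
    fix j assume "j \<notin> {J..<n}"
    then have "j < J \<or> j \<ge> n" by auto
    then show "wave 0 u cutoff j (s, x) = 0"
    proof
      assume "j \<ge> n"
      then have "(4::real) ^ n \<le> 4 ^ j" by (intro power_increasing) auto
      with n have "1 / (32 * x) < 4 ^ j" by linarith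
      then have "x > 1 / (32 * 4 ^ j)" using x(1) by (simp add: field_simps)
      then have "cutoff j x = 0" by (intro cutoff_eq_0) auto
      then show ?thesis by (simp add: wave_def)
    qed (simp add: wave_def u_def)
  qed simp
  let ?c = "\<lambda>j. exp (2 ^ j / 2) / energy j * cutoff j x * laplace 0 x"
  have integrand: "exp (- s / x) * (1 - (\<Sum>j. wave 0 u cutoff j (s, x))) * signal s =
      s ^ 0 * exp (- s / x) * signal s - (\<Sum>j=J..<n. ?c j * (packet j s * signal s))" for s
  proof -
    have "exp (- s / x) * wave 0 u cutoff j (s, x) = ?c j * packet j s" if "j \<in> {J..<n}" for j
    proof -
      have e: "exp (- s / x) * exp (s / x) = 1" by (simp flip: exp_add)
      have "exp (- s / x) * wave 0 u cutoff j (s, x) = (exp (- s / x) * exp (s / x)) * (exp (2 ^ j / 2) * (u j s * cutoff j x) * laplace 0 x)"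
        unfolding wave_def fst_conv snd_conv by (simp only: mult_ac)
      then show ?thesis unfolding e using that by (simp add: u_def)
    qed
    then have "exp (- s / x) * (\<Sum>j=J..<n. wave 0 u cutoff j (s, x)) = (\<Sum>j=J..<n. ?c j * packet j s)"
      unfolding sum_distrib_left by (intro sum.cong) auto
    then have "exp (- s / x) * (1 - (\<Sum>j=J..<n. wave 0 u cutoff j (s, x))) * signal s =
        (exp (- s / x) - (\<Sum>j=J..<n. ?c j * packet j s)) * signal s"
      by (simp only: right_diff_distrib mult_1_right)
    also have "\<dots> = s ^ 0 * exp (- s / x) * signal s - (\<Sum>j=J..<n. ?c j * (packet j s * signal s))"
      by (simp add: left_diff_distrib sum_distrib_right mult.assoc)
    finally show ?thesis unfolding fin .
  qed
  have i0: "(\<lambda>s. s ^ 0 * exp (- s / x) * signal s) integrable_on {0..1}"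
    using x(1) by (intro integrable_continuous_real continuous_intros continuous_on_signal) auto
  have ij: "(\<lambda>s. ?c j * (packet j s * signal s)) integrable_on {0..1}" for j
    by (intro integrable_continuous_real continuous_intros continuous_on_signal continuous_on_packet)
  have "(LINT s|lebesgue_on {0..1}. exp (- s / x) * (1 - (\<Sum>j. wave 0 u cutoff j (s, x))) * signal s) =
      integral {0..1} (\<lambda>s. exp (- s / x) * (1 - (\<Sum>j. wave 0 u cutoff j (s, x))) * signal s)"
  proof (rule lebesgue_integral_eq_integral)
    show "integrable (lebesgue_on {0..1}) (\<lambda>s. exp (- s / x) * (1 - (\<Sum>j. wave 0 u cutoff j (s, x))) * signal s)"
      unfolding integrand using x(1)
      by (intro continuous_imp_integrable_real continuous_intros continuous_on_signal continuous_on_packet) auto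
  qed simp
  also have "\<dots> = integral {0..1} (\<lambda>s. s ^ 0 * exp (- s / x) * signal s) - (\<Sum>j=J..<n. integral {0..1} (\<lambda>s. ?c j * (packet j s * signal s)))"
  proof -
    have eq: "integral {0..1} (\<lambda>s. \<Sum>j=J..<n. ?c j * (packet j s * signal s)) =
        (\<Sum>j=J..<n. integral {0..1} (\<lambda>s. ?c j * (packet j s * signal s)))"
      by (intro integral_sum ij) simp
    have i: "(\<lambda>s. \<Sum>j=J..<n. ?c j * (packet j s * signal s)) integrable_on {0..1}"
      by (intro integrable_sum ij) simp
    show ?thesis unfolding integrand eq[symmetric]
      by (rule Henstock_Kurzweil_Integration.integral_diff[OF i0 i])
  qed
  also have "integral {0..1} (\<lambda>s. s ^ 0 * exp (- s / x) * signal s) = laplace 0 x"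
    by (simp only: laplace_def)
  also have "(\<Sum>j=J..<n. integral {0..1} (\<lambda>s. ?c j * (packet j s * signal s))) = (\<Sum>j=J..<n. cutoff j x * laplace 0 x)"
  proof (intro sum.cong refl)
    fix j
    have "integral {0..1} (\<lambda>s. ?c j * (packet j s * signal s)) = ?c j * (exp (- (2 ^ j / 2)) * energy j)"
      by (simp only: integral_mult_right packet_signal_integral)
    also have "\<dots> = (exp (2 ^ j / 2) * exp (- (2 ^ j / 2))) * (energy j / energy j) * (cutoff j x * laplace 0 x)"
      by (simp only: divide_inverse mult_ac)
    also have "\<dots> = cutoff j x * laplace 0 x" using energy_pos[of j] by (simp flip: exp_add)
    finally show "integral {0..1} (\<lambda>s. ?c j * (packet j s * signal s)) = cutoff j x * laplace 0 x" .
  qed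
  also have "\<dots> = laplace 0 x"
  proof -
    have "64 * 4 ^ J * x \<le> 1" using x by (simp add: field_simps)
    moreover have "64 * 4 ^ n * x > 2" using n x by (simp add: field_simps)
    ultimately have "(\<Sum>j=J..<n. cutoff j x) = 1"
      using n(2) by (simp add: sum_cutoff step_eq_0 step_eq_1)
    then show ?thesis by (simp flip: sum_distrib_right)
  qed
  finally show ?thesis by simp
qed

text \<open>The correction is a convergent series with sum below \<open>1\<close> once its first \<open>J\<close> terms are dropped; dropping
  them affects the integral only for \<open>x\<close> that are not small.\<close>

theorem smooth_weight_counterexample:
  "\<exists>(Q :: real \<times> real \<Rightarrow> real) (b :: real \<Rightarrow> real).
      smooth_on ({0..1} \<times> {0..1}) Q \<and>
      (\<forall>s\<in>{0..1}. \<forall>x\<in>{0..1}. Q (s, x) > 0) \<and>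
      (\<forall>s\<in>{1/3..1}. \<forall>x\<in>{0..1}. Q (s, x) = 1) \<and>
      smooth_cpt_on {0..<1/3} b \<and>
      (\<exists>s\<in>{0..<1/3}. b s \<noteq> 0) \<and>
      (\<forall>\<^sub>F x in at_right 0.
         (LINT s|lebesgue_on {0..1}. exp (- s / x) * Q (s, x) * b s) = 0)"
proof -
  let ?S = "\<lambda>j. {left_end j..3 / (16 * 2 ^ j)}"
  have tu: "tame n ?S (\<lambda>j s. g j * (1 / energy j * packet j s))" if "poly_bounded g" for n g
    by (intro tame_scale that poly_bounded_inverse_energy tame_packet)
  obtain g where g: "poly_bounded g"
    "\<And>j p. \<bar>wave 0 (\<lambda>j s. 1 / energy j * packet j s) cutoff j p\<bar> \<le> g j * exp (- (2 ^ j / 2))"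
    using wave_bound[OF tame_imp_controlled[OF tame_scale[OF poly_bounded_inverse_energy tame_packet[of 0]]]
        tame_imp_controlled[OF tame_cutoff[of 0]]] by blast
  define M where "M = (\<lambda>j. g j * exp (- (2 ^ j / 2)))"
  have M: "summable M" unfolding M_def by (rule summable_poly_exp[OF g(1)])
  have M0: "M j \<ge> 0" for j using g(2)[of j "(0, 0)"] unfolding M_def by linarith
  have "\<forall>\<^sub>F n in sequentially. \<bar>(\<Sum>j. M (j + n))\<bar> < 1"
    using suminf_exist_split2[OF M] by (auto simp: tendsto_iff dist_real_def)
  then obtain J where J: "(\<Sum>j. M (j + J)) < 1"
    using eventually_happens'[OF sequentially_bot] abs_less_iff by blast
  define u where "u = (\<lambda>j s. (if j < J then 0 else 1 / energy j) * packet j s)"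
  define Q where "Q = (\<lambda>p. 1 - (\<Sum>j. wave 0 u cutoff j p))"
  have u_alt: "u = (\<lambda>j s. (if j < J then 0 else 1) * (1 / energy j * packet j s))"
    by (auto simp: u_def)
  have "poly_bounded (\<lambda>j. if j < J then 0 else 1)"
    by (rule poly_bounded_mono[OF poly_bounded_const[of 1]]) simp
  then have tame_u: "tame n ?S u" for n unfolding u_alt by (rule tu)
  have CkQ: "Ck_on n UNIV Q" for n
    unfolding Q_def by (intro Ck_on_diff Ck_on_const Ck_sum_suminf convex_UNIV wave_Ck_sum tame_u tame_cutoff)
  have wb: "\<bar>wave 0 u cutoff j p\<bar> \<le> (if j < J then 0 else M j)" for j p
    using g(2)[of j p] unfolding M_def u_def wave_def by auto
  have Qpos: "Q p > 0" for p
  proof -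
    have s: "summable (\<lambda>j. wave 0 u cutoff j p)"
      by (rule summable_comparison_test'[OF M, of 0]) (use wb[of _ p] M0 in \<open>smt (verit) real_norm_def\<close>)
    have "(\<Sum>j. wave 0 u cutoff j p) = (\<Sum>j. wave 0 u cutoff (j + J) p)"
      using suminf_split_initial_segment[OF s, of J] wb[of _ p] by (simp add: wave_def u_def)
    also have "\<dots> \<le> (\<Sum>j. M (j + J))"
    proof (rule suminf_le)
      show "wave 0 u cutoff (j + J) p \<le> M (j + J)" for j
        using wb[of "j + J" p] by simp
    qed (intro summable_ignore_initial_segment s M)+
    finally show ?thesis using J by (simp add: Q_def)
  qed
  have Q1: "Q (s, x) = 1" if "s \<ge> 1/3" for s x
  proof -
    have "s \<notin> ?S j" for j
    proof -
      have "3 / (16 * 2 ^ j) \<le> (3 / 16 :: real)" by (simp add: field_simps)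
      then show ?thesis using that by auto
    qed
    then have "packet j s = 0" for j by (rule packet_eq_0)
    then show ?thesis by (simp add: Q_def wave_def u_def)
  qed
  have "\<forall>\<^sub>F x in at_right 0. (LINT s|lebesgue_on {0..1}. exp (- s / x) * Q (s, x) * signal s) = 0"
    unfolding eventually_at_right_field
  proof (intro exI[of _ "1 / (64 * 4 ^ J)"] conjI allI impI)
    fix x :: real assume "x > 0" "x < 1 / (64 * 4 ^ J)"
    then show "(LINT s|lebesgue_on {0..1}. exp (- s / x) * Q (s, x) * signal s) = 0"
      unfolding Q_def u_def by (intro corrected_integral_zero) auto
  qed simp
  then show ?thesis
    using Qpos Q1 smooth_cpt_signal signal_nonzero
    by (intro exI[of _ Q] exI[of _ signal]) (auto simp: smooth_on_def intro: Ck_on_subset[OF CkQ])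
qed

section \<open>Functions with exponentially decaying moments\<close>

text \<open>The positive and the negative part of \<open>g\<close> are densities of finite measures that agree on all half-lines,
  hence on all Borel sets.\<close>

lemma AE_eq_0_of_half_line_integrals:
  fixes g :: "real \<Rightarrow> real"
  assumes g: "integrable lborel g" and z: "\<And>x. (LINT t|lborel. indicator {x<..} t * g t) = 0"
  shows "AE x in lborel. g x = 0"
proof -
  have [measurable]: "g \<in> borel_measurable borel" using g by (auto dest: borel_measurable_integrable)
  define P where "P = (\<lambda>x. max 0 (g x))"
  define N where "N = (\<lambda>x. max 0 (- g x))"
  have [measurable]: "P \<in> borel_measurable borel" "N \<in> borel_measurable borel"
    unfolding P_def N_def by measurable
  have iP: "integrable lborel P" and iN: "integrable lborel N"
    unfolding P_def N_def using g by (auto intro: integrable_max)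
  have iP': "integrable lborel (\<lambda>t. indicator {x<..} t * P t)" and iN': "integrable lborel (\<lambda>t. indicator {x<..} t * N t)" for x
    using integrable_mult_indicator[OF _ iP, of "{x<..}"] integrable_mult_indicator[OF _ iN, of "{x<..}"] by simp_all
  have em: "emeasure (density lborel (\<lambda>t. ennreal (f t))) {x<..} = ennreal (LINT t|lborel. indicator {x<..} t * f t)"
    if [measurable]: "f \<in> borel_measurable borel" and "\<And>t. f t \<ge> 0" "integrable lborel (\<lambda>t. indicator {x<..} t * f t)" for f :: "real \<Rightarrow> real" and x
  proof -
    have "emeasure (density lborel (\<lambda>t. ennreal (f t))) {x<..} = (\<integral>\<^sup>+t. ennreal (f t) * indicator {x<..} t \<partial>lborel)"
      by (rule emeasure_density) auto
    also have "\<dots> = (\<integral>\<^sup>+t. ennreal (indicator {x<..} t * f t) \<partial>lborel)"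
      by (intro nn_integral_cong) (auto simp: indicator_def)
    also have "\<dots> = ennreal (LINT t|lborel. indicator {x<..} t * f t)"
      using that by (intro nn_integral_eq_integral) auto
    finally show ?thesis .
  qed
  have "density lborel (\<lambda>t. ennreal (P t)) = density lborel (\<lambda>t. ennreal (N t))"
  proof (rule measure_eqI_lessThan)
    fix x
    show "emeasure (density lborel (\<lambda>t. ennreal (P t))) {x<..} < \<infinity>"
      by (subst em) (auto simp: P_def intro: iP'[unfolded P_def])
    have "(LINT t|lborel. indicator {x<..} t * P t) - (LINT t|lborel. indicator {x<..} t * N t) =
        (LINT t|lborel. indicator {x<..} t * P t - indicator {x<..} t * N t)"
      by (rule Bochner_Integration.integral_diff[symmetric, OF iP' iN'])
    also have "\<dots> = (LINT t|lborel. indicator {x<..} t * g t)"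
      by (rule Bochner_Integration.integral_cong) (auto simp: P_def N_def indicator_def max_def)
    finally have "(LINT t|lborel. indicator {x<..} t * P t) = (LINT t|lborel. indicator {x<..} t * N t)"
      using z by simp
    then show "emeasure (density lborel (\<lambda>t. ennreal (P t))) {x<..} = emeasure (density lborel (\<lambda>t. ennreal (N t))) {x<..}"
      using iP' iN' by (subst (1 2) em) (auto simp: P_def N_def)
  qed auto
  then have "AE x in lborel. ennreal (P x) = ennreal (N x)"
    by (subst (asm) sigma_finite_measure.density_unique_iff[OF sigma_finite_lborel]) auto
  then show ?thesis
    by eventually_elim (auto simp: P_def N_def max_def split: if_splits)
qed

lemma AE_eq_0_of_initial_integrals:
  fixes f :: "real \<Rightarrow> real"
  assumes f: "integrable lborel f" and z: "\<And>c. c < d \<Longrightarrow> (LINT t|lborel. indicator {..c} t * f t) = 0"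
  shows "AE x in lborel. x < d \<longrightarrow> f x = 0"
proof -
  have int: "integrable lborel (\<lambda>t. indicator {..c} t * f t)" for c
    using integrable_mult_indicator[OF _ f, of "{..c}"] by simp
  have *: "AE x in lborel. indicator {..c} x * f x = 0" if "c < d" for c
  proof (rule AE_eq_0_of_half_line_integrals[OF int])
    fix x
    have "(LINT t|lborel. indicator {x<..} t * (indicator {..c} t * f t)) =
        (LINT t|lborel. indicator {..c} t * f t - indicator {..min x c} t * f t)"
      by (rule Bochner_Integration.integral_cong) (auto simp: indicator_def)
    also have "\<dots> = (LINT t|lborel. indicator {..c} t * f t) - (LINT t|lborel. indicator {..min x c} t * f t)"
      by (rule Bochner_Integration.integral_diff[OF int int])
    also have "\<dots> = 0" using z that by simp
    finally show "(LINT t|lborel. indicator {x<..} t * (indicator {..c} t * f t)) = 0" .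
  qed
  have "AE x in lborel. \<forall>n::nat. indicator {..d - 1 / real (Suc n)} x * f x = 0"
    unfolding AE_all_countable by (intro allI *) simp
  then show ?thesis
  proof eventually_elim
    case (elim x)
    show ?case
    proof
      assume "x < d"
      then obtain n where "1 / real (Suc n) < d - x" using nat_approx_posE[of "d - x"] by auto
      then have "x \<in> {..d - 1 / real (Suc n)}" by auto
      with elim show "f x = 0" by (metis indicator_simps(1) mult_1)
    qed
  qed
qed

text \<open>Mikusinski's argument.  For fixed \<open>N\<close> the function \<open>1 - exp (- exp (N * (c - w)))\<close> is a power series in
  \<open>exp (- N * w)\<close>, so its integral against \<open>f\<close> is a combination of the given moments, with coefficients
  \<open>\<plusminus> exp (k * N * c) / k!\<close>.  The decay of the moments makes this combination tend to \<open>0\<close> as \<open>N\<close> grows,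
  because \<open>c < 1\<close>; at the same time the function tends to the indicator of \<open>w < c\<close>.\<close>

lemma exp_decay_moments_imp_zero:
  fixes f :: "real \<Rightarrow> real"
  assumes f: "integrable lborel f" and f0: "\<And>w. w < 0 \<Longrightarrow> f w = 0"
    and decay: "\<And>n::nat. n \<ge> 1 \<Longrightarrow> \<bar>LINT w|lborel. exp (- (real n * w)) * f w\<bar> \<le> C * exp (- real n)"
    and c: "c < 1"
  shows "(LINT w|lborel. indicator {..c} w * f w) = 0"
proof -
  have [measurable]: "f \<in> borel_measurable borel" using f by (auto dest: borel_measurable_integrable)
  define G where "G = (\<lambda>N w. (1 - exp (- exp (real N * (c - w)))) * f w)"
  have exp01: "\<bar>1 - exp (- exp (real N * (c - w)))\<bar> \<le> 1" for N w by simp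
  have lim: "(\<lambda>N. LINT w|lborel. G N w) \<longlonglongrightarrow> (LINT w|lborel. indicator {..c} w * f w)"
  proof (rule integral_dominated_convergence[where w = "\<lambda>w. \<bar>f w\<bar>"])
    show "AE w in lborel. (\<lambda>N. G N w) \<longlonglongrightarrow> indicator {..c} w * f w"
      using AE_lborel_singleton[of c]
    proof eventually_elim
      case (elim w)
      have "(\<lambda>N. 1 - exp (- exp (real N * (c - w)))) \<longlonglongrightarrow> indicator {..c} w"
      proof (cases "w < c")
        case True
        have "filterlim (\<lambda>N. (c - w) * real N) at_top sequentially"
          using True by (intro filterlim_tendsto_pos_mult_at_top[OF tendsto_const] filterlim_real_sequentially) auto
        then have "filterlim (\<lambda>N. exp (real N * (c - w))) at_top sequentially"
          by (intro filterlim_compose[OF exp_at_top]) (simp add: mult.commute)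
        then have "(\<lambda>N. exp (- exp (real N * (c - w)))) \<longlonglongrightarrow> 0"
          by (intro filterlim_compose[OF exp_at_bot] filterlim_compose[OF filterlim_uminus_at_bot_at_top])
        from tendsto_diff[OF tendsto_const[of 1] this] show ?thesis using True by simp
      next
        case False
        have "filterlim (\<lambda>N. (w - c) * real N) at_top sequentially"
          using False elim by (intro filterlim_tendsto_pos_mult_at_top[OF tendsto_const] filterlim_real_sequentially) auto
        then have "filterlim (\<lambda>N. - ((w - c) * real N)) at_bot sequentially"
          by (intro filterlim_compose[OF filterlim_uminus_at_bot_at_top])
        then have "(\<lambda>N. exp (- ((w - c) * real N))) \<longlonglongrightarrow> 0"
          by (rule filterlim_compose[OF exp_at_bot])
        moreover have "- ((w - c) * real N) = real N * (c - w)" for N by (simp add: algebra_simps)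
        ultimately have "(\<lambda>N. exp (real N * (c - w))) \<longlonglongrightarrow> 0" by simp
        then have "(\<lambda>N. 1 - exp (- exp (real N * (c - w)))) \<longlonglongrightarrow> 1 - exp (- 0)"
          by (intro tendsto_intros)
        then show ?thesis using False elim by simp
      qed
      then show ?case unfolding G_def by (intro tendsto_mult_right)
    qed
    show "AE w in lborel. norm (G N w) \<le> \<bar>f w\<bar>" for N
      using exp01 by (auto simp: G_def abs_mult intro!: mult_left_le_one_le)
  qed (use f in \<open>auto simp: G_def\<close>)
  have bound: "\<bar>LINT w|lborel. G N w\<bar> \<le> C * (exp (exp (- (real N * (1 - c)))) - 1)" if N: "N \<ge> 1" for N
  proof -
    let ?y = "\<lambda>w. exp (real N * (c - w))"
    let ?t = "\<lambda>k w. - ((- ?y w) ^ Suc k / fact (Suc k)) * f w"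
    have ex: "(\<lambda>k. z ^ Suc k / fact (Suc k)) sums (exp z - 1)" for z :: real
    proof -
      have "(\<lambda>k. z ^ k / fact k) sums exp z"
        using exp_converges[of z] by (simp add: divide_inverse mult.commute)
      then show ?thesis by (subst sums_Suc_iff) simp
    qed
    have eq: "?t k w = - ((- 1) ^ Suc k * exp (real (Suc k * N) * c) / fact (Suc k)) * (exp (- (real (Suc k * N) * w)) * f w)" for k w
    proof -
      have "?y w ^ Suc k = exp (real (Suc k) * (real N * (c - w)))" by (rule exp_of_nat_mult[symmetric])
      also have "real (Suc k) * (real N * (c - w)) = real (Suc k * N) * c + - (real (Suc k * N) * w)"
        by (simp add: algebra_simps)
      finally have "?y w ^ Suc k = exp (real (Suc k * N) * c) * exp (- (real (Suc k * N) * w))"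
        by (simp only: exp_add)
      moreover have "(- ?y w) ^ Suc k = (- 1) ^ Suc k * ?y w ^ Suc k"
        by (simp only: power_mult_distrib[symmetric] mult_minus1)
      ultimately show ?thesis by (simp only: times_divide_eq_left times_divide_eq_right mult_minus_left mult.assoc)
    qed
    have inte: "integrable lborel (\<lambda>w. exp (- (real m * w)) * f w)" for m
    proof (rule Bochner_Integration.integrable_bound[OF f])
      show "AE w in lborel. norm (exp (- (real m * w)) * f w) \<le> norm (f w)"
      proof (rule AE_I2)
        fix w show "norm (exp (- (real m * w)) * f w) \<le> norm (f w)"
          using f0[of w] by (cases "w < 0") (auto simp: abs_mult intro!: mult_left_le_one_le)
      qed
    qed simp
    have intt: "integrable lborel (?t k)" for k
      unfolding eq by (intro integrable_mult_right inte)
    have ybound: "\<bar>?t k w\<bar> \<le> exp (real N * c) ^ Suc k / fact (Suc k) * \<bar>f w\<bar>" for k w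
    proof (cases "w < 0")
      case False
      then have "?y w \<le> exp (real N * c)" by (simp add: mult_left_mono)
      then have "?y w ^ Suc k \<le> exp (real N * c) ^ Suc k" by (intro power_mono) auto
      then have "?y w ^ Suc k / fact (Suc k) * \<bar>f w\<bar> \<le> exp (real N * c) ^ Suc k / fact (Suc k) * \<bar>f w\<bar>"
        by (intro mult_right_mono divide_right_mono) auto
      then show ?thesis by (simp only: abs_mult abs_minus_cancel abs_divide power_abs abs_exp_cancel abs_of_nonneg[OF fact_ge_zero])
    qed (simp add: f0)
    have sY: "summable (\<lambda>k. exp (real N * c) ^ Suc k / fact (Suc k))"
      using ex by (rule sums_summable)
    have si: "(\<lambda>k. LINT w|lborel. ?t k w) sums (LINT w|lborel. (\<Sum>k. ?t k w))"
    proof (rule sums_integral[OF intt])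
      show "AE w in lborel. summable (\<lambda>k. norm (?t k w))"
        by (intro AE_I2 summable_comparison_test'[OF summable_mult2[OF sY], of 0])
           (use ybound in simp)
      show "summable (\<lambda>k. LINT w|lborel. norm (?t k w))"
      proof (rule summable_comparison_test'[OF summable_mult2[OF sY, of "LINT w|lborel. \<bar>f w\<bar>"], of 0])
        fix k
        have "(LINT w|lborel. norm (?t k w)) \<le> (LINT w|lborel. exp (real N * c) ^ Suc k / fact (Suc k) * \<bar>f w\<bar>)"
          using ybound f intt by (intro integral_mono integrable_norm integrable_mult_right) (auto simp del: power_Suc fact_Suc)
        also have "\<dots> = exp (real N * c) ^ Suc k / fact (Suc k) * (LINT w|lborel. \<bar>f w\<bar>)"
          by (rule integral_mult_right_zero)
        finally show "norm (LINT w|lborel. norm (?t k w)) \<le> exp (real N * c) ^ Suc k / fact (Suc k) * (LINT w|lborel. \<bar>f w\<bar>)"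
          by simp
      qed
    qed
    have "(\<Sum>k. ?t k w) = G N w" for w
    proof -
      have "?t k w = (- ?y w) ^ Suc k / fact (Suc k) * (- f w)" for k by simp
      moreover have "(\<lambda>k. (- ?y w) ^ Suc k / fact (Suc k) * (- f w)) sums ((exp (- ?y w) - 1) * (- f w))"
        by (rule sums_mult2[OF ex])
      ultimately have "(\<Sum>k. ?t k w) = (exp (- ?y w) - 1) * (- f w)" by (simp only: sums_unique[symmetric])
      then show ?thesis by (simp add: G_def algebra_simps)
    qed
    then have "(LINT w|lborel. G N w) = (\<Sum>k. LINT w|lborel. ?t k w)"
      using sums_unique[OF si] by simp
    also have "\<bar>\<dots>\<bar> \<le> (\<Sum>k. C * (exp (- (real N * (1 - c))) ^ Suc k / fact (Suc k)))"
      unfolding real_norm_def[symmetric]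
    proof (rule norm_suminf_le)
      fix k
      have "(LINT w|lborel. ?t k w) = - ((- 1) ^ Suc k * exp (real (Suc k * N) * c) / fact (Suc k)) *
          (LINT w|lborel. exp (- (real (Suc k * N) * w)) * f w)"
        unfolding eq by (rule integral_mult_right_zero)
      then have "norm (LINT w|lborel. ?t k w) = exp (real (Suc k * N) * c) / fact (Suc k) *
          \<bar>LINT w|lborel. exp (- (real (Suc k * N) * w)) * f w\<bar>"
        by (simp only: real_norm_def abs_mult abs_minus_cancel abs_divide power_abs abs_exp_cancel abs_of_nonneg[OF fact_ge_zero] abs_one power_one mult_1)
      also have "\<dots> \<le> exp (real (Suc k * N) * c) / fact (Suc k) * (C * exp (- real (Suc k * N)))"
        using N by (intro mult_left_mono decay) auto
      also have "\<dots> = C * ((exp (real (Suc k * N) * c) * exp (- real (Suc k * N))) / fact (Suc k))"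
        by (simp only: times_divide_eq_left times_divide_eq_right mult_ac)
      also have "exp (real (Suc k * N) * c) * exp (- real (Suc k * N)) = exp (real (Suc k) * - (real N * (1 - c)))"
        unfolding exp_add[symmetric] by (simp add: algebra_simps)
      also have "\<dots> = exp (- (real N * (1 - c))) ^ Suc k" by (rule exp_of_nat_mult)
      finally show "norm (LINT w|lborel. ?t k w) \<le> C * (exp (- (real N * (1 - c))) ^ Suc k / fact (Suc k))" .
    qed (intro summable_mult sums_summable[OF ex])
    also have "\<dots> = C * (exp (exp (- (real N * (1 - c)))) - 1)"
      by (rule sums_unique[symmetric], rule sums_mult, rule ex)
    finally show ?thesis .
  qed
  have "(\<lambda>N. C * (exp (exp (- (real N * (1 - c)))) - 1)) \<longlonglongrightarrow> C * (exp 0 - 1)"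
  proof (intro tendsto_intros)
    have "filterlim (\<lambda>N. (1 - c) * real N) at_top sequentially"
      using c by (intro filterlim_tendsto_pos_mult_at_top[OF tendsto_const] filterlim_real_sequentially) auto
    then have "filterlim (\<lambda>N. - ((1 - c) * real N)) at_bot sequentially"
      by (intro filterlim_compose[OF filterlim_uminus_at_bot_at_top])
    then have "(\<lambda>N. exp (- ((1 - c) * real N))) \<longlonglongrightarrow> 0"
      by (rule filterlim_compose[OF exp_at_bot])
    then show "(\<lambda>N. exp (- (real N * (1 - c)))) \<longlonglongrightarrow> 0" by (simp add: mult.commute)
  qed
  then have B: "(\<lambda>N. C * (exp (exp (- (real N * (1 - c)))) - 1)) \<longlonglongrightarrow> 0" by simp
  have "(\<lambda>N. LINT w|lborel. G N w) \<longlonglongrightarrow> 0"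
  proof (rule Lim_null_comparison[OF _ B])
    show "\<forall>\<^sub>F N in sequentially. norm (LINT w|lborel. G N w) \<le> C * (exp (exp (- (real N * (1 - c)))) - 1)"
      using bound by (auto simp: eventually_sequentially)
  qed
  with lim show ?thesis using LIMSEQ_unique by blast
qed

text \<open>\<open>exp (- K * x)\<close> times the integral of \<open>A\<close> is nonincreasing and starts at \<open>0\<close>.\<close>

lemma gronwall_zero:
  fixes A :: "real \<Rightarrow> real"
  assumes c: "continuous_on {0..1} A" and nn: "\<And>w. w \<in> {0..1} \<Longrightarrow> A w \<ge> 0"
    and le: "\<And>w. w \<in> {0..1} \<Longrightarrow> A w \<le> K * integral {0..w} A" and w: "w \<in> {0..1}"
  shows "A w = 0"
proof -
  define B where "B = (\<lambda>x. integral {0..x} A)"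
  have dB: "(B has_real_derivative A x) (at x within {0..1})" if "x \<in> {0..1}" for x
    unfolding B_def by (rule integral_has_real_derivative[OF c that])
  have cB: "continuous_on {0..1} B" using dB by (rule DERIV_continuous_on)
  have "exp (- K * w) * B w \<le> exp (- K * 0) * B 0"
  proof (rule DERIV_nonpos_imp_decreasing_open[where f = "\<lambda>x. exp (- K * x) * B x"])
    fix x assume x: "0 < x" "x < w"
    then have "x \<in> interior {0..1}" using w by auto
    then have "(B has_real_derivative A x) (at x)"
      using dB[of x] x w at_within_interior[of x "{0..1}"] by auto
    then have "((\<lambda>x. exp (- K * x) * B x) has_real_derivative exp (- K * x) * (A x - K * B x)) (at x)"
      by (auto intro!: derivative_eq_intros simp: algebra_simps)
    moreover have "exp (- K * x) * (A x - K * B x) \<le> 0"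
      using le[of x] x w unfolding B_def by (intro mult_nonneg_nonpos) auto
    ultimately show "\<exists>y. ((\<lambda>x. exp (- K * x) * B x) has_real_derivative y) (at x) \<and> y \<le> 0" by blast
  qed (use w in \<open>auto intro!: continuous_intros continuous_on_subset[OF cB]\<close>)
  then have "B w \<le> 0" by (simp add: B_def mult_le_0_iff)
  moreover have "B w \<ge> 0" unfolding B_def
    using w by (intro integral_nonneg integrable_continuous_real continuous_on_subset[OF c]) (auto intro: nn)
  ultimately show ?thesis using le[OF w] nn[OF w] by (simp add: B_def)
qed

section \<open>Volterra equations of the first kind\<close>

lemma borel_measurable_pair_lborel:
  fixes k :: "real \<times> real \<Rightarrow> real"
  assumes "k \<in> borel_measurable borel" shows "k \<in> borel_measurable (lborel \<Otimes>\<^sub>M lborel)"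
  using assms by (simp add: lborel_prod)

text \<open>Domination by the tensor product of \<open>\<alpha>\<close> and the indicator of a bounded interval.\<close>

lemma kernel_integrable:
  fixes \<alpha> :: "real \<Rightarrow> real" and k :: "real \<times> real \<Rightarrow> real"
  assumes \<alpha>: "integrable lborel \<alpha>" and k: "k \<in> borel_measurable borel"
    and bd: "\<And>t \<sigma>. \<bar>\<alpha> t * k (t, \<sigma>)\<bar> \<le> \<bar>\<alpha> t\<bar> * (B * indicator {a..b} \<sigma>)"
  shows "integrable (lborel \<Otimes>\<^sub>M lborel) (\<lambda>(t, \<sigma>). \<alpha> t * k (t, \<sigma>))"
proof -
  have m\<alpha>[measurable]: "\<alpha> \<in> borel_measurable borel" using \<alpha> by (auto dest: borel_measurable_integrable)
  have mk[measurable]: "k \<in> borel_measurable (lborel \<Otimes>\<^sub>M lborel)"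
    by (rule borel_measurable_pair_lborel[OF k])
  have base: "integrable (lborel \<Otimes>\<^sub>M lborel) (\<lambda>p. \<alpha> (fst p) * (B * indicator {a..b} (snd p)))"
  proof (rule lborel_pair.Fubini_integrable)
    show "(\<lambda>p. \<alpha> (fst p) * (B * indicator {a..b} (snd p))) \<in> borel_measurable (lborel \<Otimes>\<^sub>M lborel)"
      by measurable
    have i: "integrable lborel (\<lambda>\<sigma>. indicator {a..b} \<sigma> :: real)"
      by (rule integrable_real_indicator) (auto simp: emeasure_lborel_Icc_eq)
    have "(\<lambda>t. LINT \<sigma>|lborel. norm (\<alpha> (fst (t, \<sigma>)) * (B * indicator {a..b} (snd (t, \<sigma>))))) =
        (\<lambda>t. \<bar>\<alpha> t\<bar> * (\<bar>B\<bar> * (LINT \<sigma>|lborel. indicator {a..b} \<sigma>)))"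
      by (simp add: abs_mult)
    moreover have "integrable lborel (\<lambda>t. \<bar>\<alpha> t\<bar> * (\<bar>B\<bar> * (LINT \<sigma>|lborel. indicator {a..b} \<sigma>)))"
      using \<alpha> by (intro integrable_mult_left) auto
    ultimately show "integrable lborel (\<lambda>t. LINT \<sigma>|lborel. norm (\<alpha> (fst (t, \<sigma>)) * (B * indicator {a..b} (snd (t, \<sigma>)))))"
      by simp
    show "AE t in lborel. integrable lborel (\<lambda>\<sigma>. \<alpha> (fst (t, \<sigma>)) * (B * indicator {a..b} (snd (t, \<sigma>))))"
      using i by (intro AE_I2) (simp only: fst_conv snd_conv integrable_mult_right)
  qed
  show ?thesis
  proof (rule Bochner_Integration.integrable_bound[OF base])
    show "(\<lambda>(t, \<sigma>). \<alpha> t * k (t, \<sigma>)) \<in> borel_measurable (lborel \<Otimes>\<^sub>M lborel)"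
      unfolding case_prod_unfold by measurable
    show "AE p in lborel \<Otimes>\<^sub>M lborel. norm (case p of (t, \<sigma>) \<Rightarrow> \<alpha> t * k (t, \<sigma>)) \<le>
        norm (\<alpha> (fst p) * (B * indicator {a..b} (snd p)))"
    proof (rule AE_I2, clarsimp)
      fix t \<sigma>
      have "\<bar>\<alpha> t * k (t, \<sigma>)\<bar> \<le> \<bar>\<alpha> t\<bar> * (B * indicator {a..b} \<sigma>)" by (rule bd)
      also have "\<dots> \<le> \<bar>\<alpha> t\<bar> * \<bar>B * indicator {a..b} \<sigma>\<bar>" by (intro mult_left_mono) auto
      finally show "\<bar>\<alpha> t * k (t, \<sigma>)\<bar> \<le> \<bar>\<alpha> t * (B * indicator {a..b} \<sigma>)\<bar>" by (simp add: abs_mult)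
    qed
  qed
qed

lemma interval_LINT_eq_integral:
  fixes f :: "real \<Rightarrow> real"
  assumes "set_integrable lborel {a..b} f"
  shows "(LINT t|lborel. indicator {a..b} t * f t) = integral {a..b} f"
  using set_borel_integral_eq_integral(2)[OF assms] by (simp add: set_lebesgue_integral_def)

lemma initial_LINT_eq_integral:
  fixes f :: "real \<Rightarrow> real"
  assumes f: "set_integrable lborel {0..c} f" and f0: "\<And>t. t < 0 \<Longrightarrow> f t = 0"
  shows "(LINT t|lborel. indicator {..c} t * f t) = integral {0..c} f"
proof -
  have "(LINT t|lborel. indicator {..c} t * f t) = (LINT t|lborel. indicator {0..c} t * f t)"
    by (rule Bochner_Integration.integral_cong) (auto simp: indicator_def f0)
  then show ?thesis using interval_LINT_eq_integral[OF f] by simp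
qed

text \<open>A Volterra equation of the first kind whose kernel does not vanish on the diagonal.  Writing the kernel as
  its diagonal value plus the integral of its derivative and exchanging integrals shows that
  the convolution \<open>F\<close> is the indefinite integral of some \<open>h\<close>.  As \<open>F\<close> vanishes, so does \<open>h\<close>, and this is a
  Volterra equation of the second kind for \<open>\<alpha>\<close>, to which Gronwall's inequality applies.\<close>

lemma volterra_unique:
  fixes \<alpha> :: "real \<Rightarrow> real" and \<beta> \<beta>' :: "real \<times> real \<Rightarrow> real"
  assumes \<alpha>: "integrable lborel \<alpha>" and \<alpha>0: "\<And>t. t \<notin> {0..1} \<Longrightarrow> \<alpha> t = 0"
    and c\<beta>: "continuous_on UNIV \<beta>" and c\<beta>': "continuous_on UNIV \<beta>'"
    and b\<beta>: "\<And>p. \<bar>\<beta> p\<bar> \<le> B" and b\<beta>': "\<And>p. \<bar>\<beta>' p\<bar> \<le> B"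
    and m: "m > 0" "\<And>t. t \<in> {0..1} \<Longrightarrow> \<beta> (t, 0) \<ge> m"
    and ftc: "\<And>t u. t \<in> {0..1} \<Longrightarrow> u \<in> {0..1} \<Longrightarrow> \<beta> (t, u) = \<beta> (t, 0) + integral {0..u} (\<lambda>\<sigma>. \<beta>' (t, \<sigma>))"
    and zero: "\<And>c. c < 1 \<Longrightarrow>
      (LINT w|lborel. indicator {..c} w * (LINT t|lborel. \<alpha> t * (\<beta> (t, w - t) * indicator {0..1} (w - t)))) = 0"
  shows "AE t in lborel. \<alpha> t = 0"
proof -
  have m\<alpha>[measurable]: "\<alpha> \<in> borel_measurable borel" using \<alpha> by (auto dest: borel_measurable_integrable)
  have B0: "B \<ge> 0" using b\<beta>[of 0] by linarith
  define F where "F = (\<lambda>w. LINT t|lborel. \<alpha> t * (\<beta> (t, w - t) * indicator {0..1} (w - t)))"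
  define k where "k = (\<lambda>p::real \<times> real. \<beta>' (fst p, snd p - fst p) * indicator {0..} (snd p - fst p) * indicator {0..1} (snd p))"
  define H where "H = (\<lambda>\<sigma>. LINT t|lborel. \<alpha> t * k (t, \<sigma>))"
  define h where "h = (\<lambda>\<sigma>. \<alpha> \<sigma> * \<beta> (\<sigma>, 0) + H \<sigma>)"
  have mk: "k \<in> borel_measurable borel"
  proof -
    have [measurable]: "(\<lambda>p::real \<times> real. \<beta>' (fst p, snd p - fst p)) \<in> borel_measurable borel"
      by (intro borel_measurable_continuous_onI continuous_on_compose2[OF c\<beta>'] continuous_intros) auto
    have [measurable]: "(\<lambda>p::real \<times> real. snd p - fst p) \<in> borel_measurable borel" "(\<lambda>p::real \<times> real. snd p) \<in> borel_measurable borel"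
      by (intro borel_measurable_continuous_onI continuous_intros)+
    show ?thesis unfolding k_def by measurable
  qed
  have bk: "\<bar>k (t, \<sigma>)\<bar> \<le> B * indicator {0..1} \<sigma>" for t \<sigma>
    using b\<beta>' B0 by (auto simp: k_def indicator_def)
  have ki: "integrable (lborel \<Otimes>\<^sub>M lborel) (\<lambda>(t, \<sigma>). \<alpha> t * k (t, \<sigma>))"
  proof (rule kernel_integrable[OF \<alpha> mk])
    show "\<bar>\<alpha> t * k (t, \<sigma>)\<bar> \<le> \<bar>\<alpha> t\<bar> * (B * indicator {0..1} \<sigma>)" for t \<sigma>
      unfolding abs_mult by (intro mult_left_mono bk) simp
  qed
  have iH: "integrable lborel H" unfolding H_def by (rule lborel_pair.integrable_snd[OF ki])
  have c\<beta>0: "continuous_on UNIV (\<lambda>\<sigma>. \<beta> (\<sigma>, 0))"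
    by (intro continuous_on_compose2[OF c\<beta>] continuous_intros) auto
  then have [measurable]: "(\<lambda>\<sigma>. \<beta> (\<sigma>, 0)) \<in> borel_measurable borel"
    by (rule borel_measurable_continuous_onI)
  have i1: "integrable lborel (\<lambda>\<sigma>. \<alpha> \<sigma> * \<beta> (\<sigma>, 0))"
  proof (rule Bochner_Integration.integrable_bound[OF integrable_mult_right[OF \<alpha>, of B]])
    show "AE \<sigma> in lborel. norm (\<alpha> \<sigma> * \<beta> (\<sigma>, 0)) \<le> norm (B * \<alpha> \<sigma>)"
    proof (rule AE_I2)
      fix \<sigma>
      have "\<bar>\<alpha> \<sigma>\<bar> * \<bar>\<beta> (\<sigma>, 0)\<bar> \<le> \<bar>\<alpha> \<sigma>\<bar> * B" by (intro mult_left_mono b\<beta>) auto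
      then show "norm (\<alpha> \<sigma> * \<beta> (\<sigma>, 0)) \<le> norm (B * \<alpha> \<sigma>)" using B0 by (simp add: abs_mult mult.commute)
    qed
  qed simp
  have ih: "integrable lborel h" unfolding h_def using i1 iH by simp
  have h0: "h \<sigma> = 0" if "\<sigma> < 0" for \<sigma>
  proof -
    have "k (t, \<sigma>) = 0" for t using that by (simp add: k_def)
    then show ?thesis using that \<alpha>0 by (simp add: h_def H_def)
  qed
  have Fh: "F w = (LINT \<sigma>|lborel. indicator {..w} \<sigma> * h \<sigma>)" if w: "w \<in> {0..1}" for w
  proof -
    have inner: "\<alpha> t * (\<beta> (t, w - t) * indicator {0..1} (w - t)) =
        indicator {..w} t * (\<alpha> t * \<beta> (t, 0)) + (LINT \<sigma>|lborel. \<alpha> t * (indicator {..w} \<sigma> * k (t, \<sigma>)))" for t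
    proof (cases "t \<in> {0..w}")
      case True
      then have t: "t \<in> {0..1}" "w - t \<in> {0..1}" using w by auto
      have cs: "continuous_on {0..w - t} (\<lambda>\<sigma>. \<beta>' (t, \<sigma>))"
        by (intro continuous_on_compose2[OF c\<beta>'] continuous_intros) auto
      have "(LINT \<sigma>|lborel. indicator {..w} \<sigma> * k (t, \<sigma>)) = (LINT \<sigma>|lborel. indicator {0..w - t} (\<sigma> - t) * \<beta>' (t, \<sigma> - t))"
        using True w by (intro Bochner_Integration.integral_cong) (auto simp: k_def indicator_def)
      also have "\<dots> = (LINT \<sigma>|lborel. indicator {0..w - t} \<sigma> * \<beta>' (t, \<sigma>))"
        using lborel_integral_real_affine[of 1 "\<lambda>\<sigma>. indicator {0..w - t} (\<sigma> - t) * \<beta>' (t, \<sigma> - t)" t]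
        by simp
      also have "\<dots> = integral {0..w - t} (\<lambda>\<sigma>. \<beta>' (t, \<sigma>))"
        by (rule interval_LINT_eq_integral[OF borel_integrable_atLeastAtMost'[OF cs]])
      finally have I: "(LINT \<sigma>|lborel. indicator {..w} \<sigma> * k (t, \<sigma>)) = integral {0..w - t} (\<lambda>\<sigma>. \<beta>' (t, \<sigma>))" .
      have "(LINT \<sigma>|lborel. \<alpha> t * (indicator {..w} \<sigma> * k (t, \<sigma>))) = \<alpha> t * integral {0..w - t} (\<lambda>\<sigma>. \<beta>' (t, \<sigma>))"
        unfolding integral_mult_right_zero I ..
      then show ?thesis using True t ftc[OF t] by (auto simp: algebra_simps)
    next
      case False
      then consider "t < 0" | "t > w" by force
      then show ?thesis
      proof cases
        case 2
        have "(LINT \<sigma>|lborel. \<alpha> t * (indicator {..w} \<sigma> * k (t, \<sigma>))) = (LINT \<sigma>|(lborel :: real measure). 0)"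
          by (rule Bochner_Integration.integral_cong) (use 2 in \<open>auto simp: k_def indicator_def\<close>)
        then show ?thesis using 2 by simp
      qed (simp add: \<alpha>0)
    qed
    have ki': "integrable (lborel \<Otimes>\<^sub>M lborel) (\<lambda>(t, \<sigma>). \<alpha> t * (indicator {..w} \<sigma> * k (t, \<sigma>)))"
    proof -
      have "integrable (lborel \<Otimes>\<^sub>M lborel) (\<lambda>(t, \<sigma>). \<alpha> t * (\<lambda>p. indicator {..w} (snd p) * k p) (t, \<sigma>))"
      proof (rule kernel_integrable[OF \<alpha>])
        have [measurable]: "(\<lambda>p::real \<times> real. snd p) \<in> borel_measurable borel"
          by (intro borel_measurable_continuous_onI continuous_intros)
        note mk[measurable]
        show "(\<lambda>p. indicator {..w} (snd p) * k p) \<in> borel_measurable borel" by measurable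
        show "\<bar>\<alpha> t * (indicator {..w} (snd (t, \<sigma>)) * k (t, \<sigma>))\<bar> \<le> \<bar>\<alpha> t\<bar> * (B * indicator {0..1} \<sigma>)" for t \<sigma>
          unfolding abs_mult[of "\<alpha> t"]
          by (intro mult_left_mono order_trans[OF _ bk[of t \<sigma>]]) (auto simp: indicator_def)
      qed
      then show ?thesis by simp
    qed
    have i2: "integrable lborel (\<lambda>t. indicator {..w} t * (\<alpha> t * \<beta> (t, 0)))"
      using integrable_mult_indicator[OF _ i1, of "{..w}"] by simp
    have i3: "integrable lborel (\<lambda>\<sigma>. indicator {..w} \<sigma> * H \<sigma>)"
      using integrable_mult_indicator[OF _ iH, of "{..w}"] by simp
    have "F w = (LINT t|lborel. indicator {..w} t * (\<alpha> t * \<beta> (t, 0))) +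
        (LINT t|lborel. LINT \<sigma>|lborel. \<alpha> t * (indicator {..w} \<sigma> * k (t, \<sigma>)))"
      unfolding F_def inner by (rule Bochner_Integration.integral_add[OF i2 lborel_pair.integrable_fst[OF ki']])
    also have "(LINT t|lborel. LINT \<sigma>|lborel. \<alpha> t * (indicator {..w} \<sigma> * k (t, \<sigma>))) =
        (LINT \<sigma>|lborel. LINT t|lborel. \<alpha> t * (indicator {..w} \<sigma> * k (t, \<sigma>)))"
      by (rule lborel_pair.Fubini_integral[OF ki', symmetric])
    also have "\<dots> = (LINT \<sigma>|lborel. indicator {..w} \<sigma> * H \<sigma>)"
    proof (rule Bochner_Integration.integral_cong[OF refl])
      fix \<sigma>
      have "(LINT t|lborel. \<alpha> t * (indicator {..w} \<sigma> * k (t, \<sigma>))) = (LINT t|lborel. indicator {..w} \<sigma> * (\<alpha> t * k (t, \<sigma>)))"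
        by (simp only: mult.left_commute)
      then show "(LINT t|lborel. \<alpha> t * (indicator {..w} \<sigma> * k (t, \<sigma>))) = indicator {..w} \<sigma> * H \<sigma>"
        unfolding H_def integral_mult_right_zero .
    qed
    also have "(LINT t|lborel. indicator {..w} t * (\<alpha> t * \<beta> (t, 0))) + (LINT \<sigma>|lborel. indicator {..w} \<sigma> * H \<sigma>) =
        (LINT \<sigma>|lborel. indicator {..w} \<sigma> * h \<sigma>)"
      unfolding h_def distrib_left by (rule Bochner_Integration.integral_add[OF i2 i3, symmetric])
    finally show ?thesis .
  qed
  have sh: "set_integrable lborel {0..w} h" for w
    unfolding set_integrable_def by (rule integrable_mult_indicator[OF _ ih]) simp
  have Fh': "F w = integral {0..w} h" if "w \<in> {0..1}" for w
    unfolding Fh[OF that] by (rule initial_LINT_eq_integral[OF sh h0])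
  have cF: "continuous_on {0..1} F"
  proof -
    have "continuous_on {0..1} (\<lambda>w. integral {0..w} h)"
      by (rule indefinite_integral_continuous_1) (rule set_borel_integral_eq_integral(1)[OF sh])
    then show ?thesis by (rule continuous_on_eq) (simp add: Fh')
  qed
  have F0: "F w = 0" if "w < 0" for w
  proof -
    have z: "\<alpha> t * (\<beta> (t, w - t) * indicator {0..1} (w - t)) = 0" for t
      using that \<alpha>0[of t] by (auto simp: indicator_def)
    show ?thesis unfolding F_def z by simp
  qed
  have intF: "integral {0..c} F = 0" if "c < 1" for c
  proof -
    have "set_integrable lborel {0..c} F"
      by (rule borel_integrable_atLeastAtMost') (rule continuous_on_subset[OF cF], use that in auto)
    from initial_LINT_eq_integral[OF this F0] zero[OF that] show ?thesis by (simp add: F_def)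
  qed
  \<comment> \<open>\<open>F\<close> is continuous, so the vanishing of its integrals over \<open>{0..c}\<close> gives pointwise vanishing.\<close>
  have Fz: "F w = 0" if w: "0 \<le> w" "w < 1" for w
  proof (cases "w = 0")
    case True
    then show ?thesis using Fh'[of 0] by simp
  next
    case False
    have "((\<lambda>c. integral {0..c} F) has_real_derivative F w) (at w within {0..1})"
      by (rule integral_has_real_derivative[OF cF]) (use w in auto)
    then have "((\<lambda>c. integral {0..c} F) has_real_derivative F w) (at w)"
      using w False by (subst (asm) at_within_interior) auto
    moreover have "((\<lambda>c. integral {0..c} F) has_real_derivative 0) (at w)"
      by (rule has_field_derivative_transform_within_open[of "\<lambda>_. 0" _ _ "{..<1}"]) (use w intF in auto)
    ultimately show ?thesis by (rule DERIV_unique)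
  qed
  \<comment> \<open>\<open>H\<close> is controlled by the initial integrals of \<open>\<bar>\<alpha>\<bar>\<close>, so this is an equation of the second kind for \<open>\<alpha>\<close>.\<close>
  have hz: "AE x in lborel. x < 1 \<longrightarrow> h x = 0"
  proof (rule AE_eq_0_of_initial_integrals[OF ih])
    fix c :: real assume c: "c < 1"
    show "(LINT t|lborel. indicator {..c} t * h t) = 0"
    proof (cases "c < 0")
      case True
      then have z: "indicator {..c} t * h t = 0" for t using h0[of t] by (auto simp: indicator_def)
      show ?thesis unfolding z by simp
    next
      case False
      then show ?thesis using Fh[of c] Fz[of c] c by simp
    qed
  qed
  define A where "A = (\<lambda>w. integral {0..w} (\<lambda>t. \<bar>\<alpha> t\<bar>))"
  have i\<alpha>: "integrable lborel (\<lambda>t. \<bar>\<alpha> t\<bar>)" using \<alpha> by simp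
  have s\<alpha>: "set_integrable lborel {0..w} (\<lambda>t. \<bar>\<alpha> t\<bar>)" for w
    unfolding set_integrable_def by (rule integrable_mult_indicator[OF _ i\<alpha>]) simp
  have cA: "continuous_on {0..1} A"
    unfolding A_def by (rule indefinite_integral_continuous_1) (rule set_borel_integral_eq_integral(1)[OF s\<alpha>])
  have A_LINT: "A w = (LINT t|lborel. indicator {0..w} t * \<bar>\<alpha> t\<bar>)" for w
    unfolding A_def by (rule interval_LINT_eq_integral[OF s\<alpha>, symmetric])
  have A0: "A w \<ge> 0" for w unfolding A_LINT by (intro Bochner_Integration.integral_nonneg) auto
  have Hb: "\<bar>H \<sigma>\<bar> \<le> B * A \<sigma>" for \<sigma>
  proof -
    have "norm (H \<sigma>) \<le> (LINT t|lborel. B * (indicator {0..\<sigma>} t * \<bar>\<alpha> t\<bar>))"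
      unfolding H_def
    proof (rule Bochner_Integration.integral_norm_bound_integral)
      show "integrable lborel (\<lambda>t. B * (indicator {0..\<sigma>} t * \<bar>\<alpha> t\<bar>))"
        using s\<alpha>[of \<sigma>] by (intro integrable_mult_right) (simp add: set_integrable_def)
      have le: "norm (\<alpha> t * k (t, \<sigma>)) \<le> B * (indicator {0..\<sigma>} t * \<bar>\<alpha> t\<bar>)" for t
      proof (cases "t \<in> {0..\<sigma>}")
        case True
        have "\<bar>k (t, \<sigma>)\<bar> \<le> B" using bk[of t \<sigma>] B0 by (cases "\<sigma> \<in> {0..1}") auto
        then have "\<bar>\<alpha> t\<bar> * \<bar>k (t, \<sigma>)\<bar> \<le> \<bar>\<alpha> t\<bar> * B" by (intro mult_left_mono) auto
        then show ?thesis using True by (simp add: abs_mult mult.commute)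
      next
        case False
        then have "\<alpha> t * k (t, \<sigma>) = 0" using \<alpha>0[of t] by (cases "t < 0") (auto simp: k_def)
        then show ?thesis using False by simp
      qed
      then show "\<And>t. t \<in> space lborel \<Longrightarrow> norm (\<alpha> t * k (t, \<sigma>)) \<le> B * (indicator {0..\<sigma>} t * \<bar>\<alpha> t\<bar>)" by blast
      show "integrable lborel (\<lambda>t. \<alpha> t * k (t, \<sigma>))"
      proof (rule Bochner_Integration.integrable_bound)
        show "integrable lborel (\<lambda>t. B * (indicator {0..\<sigma>} t * \<bar>\<alpha> t\<bar>))" by fact
        have "(\<lambda>t. k (t, \<sigma>)) \<in> borel_measurable borel"
          using measurable_compose[OF _ mk, of "\<lambda>t. (t, \<sigma>)" borel]
          by (simp add: borel_measurable_continuous_onI continuous_intros)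
        then show "(\<lambda>t. \<alpha> t * k (t, \<sigma>)) \<in> borel_measurable lborel" by simp
        show "AE t in lborel. norm (\<alpha> t * k (t, \<sigma>)) \<le> norm (B * (indicator {0..\<sigma>} t * \<bar>\<alpha> t\<bar>))"
          by (rule AE_I2, rule order_trans[OF le]) simp
      qed
    qed
    then show ?thesis by (simp add: A_LINT)
  qed
  have pw: "AE x in lborel. x \<in> {0..1} \<longrightarrow> \<bar>\<alpha> x\<bar> \<le> B / m * A x"
    using hz AE_lborel_singleton[of 1]
  proof eventually_elim
    case (elim x)
    show ?case
    proof
      assume x: "x \<in> {0..1}"
      then have "\<alpha> x * \<beta> (x, 0) = - H x" using elim by (auto simp: h_def)
      then have "\<bar>\<alpha> x\<bar> * \<bar>\<beta> (x, 0)\<bar> = \<bar>H x\<bar>" by (metis abs_minus_cancel abs_mult)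
      moreover have "\<bar>\<alpha> x\<bar> * m \<le> \<bar>\<alpha> x\<bar> * \<bar>\<beta> (x, 0)\<bar>"
        using m(2)[OF x] by (intro mult_left_mono) auto
      ultimately have "\<bar>\<alpha> x\<bar> * m \<le> B * A x" using Hb[of x] by linarith
      then show "\<bar>\<alpha> x\<bar> \<le> B / m * A x" using m(1) by (simp add: field_simps)
    qed
  qed
  have "A 1 = 0"
  proof (rule gronwall_zero[OF cA A0])
    fix w :: real assume w: "w \<in> {0..1}"
    have sA: "set_integrable lborel {0..w} A"
      by (rule borel_integrable_atLeastAtMost') (rule continuous_on_subset[OF cA], use w in auto)
    have "A w \<le> (LINT t|lborel. B / m * (indicator {0..w} t * A t))"
      unfolding A_LINT[of w]
    proof (rule integral_mono_AE)
      show "integrable lborel (\<lambda>t. indicator {0..w} t * \<bar>\<alpha> t\<bar>)"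
        using s\<alpha>[of w] by (simp add: set_integrable_def)
      show "integrable lborel (\<lambda>t. B / m * (indicator {0..w} t * A t))"
        using sA by (intro integrable_mult_right) (simp add: set_integrable_def)
      show "AE t in lborel. indicator {0..w} t * \<bar>\<alpha> t\<bar> \<le> B / m * (indicator {0..w} t * A t)"
        using pw by eventually_elim (use w in \<open>auto simp: indicator_def\<close>)
    qed
    also have "\<dots> = B / m * integral {0..w} A"
      unfolding integral_mult_right_zero interval_LINT_eq_integral[OF sA] ..
    finally show "A w \<le> B / m * integral {0..w} A" .
  qed simp
  moreover have "A 1 = (LINT t|lborel. \<bar>\<alpha> t\<bar>)"
  proof -
    have e: "indicator {0..1} t * \<bar>\<alpha> t\<bar> = \<bar>\<alpha> t\<bar>" for t using \<alpha>0[of t] by (cases "t \<in> {0..1}") auto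
    show ?thesis unfolding A_LINT e ..
  qed
  ultimately have "AE t in lborel. \<bar>\<alpha> t\<bar> = 0"
    using integral_nonneg_eq_0_iff_AE[OF i\<alpha>] by simp
  then show ?thesis by simp
qed

section \<open>Weights that are Laplace transforms\<close>

text \<open>The retraction of the plane onto the unit square.  Composition with it extends continuous functions on
  the square to bounded continuous functions on the plane, to which Fubini's theorem applies directly.\<close>

definition clamp2 :: "real \<times> real \<Rightarrow> real \<times> real" where
  "clamp2 p = (max 0 (min 1 (fst p)), max 0 (min 1 (snd p)))"

lemma clamp2_in: "clamp2 p \<in> {0..1} \<times> {0..1}"
  by (simp add: clamp2_def)

lemma clamp2_id: "t \<in> {0..1} \<Longrightarrow> s \<in> {0..1} \<Longrightarrow> clamp2 (t, s) = (t, s)"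
  by (simp add: clamp2_def)

lemma clamp2_extension:
  fixes f :: "real \<times> real \<Rightarrow> real"
  assumes "continuous_on ({0..1} \<times> {0..1}) f"
  shows "continuous_on UNIV (f \<circ> clamp2)" "\<exists>B. \<forall>p. \<bar>(f \<circ> clamp2) p\<bar> \<le> B"
proof -
  have "continuous_on UNIV clamp2" unfolding clamp2_def by (intro continuous_intros)
  then show "continuous_on UNIV (f \<circ> clamp2)"
    by (rule continuous_on_compose) (rule continuous_on_subset[OF assms], use clamp2_in in blast)
  have "compact ({0..1::real} \<times> {0..1::real})" by (intro compact_Times compact_Icc)
  then have "bounded (f ` ({0..1} \<times> {0..1}))"
    by (intro compact_imp_bounded compact_continuous_image assms)
  then obtain B where "\<And>q. q \<in> {0..1} \<times> {0..1} \<Longrightarrow> \<bar>f q\<bar> \<le> B"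
    unfolding bounded_iff by auto
  then show "\<exists>B. \<forall>p. \<bar>(f \<circ> clamp2) p\<bar> \<le> B" using clamp2_in by (intro exI[of _ B]) auto
qed

text \<open>Fubini's theorem is applied on the product of two copies of \<open>lborel\<close>; this requires a Borel function in place
  of the merely Lebesgue measurable \<open>a\<close>.\<close>

lemma borel_representative:
  fixes a :: "real \<Rightarrow> real"
  assumes a: "integrable (lebesgue_on {0..1}) a"
  obtains \<alpha> where "integrable lborel \<alpha>" "\<And>t. t \<notin> {0..1} \<Longrightarrow> \<alpha> t = 0"
    "AE t in lebesgue. indicator {0..1} t * a t = \<alpha> t"
proof -
  have ia: "integrable lebesgue (\<lambda>t. indicator {0..1} t * a t)"
    using a by (subst (asm) integrable_restrict_space) auto
  obtain g where g: "g \<in> borel_measurable lborel" "AE t in lborel. indicator {0..1} t * a t = g t"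
    using completion_ex_borel_measurable_real[of "\<lambda>t. indicator {0..1} t * a t" lborel] ia
    by (auto dest: borel_measurable_integrable)
  define \<alpha> where "\<alpha> = (\<lambda>t. indicator {0..1} t * g t)"
  have m: "\<alpha> \<in> borel_measurable lborel" using g(1) unfolding \<alpha>_def by simp
  have ae: "AE t in lebesgue. indicator {0..1} t * a t = \<alpha> t"
    using AE_completion[OF g(2)]
  proof eventually_elim
    case (elim t)
    then show ?case by (cases "t \<in> {0..1}") (auto simp: \<alpha>_def)
  qed
  have "integrable lebesgue \<alpha>"
    by (subst integrable_cong_AE[of _ _ "\<lambda>t. indicator {0..1} t * a t"])
       (use ia ae measurable_completion[OF m] in \<open>auto dest: borel_measurable_integrable elim: eventually_mono\<close>)
  then have "integrable lborel \<alpha>" using integrable_completion[OF m] by simp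
  then show ?thesis using that[of \<alpha>] ae by (auto simp: \<alpha>_def)
qed

lemma LINT_unit_interval:
  fixes g :: "real \<Rightarrow> real"
  assumes \<alpha>: "integrable lborel \<alpha>" "AE t in lebesgue. indicator {0..1} t * a t = \<alpha> t"
    and a: "a \<in> borel_measurable (lebesgue_on {0..1})" and g: "g \<in> borel_measurable borel"
  shows "(LINT t|lebesgue_on {0..1}. g t * a t) = (LINT t|lborel. \<alpha> t * g t)"
proof -
  have m\<alpha>: "\<alpha> \<in> borel_measurable lborel" using \<alpha>(1) by (rule borel_measurable_integrable)
  have ma: "(\<lambda>t. indicator {0..1} t * a t) \<in> borel_measurable lebesgue"
    using a by (subst (asm) borel_measurable_restrict_space_iff) auto
  have mg: "g \<in> borel_measurable lebesgue" using g by (simp add: measurable_completion)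
  have m\<alpha>': "\<alpha> \<in> borel_measurable lebesgue" using m\<alpha> by (rule measurable_completion)
  have "(LINT t|lebesgue_on {0..1}. g t * a t) = (LINT t|lebesgue. indicator {0..1} t *\<^sub>R (g t * a t))"
    by (rule integral_restrict_space) auto
  also have "\<dots> = (LINT t|lebesgue. g t * (indicator {0..1} t * a t))"
    by (simp add: mult.left_commute)
  also have "\<dots> = (LINT t|lebesgue. \<alpha> t * g t)"
    using \<alpha>(2) by (intro integral_cong_AE borel_measurable_times ma mg m\<alpha>') (auto elim: eventually_mono)
  also have "\<dots> = (LINT t|lborel. \<alpha> t * g t)"
    using m\<alpha> g by (intro integral_completion) auto
  finally show ?thesis .
qed

text \<open>Since the weight is a Laplace transform itself, the product \<open>exp (- t / x) * Q (t, x)\<close> turns into a single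
  exponential in \<open>w = t + s\<close>, integrated against the convolution \<open>F\<close>; the term with \<open>G\<close> is absorbed in the
  error.  So \<open>F\<close> has exponentially decaying moments.\<close>

theorem laplace_weighted_uniqueness:
  fixes G b b' Q :: "real \<times> real \<Rightarrow> real" and a :: "real \<Rightarrow> real"
  assumes bG: "bounded (G ` ({0..1} \<times> {0..1}))"
    and mG: "\<forall>x\<in>{0..1}. (\<lambda>t. G (t, x)) \<in> borel_measurable (lebesgue_on {0..1})"
    and cb: "continuous_on ({0..1} \<times> {0..1}) b"
    and pb: "\<forall>t\<in>{0..1}. b (t, 0) > 0"
    and db: "\<forall>t\<in>{0..1}. \<forall>s\<in>{0..1}. ((\<lambda>\<sigma>. b (t, \<sigma>)) has_real_derivative b' (t, s)) (at s within {0..1})"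
    and cb': "continuous_on ({0..1} \<times> {0..1}) b'"
    and Q: "\<forall>t\<in>{0..1}. \<forall>x\<in>{0<..1}. Q (t, x) = 1 / x * (LINT s|lebesgue_on {0..1}. exp (- s / x) * b (t, s)) + exp (- 1 / x) * G (t, x)"
    and a: "integrable (lebesgue_on {0..1}) a"
    and decay: "\<forall>x\<in>{1 / real n |n. n \<ge> 1}. \<bar>LINT t|lebesgue_on {0..1}. exp (- t / x) * Q (t, x) * a t\<bar> \<le> C * exp (- 1 / x)"
  shows "AE t in lebesgue_on {0..1}. a t = 0"
proof -
  obtain \<alpha> where \<alpha>: "integrable lborel \<alpha>" "\<And>t. t \<notin> {0..1} \<Longrightarrow> \<alpha> t = 0"
    and \<alpha>a: "AE t in lebesgue. indicator {0..1} t * a t = \<alpha> t"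
    using borel_representative[OF a] by metis
  have ma: "a \<in> borel_measurable (lebesgue_on {0..1})" using a by (rule borel_measurable_integrable)
  have m\<alpha>[measurable]: "\<alpha> \<in> borel_measurable borel" using \<alpha>(1) by (auto dest: borel_measurable_integrable)
  define \<beta> where "\<beta> = b \<circ> clamp2"
  define \<beta>' where "\<beta>' = b' \<circ> clamp2"
  have c\<beta>: "continuous_on UNIV \<beta>" and c\<beta>': "continuous_on UNIV \<beta>'"
    unfolding \<beta>_def \<beta>'_def by (rule clamp2_extension[OF cb], rule clamp2_extension[OF cb'])
  obtain B1 B2 where "\<And>p. \<bar>\<beta> p\<bar> \<le> B1" "\<And>p. \<bar>\<beta>' p\<bar> \<le> B2"
    using clamp2_extension(2)[OF cb] clamp2_extension(2)[OF cb'] unfolding \<beta>_def \<beta>'_def by metis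
  then obtain B where b\<beta>: "\<And>p. \<bar>\<beta> p\<bar> \<le> B" and b\<beta>': "\<And>p. \<bar>\<beta>' p\<bar> \<le> B"
    by (metis max.coboundedI1 max.coboundedI2)
  have B0: "B \<ge> 0" using b\<beta>[of 0] by linarith
  have \<beta>b: "\<beta> (t, s) = b (t, s)" "\<beta>' (t, s) = b' (t, s)" if "t \<in> {0..1}" "s \<in> {0..1}" for t s
    using clamp2_id[OF that] by (simp_all add: \<beta>_def \<beta>'_def)
  have m\<beta>[measurable]: "\<beta> \<in> borel_measurable (lborel \<Otimes>\<^sub>M lborel)"
    by (rule borel_measurable_pair_lborel[OF borel_measurable_continuous_onI[OF c\<beta>]])
  define L where "L = (\<lambda>n t. LINT s|lborel. exp (- (real n * s)) * (\<beta> (t, s) * indicator {0..1} s))"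
  have mL[measurable]: "L n \<in> borel_measurable borel" for n
  proof -
    have "(\<lambda>t. LINT s|lborel. exp (- (real n * s)) * (\<beta> (t, s) * indicator {0..1} s)) \<in> borel_measurable lborel"
      by measurable
    then show ?thesis by (simp add: L_def)
  qed
  have L_eq: "(LINT s|lebesgue_on {0..1}. exp (- s * real n) * b (t, s)) = L n t" if "t \<in> {0..1}" for n t
  proof -
    have [measurable]: "(\<lambda>s. \<beta> (t, s)) \<in> borel_measurable borel"
      by (intro borel_measurable_continuous_onI continuous_on_compose2[OF c\<beta>] continuous_intros) auto
    have "(LINT s|lebesgue_on {0..1}. exp (- s * real n) * b (t, s)) =
        (LINT s|lebesgue. indicator {0..1} s *\<^sub>R (exp (- s * real n) * b (t, s)))"
      by (rule integral_restrict_space) auto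
    also have "\<dots> = (LINT s|lebesgue. exp (- (real n * s)) * (\<beta> (t, s) * indicator {0..1} s))"
      by (rule Bochner_Integration.integral_cong) (auto simp: indicator_def \<beta>b(1)[OF that] mult.commute)
    also have "\<dots> = L n t" unfolding L_def by (rule integral_completion) measurable
    finally show ?thesis .
  qed
  have bL: "\<bar>L n t\<bar> \<le> B" for n t
  proof -
    have i: "integrable lborel (\<lambda>s. B * indicator {0..1::real} s)"
      by (intro integrable_mult_right integrable_real_indicator) (auto simp: emeasure_lborel_Icc_eq)
    have [measurable]: "(\<lambda>s. \<beta> (t, s)) \<in> borel_measurable borel"
      by (intro borel_measurable_continuous_onI continuous_on_compose2[OF c\<beta>] continuous_intros) auto
    have le: "norm (exp (- (real n * s)) * (\<beta> (t, s) * indicator {0..1} s)) \<le> B * indicator {0..1} s" for s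
    proof (cases "s \<in> {0..1}")
      case True
      then have "exp (- (real n * s)) * \<bar>\<beta> (t, s)\<bar> \<le> 1 * B"
        using b\<beta> by (intro mult_mono) auto
      then show ?thesis using True by (simp add: abs_mult)
    qed simp
    have "norm (L n t) \<le> (LINT s|lborel. B * indicator {0..1::real} s)"
      unfolding L_def
    proof (rule Bochner_Integration.integral_norm_bound_integral[OF _ i le])
      show "integrable lborel (\<lambda>s. exp (- (real n * s)) * (\<beta> (t, s) * indicator {0..1} s))"
        by (rule Bochner_Integration.integrable_bound[OF i]) (use le B0 in \<open>auto intro!: AE_I2 simp del: mult_eq_0_iff\<close>)
    qed
    then show ?thesis by simp
  qed
  define F where "F = (\<lambda>w. LINT t|lborel. \<alpha> t * (\<beta> (t, w - t) * indicator {0..1} (w - t)))"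
  have ker: "integrable (lborel \<Otimes>\<^sub>M lborel)
      (\<lambda>(t, w). \<alpha> t * (exp (- (real n * w)) * (\<beta> (t, w - t) * indicator {0..1} (w - t))))" for n
  proof -
    have "integrable (lborel \<Otimes>\<^sub>M lborel) (\<lambda>(t, w). \<alpha> t *
        (\<lambda>p. exp (- (real n * snd p)) * (\<beta> (fst p, snd p - fst p) * indicator {0..1} (snd p - fst p))) (t, w))"
    proof (rule kernel_integrable[OF \<alpha>(1)])
      have [measurable]: "(\<lambda>p::real \<times> real. \<beta> (fst p, snd p - fst p)) \<in> borel_measurable borel"
        by (intro borel_measurable_continuous_onI continuous_on_compose2[OF c\<beta>] continuous_intros) auto
      have [measurable]: "(\<lambda>p::real \<times> real. snd p - fst p) \<in> borel_measurable borel" "(\<lambda>p::real \<times> real. snd p) \<in> borel_measurable borel"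
        by (intro borel_measurable_continuous_onI continuous_intros)+
      show "(\<lambda>p. exp (- (real n * snd p)) * (\<beta> (fst p, snd p - fst p) * indicator {0..1} (snd p - fst p))) \<in> borel_measurable borel"
        by measurable
      fix t w
      have "\<bar>exp (- (real n * w)) * (\<beta> (t, w - t) * indicator {0..1} (w - t))\<bar> \<le> B * indicator {0..2} w" if t: "t \<in> {0..1}"
      proof (cases "w - t \<in> {0..1}")
        case True
        then have "w \<in> {0..2}" using t by auto
        moreover have "exp (- (real n * w)) * \<bar>\<beta> (t, w - t)\<bar> \<le> 1 * B"
          using calculation b\<beta> by (intro mult_mono) auto
        ultimately show ?thesis using True by (simp add: abs_mult)
      qed (simp add: B0)
      then show "\<bar>\<alpha> t * (exp (- (real n * snd (t, w))) * (\<beta> (fst (t, w), snd (t, w) - fst (t, w)) * indicator {0..1} (snd (t, w) - fst (t, w))))\<bar>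
          \<le> \<bar>\<alpha> t\<bar> * (B * indicator {0..2} w)"
        unfolding abs_mult[of "\<alpha> t"] using \<alpha>(2)[of t] by (cases "t \<in> {0..1}") (auto intro!: mult_left_mono)
    qed
    then show ?thesis by simp
  qed
  have iF: "integrable lborel F"
    using lborel_pair.integrable_snd[OF ker[of 0]] by (simp add: F_def)
  have F0: "F w = 0" if "w < 0" for w
  proof -
    have z: "\<alpha> t * (\<beta> (t, w - t) * indicator {0..1} (w - t)) = 0" for t
      using that \<alpha>(2)[of t] by (auto simp: indicator_def)
    show ?thesis unfolding F_def z by simp
  qed
  have convolution: "(LINT t|lborel. \<alpha> t * (exp (- (real n * t)) * L n t)) = (LINT w|lborel. exp (- (real n * w)) * F w)" for n
  proof -
    have e: "\<alpha> t * (exp (- (real n * t)) * L n t) =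
        (LINT w|lborel. \<alpha> t * (exp (- (real n * w)) * (\<beta> (t, w - t) * indicator {0..1} (w - t))))" for t
    proof -
      have "(LINT w|lborel. exp (- (real n * w)) * (\<beta> (t, w - t) * indicator {0..1} (w - t))) =
          (LINT s|lborel. exp (- (real n * (t + s))) * (\<beta> (t, s) * indicator {0..1} s))"
        using lborel_integral_real_affine[of 1 "\<lambda>w. exp (- (real n * w)) * (\<beta> (t, w - t) * indicator {0..1} (w - t))" t]
        by simp
      also have "\<dots> = (LINT s|lborel. exp (- (real n * t)) * (exp (- (real n * s)) * (\<beta> (t, s) * indicator {0..1} s)))"
      proof (rule Bochner_Integration.integral_cong[OF refl])
        fix s
        have "exp (- (real n * (t + s))) = exp (- (real n * t)) * exp (- (real n * s))"
          unfolding exp_add[symmetric] by (simp add: algebra_simps)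
        then show "exp (- (real n * (t + s))) * (\<beta> (t, s) * indicator {0..1} s) =
            exp (- (real n * t)) * (exp (- (real n * s)) * (\<beta> (t, s) * indicator {0..1} s))" by simp
      qed
      also have "\<dots> = exp (- (real n * t)) * L n t" unfolding L_def by (rule integral_mult_right_zero)
      finally show ?thesis unfolding integral_mult_right_zero by simp
    qed
    have "(LINT t|lborel. \<alpha> t * (exp (- (real n * t)) * L n t)) =
        (LINT t|lborel. LINT w|lborel. \<alpha> t * (exp (- (real n * w)) * (\<beta> (t, w - t) * indicator {0..1} (w - t))))"
      by (simp only: e)
    also have "\<dots> = (LINT w|lborel. LINT t|lborel. \<alpha> t * (exp (- (real n * w)) * (\<beta> (t, w - t) * indicator {0..1} (w - t))))"
      by (rule lborel_pair.Fubini_integral[OF ker, symmetric])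
    also have "\<dots> = (LINT w|lborel. exp (- (real n * w)) * F w)"
    proof (rule Bochner_Integration.integral_cong[OF refl])
      fix w
      have "(LINT t|lborel. \<alpha> t * (exp (- (real n * w)) * (\<beta> (t, w - t) * indicator {0..1} (w - t)))) =
          (LINT t|lborel. exp (- (real n * w)) * (\<alpha> t * (\<beta> (t, w - t) * indicator {0..1} (w - t))))"
        by (simp only: mult.left_commute)
      then show "(LINT t|lborel. \<alpha> t * (exp (- (real n * w)) * (\<beta> (t, w - t) * indicator {0..1} (w - t)))) =
          exp (- (real n * w)) * F w"
        unfolding F_def integral_mult_right_zero .
    qed
    finally show ?thesis .
  qed
  obtain M where M: "\<And>p. p \<in> {0..1} \<times> {0..1} \<Longrightarrow> \<bar>G p\<bar> \<le> M"
    using bG unfolding bounded_iff by auto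
  have M0: "M \<ge> 0" using M[of "(0, 0)"] by simp
  define I where "I = (LINT t|lebesgue_on {0..1}. \<bar>a t\<bar>)"
  have I0: "I \<ge> 0" unfolding I_def by (rule Bochner_Integration.integral_nonneg) simp
  have F_decay: "\<bar>LINT w|lborel. exp (- (real n * w)) * F w\<bar> \<le> (\<bar>C\<bar> + M * I) * exp (- real n)" if n: "n \<ge> 1" for n
  proof -
    define x where "x = 1 / real n"
    have x: "x \<in> {0<..1}" "x \<in> {0..1}" "1 / x = real n" using n by (auto simp: x_def)
    have dx: "y / x = y * real n" for y by (simp add: x_def)
    have e1: "exp (- 1 / x) = exp (- real n)" by (simp add: dx)
    have mLa: "(\<lambda>t. exp (- (real n * t)) * L n t) \<in> borel_measurable (lebesgue_on {0..1})"
      using mL[of n] by (intro measurable_restrict_space1 measurable_completion) measurable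
    have mGa: "(\<lambda>t. exp (- (real n * t)) * G (t, x)) \<in> borel_measurable (lebesgue_on {0..1})"
    proof (rule borel_measurable_times)
      show "(\<lambda>t::real. exp (- (real n * t))) \<in> borel_measurable (lebesgue_on {0..1})"
        by (intro measurable_restrict_space1 measurable_completion) measurable
    qed (use mG x in auto)
    have iL: "integrable (lebesgue_on {0..1}) (\<lambda>t. exp (- (real n * t)) * L n t * a t)"
    proof (rule Bochner_Integration.integrable_bound[OF integrable_mult_right[OF a, of B]])
      show "AE t in lebesgue_on {0..1}. norm (exp (- (real n * t)) * L n t * a t) \<le> norm (B * a t)"
      proof (rule AE_I2)
        fix t :: real assume "t \<in> space (lebesgue_on {0..1})"
        then have "exp (- (real n * t)) * \<bar>L n t\<bar> * \<bar>a t\<bar> \<le> 1 * B * \<bar>a t\<bar>"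
          by (intro mult_right_mono mult_mono bL) auto
        then show "norm (exp (- (real n * t)) * L n t * a t) \<le> norm (B * a t)" using B0 by (simp add: abs_mult)
      qed
    qed (intro borel_measurable_times mLa ma)
    have leG: "norm (exp (- (real n * t)) * G (t, x) * a t) \<le> M * \<bar>a t\<bar>" if "t \<in> space (lebesgue_on {0..1})" for t
    proof -
      have "exp (- (real n * t)) * \<bar>G (t, x)\<bar> * \<bar>a t\<bar> \<le> 1 * M * \<bar>a t\<bar>"
        using that x by (intro mult_right_mono mult_mono M) auto
      then show ?thesis by (simp add: abs_mult)
    qed
    have iG: "integrable (lebesgue_on {0..1}) (\<lambda>t. exp (- (real n * t)) * G (t, x) * a t)"
    proof (rule Bochner_Integration.integrable_bound[OF integrable_mult_right[OF integrable_abs[OF a], of M]])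
      show "AE t in lebesgue_on {0..1}. norm (exp (- (real n * t)) * G (t, x) * a t) \<le> norm (M * \<bar>a t\<bar>)"
        using leG M0 by (intro AE_I2) auto
    qed (intro borel_measurable_times mGa ma)
    have bG': "\<bar>LINT t|lebesgue_on {0..1}. exp (- (real n * t)) * G (t, x) * a t\<bar> \<le> M * I"
    proof -
      have "norm (LINT t|lebesgue_on {0..1}. exp (- (real n * t)) * G (t, x) * a t) \<le> (LINT t|lebesgue_on {0..1}. M * \<bar>a t\<bar>)"
        by (rule Bochner_Integration.integral_norm_bound_integral[OF iG integrable_mult_right[OF integrable_abs[OF a]] leG])
      also have "\<dots> = M * I" unfolding I_def by (rule integral_mult_right_zero)
      finally show ?thesis by simp
    qed
    have "(LINT t|lebesgue_on {0..1}. exp (- t / x) * Q (t, x) * a t) =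
        (LINT t|lebesgue_on {0..1}. real n * (exp (- (real n * t)) * L n t * a t) + exp (- real n) * (exp (- (real n * t)) * G (t, x) * a t))"
    proof (rule Bochner_Integration.integral_cong[OF refl])
      fix t :: real assume "t \<in> space (lebesgue_on {0..1})"
      then have t: "t \<in> {0..1}" by simp
      have "Q (t, x) = real n * L n t + exp (- real n) * G (t, x)"
        using Q t x L_eq[OF t, of n] by (simp add: dx)
      moreover have "exp (- t / x) = exp (- (real n * t))" by (simp add: dx mult.commute)
      ultimately show "exp (- t / x) * Q (t, x) * a t =
          real n * (exp (- (real n * t)) * L n t * a t) + exp (- real n) * (exp (- (real n * t)) * G (t, x) * a t)"
        by (simp add: algebra_simps)
    qed
    also have "\<dots> = real n * (LINT t|lebesgue_on {0..1}. exp (- (real n * t)) * L n t * a t) +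
        exp (- real n) * (LINT t|lebesgue_on {0..1}. exp (- (real n * t)) * G (t, x) * a t)"
      using iL iG by simp
    finally have eq: "(LINT t|lebesgue_on {0..1}. exp (- t / x) * Q (t, x) * a t) =
        real n * (LINT t|lebesgue_on {0..1}. exp (- (real n * t)) * L n t * a t) +
        exp (- real n) * (LINT t|lebesgue_on {0..1}. exp (- (real n * t)) * G (t, x) * a t)" .
    have "(LINT t|lebesgue_on {0..1}. exp (- (real n * t)) * L n t * a t) =
        (LINT t|lborel. \<alpha> t * (exp (- (real n * t)) * L n t))"
      by (rule LINT_unit_interval[OF \<alpha>(1) \<alpha>a ma]) measurable
    then have W: "(LINT t|lebesgue_on {0..1}. exp (- (real n * t)) * L n t * a t) = (LINT w|lborel. exp (- (real n * w)) * F w)"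
      by (simp only: convolution)
    let ?W = "LINT w|lborel. exp (- (real n * w)) * F w"
    let ?V = "LINT t|lebesgue_on {0..1}. exp (- (real n * t)) * G (t, x) * a t"
    have "x \<in> {1 / real n |n. n \<ge> 1}" using n by (auto simp: x_def)
    then have "\<bar>LINT t|lebesgue_on {0..1}. exp (- t / x) * Q (t, x) * a t\<bar> \<le> C * exp (- 1 / x)"
      using decay by blast
    then have "\<bar>real n * ?W + exp (- real n) * ?V\<bar> \<le> C * exp (- real n)"
      unfolding eq W e1 .
    moreover have "\<bar>exp (- real n) * ?V\<bar> \<le> exp (- real n) * (M * I)"
      using bG' by (simp add: abs_mult mult_left_mono)
    \<comment> \<open>The factor \<open>1 / x = n \<ge> 1\<close> only strengthens the hypothesis.\<close>
    moreover have "\<bar>?W\<bar> \<le> \<bar>real n * ?W\<bar>"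
      using n mult_right_mono[of 1 "real n" "\<bar>?W\<bar>"] by (simp add: abs_mult)
    moreover have "C * exp (- real n) \<le> \<bar>C\<bar> * exp (- real n)" by (intro mult_right_mono) auto
    ultimately have "\<bar>?W\<bar> \<le> \<bar>C\<bar> * exp (- real n) + exp (- real n) * (M * I)" by linarith
    then show ?thesis by (simp add: algebra_simps)
  qed
  have F_zero: "(LINT w|lborel. indicator {..c} w * F w) = 0" if "c < 1" for c
    by (rule exp_decay_moments_imp_zero[OF iF F0 F_decay that])
  have "compact ((\<lambda>t. b (t, 0)) ` {0..1})"
    by (intro compact_continuous_image continuous_on_compose2[OF cb] continuous_intros) auto
  then obtain t0 where t0: "t0 \<in> {0..1}" "\<And>t. t \<in> {0..1} \<Longrightarrow> b (t0, 0) \<le> b (t, 0)"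
    using compact_attains_inf[of "(\<lambda>t. b (t, 0)) ` {0..1}"] by fastforce
  have "AE t in lborel. \<alpha> t = 0"
  proof (rule volterra_unique[OF \<alpha> c\<beta> c\<beta>' b\<beta> b\<beta>'])
    show "b (t0, 0) > 0" using pb t0 by blast
    show "b (t0, 0) \<le> \<beta> (t, 0)" if "t \<in> {0..1}" for t using t0(2)[OF that] that by (simp add: \<beta>b)
    show "(LINT w|lborel. indicator {..c} w * (LINT t|lborel. \<alpha> t * (\<beta> (t, w - t) * indicator {0..1} (w - t)))) = 0"
      if "c < 1" for c using F_zero[OF that] by (simp only: F_def)
    fix t u :: real assume tu: "t \<in> {0..1}" "u \<in> {0..1}"
    have "((\<lambda>\<sigma>. b' (t, \<sigma>)) has_integral b (t, u) - b (t, 0)) {0..u}"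
    proof (rule fundamental_theorem_of_calculus)
      fix s assume s: "s \<in> {0..u}"
      then have "((\<lambda>\<sigma>. b (t, \<sigma>)) has_real_derivative b' (t, s)) (at s within {0..1})"
        using db tu by auto
      then have "((\<lambda>\<sigma>. b (t, \<sigma>)) has_real_derivative b' (t, s)) (at s within {0..u})"
        by (rule DERIV_subset) (use tu in auto)
      then show "((\<lambda>\<sigma>. b (t, \<sigma>)) has_vector_derivative b' (t, s)) (at s within {0..u})"
        by (simp add: has_real_derivative_iff_has_vector_derivative)
    qed (use tu in auto)
    then have "integral {0..u} (\<lambda>\<sigma>. b' (t, \<sigma>)) = b (t, u) - b (t, 0)" by (rule integral_unique)
    moreover have "integral {0..u} (\<lambda>\<sigma>. \<beta>' (t, \<sigma>)) = integral {0..u} (\<lambda>\<sigma>. b' (t, \<sigma>))"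
      by (rule integral_cong) (use tu in \<open>auto simp: \<beta>b\<close>)
    ultimately show "\<beta> (t, u) = \<beta> (t, 0) + integral {0..u} (\<lambda>\<sigma>. \<beta>' (t, \<sigma>))"
      using tu by (simp add: \<beta>b)
  qed
  then have "AE t in lebesgue. \<alpha> t = 0" by (rule AE_completion)
  with \<alpha>a have "AE t in lebesgue. t \<in> {0..1} \<longrightarrow> a t = 0"
    by eventually_elim (auto simp: indicator_def)
  then show ?thesis by (subst AE_restrict_space_iff) auto
qed

section \<open>Non-uniqueness and uniqueness\<close>

theorem theorem1p2:
  "(\<exists>(Q :: real \<times> real \<Rightarrow> real) (b :: real \<Rightarrow> real).
      smooth_on ({0..1} \<times> {0..1}) Q \<and>
      (\<forall>s\<in>{0..1}. \<forall>x\<in>{0..1}. Q (s, x) > 0) \<and>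
      (\<forall>s\<in>{1/3..1}. \<forall>x\<in>{0..1}. Q (s, x) = 1) \<and>
      smooth_cpt_on {0..<1/3} b \<and>
      (\<exists>s\<in>{0..<1/3}. b s \<noteq> 0) \<and>
      (\<forall>\<^sub>F x in at_right 0.
         (LINT s|lebesgue_on {0..1}. exp (- s / x) * Q (s, x) * b s) = 0))
   \<and>
   (\<forall>(G :: real \<times> real \<Rightarrow> real) (b :: real \<times> real \<Rightarrow> real) (b' :: real \<times> real \<Rightarrow> real)
     (Q :: real \<times> real \<Rightarrow> real) (a :: real \<Rightarrow> real).
      bounded (G ` ({0..1} \<times> {0..1})) \<longrightarrow>
      (\<forall>x\<in>{0..1}. (\<lambda>t. G (t, x)) \<in> borel_measurable (lebesgue_on {0..1})) \<longrightarrow>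
      continuous_on ({0..1} \<times> {0..1}) b \<longrightarrow>
      (\<forall>t\<in>{0..1}. b (t, 0) > 0) \<longrightarrow>
      (\<forall>t\<in>{0..1}. \<forall>s\<in>{0..1}.
         ((\<lambda>\<sigma>. b (t, \<sigma>)) has_real_derivative b' (t, s)) (at s within {0..1})) \<longrightarrow>
      continuous_on ({0..1} \<times> {0..1}) b' \<longrightarrow>
      (\<forall>t\<in>{0..1}. \<forall>x\<in>{0<..1}.
         Q (t, x) = 1 / x * (LINT s|lebesgue_on {0..1}. exp (- s / x) * b (t, s))
                    + exp (- 1 / x) * G (t, x)) \<longrightarrow>
      integrable (lebesgue_on {0..1}) a \<longrightarrow>
      (\<exists>C::real. \<forall>x\<in>{1 / real n |n. n \<ge> 1}.
         \<bar>LINT t|lebesgue_on {0..1}. exp (- t / x) * Q (t, x) * a t\<bar> \<le> C * exp (- 1 / x)) \<longrightarrow>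
      (AE t in lebesgue_on {0..1}. a t = 0))"
proof (intro conjI allI impI, goal_cases)
  case 1
  show ?case by (rule smooth_weight_counterexample)
next
  case (2 G b b' Q a)
  from 2(9) obtain C where
    "\<forall>x\<in>{1 / real n |n. n \<ge> 1}. \<bar>LINT t|lebesgue_on {0..1}. exp (- t / x) * Q (t, x) * a t\<bar> \<le> C * exp (- 1 / x)" ..
  with 2(1-8) show ?case by (rule laplace_weighted_uniqueness)
qed

end
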